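(* Let $s\ge0$, $0<p<\infty$ and $0<q\le\infty$. Then: (a) if $s>0$, there is no reverse Carleson measure for $HF_s^{p,q}$; (b) if $2\le q\le\infty$, a finite positive Borel measure $\mu$ on $\overline{\mathbb{D}}$ is a reverse Carleson measure for $HF_0^{p,q}$ if and only if there is $c>0$ with $\mu(I)\ge c|I|$ for every arc $I\subset\partial\mathbb{D}$; (c) if $0<q<2$, there is no reverse Carleson measure for $HF_0^{p,q}$.
   Context: For $s\ge0$, $0<p<\infty$, $0<q<\infty$ and an integer $m>s$, the holomorphic Triebel–Lizorkin space $HF_s^{p,q}$ consists of holomorphic $f$ on $\mathbb{D}$ with $\|f\|^p_{F_s^{p,q}}=\int_0^1\big(\int_0^1|f^{(m)}(re^{2\pi it})|^q(1-r)^{(m-s)q-1}\,dr\big)^{p/q}dt<\infty$; for $q=\infty$, $\|f\|^p_{F_s^{p,\infty}}=\int_0^1\big(\sup_{0\le r<1}|f^{(m)}(re^{2\pi it})|(1-r)^{m-s}\big)^p dt$. The quasinorm is $\|f\|_{HF_s^{p,q}}=\|f\|_{F_s^{p,q}}+\sum_{j=0}^{m-1}|f^{(j)}(0)|$ (different admissible $m$ give equivalent quasinorms). A finite positive Borel measure $\mu$ on $\overline{\mathbb{D}}$ is a reverse Carleson measure for $HF_s^{p,q}$ if there is $C>0$ with $\|f\|_{HF_s^{p,q}}\le C\|f\|_{L^p(\overline{\mathbb{D}},\mu)}$ for all $f\in HF_s^{p,q}\cap C(\overline{\mathbb{D}})$. $|I|$ denotes normalized arc-length of $I$. *)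

theory Defs
  imports "HOL-Analysis.Analysis"
begin

definition enn_powr :: "ennreal \<Rightarrow> real \<Rightarrow> ennreal" where
  "enn_powr x a = (if x = top then top else ennreal (enn2real x powr a))"

text \<open>The admissible order of differentiation used: the smallest integer m > s.\<close>
definition ord_m :: "real \<Rightarrow> nat" where
  "ord_m s = nat \<lfloor>s\<rfloor> + 1"

definition F_inner :: "(complex \<Rightarrow> complex) \<Rightarrow> real \<Rightarrow> nat \<Rightarrow> real \<Rightarrow> real \<Rightarrow> ennreal" where
  "F_inner f s m q t =
     (\<integral>\<^sup>+ r. ennreal (cmod ((deriv ^^ m) f (complex_of_real r * cis (2 * pi * t))) powr q
                      * (1 - r) powr ((real m - s) * q - 1)) * indicator {0..<1} r \<partial>lborel)"

definition F_inner_inf :: "(complex \<Rightarrow> complex) \<Rightarrow> real \<Rightarrow> nat \<Rightarrow> real \<Rightarrow> ennreal" where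
  "F_inner_inf f s m t =
     (SUP r\<in>{0..<1}. ennreal (cmod ((deriv ^^ m) f (complex_of_real r * cis (2 * pi * t)))
                      * (1 - r) powr (real m - s)))"

text \<open>The p-th power of the F_s^{p,q} quasinorm, q in (0, infinity] encoded as ennreal
  (q = top means q = infinity).\<close>
definition F_pow :: "(complex \<Rightarrow> complex) \<Rightarrow> real \<Rightarrow> real \<Rightarrow> ennreal \<Rightarrow> nat \<Rightarrow> ennreal" where
  "F_pow f s p q m =
     (if q = top then (\<integral>\<^sup>+ t. enn_powr (F_inner_inf f s m t) p * indicator {0..1} t \<partial>lborel)
      else (\<integral>\<^sup>+ t. enn_powr (F_inner f s m (enn2real q) t) (p / enn2real q)
                    * indicator {0..1} t \<partial>lborel))"

definition HF_norm :: "(complex \<Rightarrow> complex) \<Rightarrow> real \<Rightarrow> real \<Rightarrow> ennreal \<Rightarrow> ennreal" where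
  "HF_norm f s p q =
     enn_powr (F_pow f s p q (ord_m s)) (1 / p)
     + ennreal (\<Sum>j<ord_m s. cmod ((deriv ^^ j) f 0))"

definition Lp_norm :: "complex measure \<Rightarrow> real \<Rightarrow> (complex \<Rightarrow> complex) \<Rightarrow> ennreal" where
  "Lp_norm \<mu> p f = enn_powr (\<integral>\<^sup>+ z. ennreal (cmod (f z) powr p) \<partial>\<mu>) (1 / p)"

text \<open>Finite positive Borel measure on the closed unit disc (as a Borel measure on C
  carried by the closed disc).\<close>
definition disc_measure :: "complex measure \<Rightarrow> bool" where
  "disc_measure \<mu> \<longleftrightarrow> sets \<mu> = sets borel \<and> finite_measure \<mu>
      \<and> emeasure \<mu> (- cball 0 1) = 0"

definition reverse_carleson :: "complex measure \<Rightarrow> real \<Rightarrow> real \<Rightarrow> ennreal \<Rightarrow> bool" where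
  "reverse_carleson \<mu> s p q \<longleftrightarrow>
     (\<exists>C>0. \<forall>f. f holomorphic_on ball 0 1 \<longrightarrow> continuous_on (cball 0 1) f
        \<longrightarrow> HF_norm f s p q < top
        \<longrightarrow> HF_norm f s p q \<le> ennreal C * Lp_norm \<mu> p f)"

definition arc :: "real \<Rightarrow> real \<Rightarrow> complex set" where
  "arc a l = (\<lambda>t. cis (2 * pi * t)) ` {a..a + l}"

end

theory Submission
  imports Defs "HOL-Complex_Analysis.Complex_Analysis" "HOL-Computational_Algebra.Fundamental_Theorem_Algebra"
begin

text \<open>For \<open>2 \<le> q\<close> the sufficiency rests on \<open>\<parallel>f\<parallel> \<le> C \<parallel>f\<parallel>\<close> with the \<open>HF_0^{p,q}\<close> norm on the left
  and the norm of \<open>L^p\<close> of the circle on the right, for all \<open>0 < p\<close>. For large exponents \<open>2n\<close> write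
  the \<open>n\<close>-th power of the Littlewood--Paley square function as an iterated radial integral, smooth the
  inner part by subharmonicity and integrate the outer part by Parseval's identity: this gives
  \<open>\<integral>X^n \<le> C \<integral>X^{n-1} M\<close> with a maximal function \<open>M\<close> of Poisson integrals, which a TT* argument bounds
  in \<open>L^2\<close>, hence in all \<open>L^{2^i}\<close>. A function \<open>f\<close> without zeros is a power \<open>F^\<alpha>\<close>, which brings the
  exponent down to \<open>p\<close>, and a polynomial is a difference of two such functions of comparable boundary
  size. The function \<open>f\<close> only meets the measure on the circle, where it dominates arc length.

  The converse tests \<open>z^N P\<close> with \<open>N \<rightarrow> \<infinity>\<close>, since every nonnegative function on the circle is almost
  the modulus of a polynomial. For \<open>0 < s\<close> the monomials \<open>z^N\<close> have norms of size \<open>N^s\<close>. For \<open>q < 2\<close>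
  lacunary polynomials with \<open>n\<close> terms and suitable signs have norm at least \<open>c n^{1/q}\<close>, but size only
  \<open>n^{1/2}\<close> in \<open>L^p(\<mu>)\<close>.\<close>

section \<open>Poisson integrals on the circle\<close>

text \<open>All integral bounds come from Hilbert space tools: Parseval, Cauchy-Schwarz and the
  self-adjointness of Poisson operators, without covering lemmas, interpolation or duality.
  Exponents are powers of two because Jensen's inequality is iterated by squaring. The inequality
  for \<open>X\<close> can only be absorbed when its left side is finite beforehand, so it is run
  for entire functions and carried to the disc algebra by Fatou's lemma. A square function alone
  reaches q = 2; larger q follow from the pointwise bound of (1 - r)|F'| by a maximal function.
  Zeros are an obstacle because a root of f need not exist. Dividing by a Blaschke product would
  leave its derivative to be estimated; instead a zero-free majorant Q with |P| \<le> |Q| makes P +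
  2Q zero free, and only a sum has to be handled. For q < 2 the measure is arbitrary, so no fixed
  signs will do: they are selected through an exponential moment, which controls all p at
  once.\<close>

definition circ :: "real \<Rightarrow> complex" where
  "circ t = cis (2 * pi * t)"

text \<open>Length on [0, 1] is a density, so that the space stays the whole line and measurability
  stays plain Borel measurability.\<close>

definition unit_lborel :: "real measure" where
  "unit_lborel = density lborel (indicator {0..1})"

definition poisson :: "real \<Rightarrow> real \<Rightarrow> real" where
  "poisson r x = (1 - r\<^sup>2) / (cmod (1 - of_real r * circ x))\<^sup>2"

text \<open>The kernel acts on nonnegative extended functions, so Fubini and monotone limits need no
  integrability.\<close>

definition poisson_int :: "real \<Rightarrow> (real \<Rightarrow> ennreal) \<Rightarrow> real \<Rightarrow> ennreal" where
  "poisson_int r u t = (\<integral>\<^sup>+ y. ennreal (poisson r (t - y)) * u y \<partial>unit_lborel)"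

lemma norm_circ [simp]: "cmod (circ t) = 1"
  by (simp add: circ_def)

lemma circ_nonzero [simp]: "circ t \<noteq> 0"
  using norm_circ[of t] by (metis norm_zero zero_neq_one)

lemma continuous_on_circ [continuous_intros]:
  "continuous_on A f \<Longrightarrow> continuous_on A (\<lambda>x. circ (f x))"
  unfolding circ_def cis_conv_exp by (intro continuous_intros)

lemma circ_diff: "circ (x - y) = circ x * cnj (circ y)"
  by (simp add: circ_def cis_cnj cis_mult algebra_simps)

lemma circ_cnj_mult [simp]: "circ x * cnj (circ x) = 1" "cnj (circ x) * circ x = 1"
  by (simp_all add: circ_def cis_cnj cis_mult)

lemma measurable_circ [measurable]: "circ \<in> borel_measurable borel"
  by (intro borel_measurable_continuous_onI continuous_intros)

lemma sets_unit_lborel [measurable_cong, simp]: "sets unit_lborel = sets borel"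
  by (simp add: unit_lborel_def)

lemma space_unit_lborel [simp]: "space unit_lborel = UNIV"
  by (simp add: unit_lborel_def)

lemma nn_integral_unit_lborel:
  assumes [measurable]: "f \<in> borel_measurable borel"
  shows "(\<integral>\<^sup>+ x. f x \<partial>unit_lborel) = (\<integral>\<^sup>+ x. f x * indicator {0..1} x \<partial>lborel)"
  unfolding unit_lborel_def by (subst nn_integral_density) (auto simp: mult.commute)

lemma emeasure_unit_lborel_UNIV [simp]: "emeasure unit_lborel UNIV = 1"
proof -
  have "emeasure unit_lborel UNIV = (\<integral>\<^sup>+ x. 1 \<partial>unit_lborel)" by simp
  also have "\<dots> = 1" by (subst nn_integral_unit_lborel) auto
  finally show ?thesis .
qed

lemma finite_measure_unit_lborel: "finite_measure unit_lborel"
  by (rule finite_measureI) simp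

interpretation UL: finite_measure unit_lborel
  by (rule finite_measure_unit_lborel)

interpretation ULP: pair_sigma_finite unit_lborel unit_lborel
  by standard

lemma AE_unit_lborel: "AE x in unit_lborel. x \<in> {0..1}"
  unfolding unit_lborel_def by (subst AE_density) (auto simp: indicator_def)

lemma nn_integral_unit_lborel_integral:
  fixes f :: "real \<Rightarrow> real"
  assumes [measurable]: "f \<in> borel_measurable borel" and "continuous_on {0..1} f"
    and "\<And>x. x \<in> {0..1} \<Longrightarrow> 0 \<le> f x"
  shows "(\<integral>\<^sup>+ x. ennreal (f x) \<partial>unit_lborel) = ennreal (integral {0..1} f)"
proof -
  have "(f has_integral integral {0..1} f) {0..1}"
    using assms(2) by (intro integrable_integral integrable_continuous_interval)
  from nn_integral_has_integral_lebesgue'[OF assms(3) this] show ?thesis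
    by (subst nn_integral_unit_lborel) auto
qed

lemma nn_integral_unit_lborel_mono:
  assumes "\<And>x. 0 \<le> x \<Longrightarrow> x \<le> 1 \<Longrightarrow> f x \<le> g x"
  shows "(\<integral>\<^sup>+ x. f x \<partial>unit_lborel) \<le> (\<integral>\<^sup>+ x. g x \<partial>unit_lborel)"
proof (rule nn_integral_mono_AE)
  show "AE x in unit_lborel. f x \<le> g x"
    using AE_unit_lborel by eventually_elim (auto intro: assms)
qed

section \<open>The Poisson kernel: representation, semigroup law, comparability of radii\<close>

lemma poisson_denom_pos: "\<lbrakk>0 \<le> r; r < 1\<rbrakk> \<Longrightarrow> 0 < cmod (1 - of_real r * circ x)"
proof -
  assume r: "0 \<le> r" "r < 1"
  have "1 - r \<le> cmod (1 - of_real r * circ x)"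
    using norm_triangle_ineq2[of 1 "of_real r * circ x"] r by (simp add: norm_mult)
  then show ?thesis using r by linarith
qed

lemma poisson_denom_ge: "\<lbrakk>0 \<le> r\<rbrakk> \<Longrightarrow> 1 - r \<le> cmod (1 - of_real r * circ x)"
  using norm_triangle_ineq2[of 1 "of_real r * circ x"] by (simp add: norm_mult)

lemma poisson_nonneg: "\<lbrakk>0 \<le> r; r < 1\<rbrakk> \<Longrightarrow> 0 \<le> poisson r x"
  unfolding poisson_def by (simp add: power_le_one)

lemma measurable_poisson [measurable (raw)]:
  assumes [measurable]: "f \<in> borel_measurable M" "g \<in> borel_measurable M"
  shows "(\<lambda>x. poisson (f x) (g x)) \<in> borel_measurable M"
  unfolding poisson_def by measurable

lemma measurable_poisson_int [measurable]:
  assumes [measurable]: "u \<in> borel_measurable borel"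
  shows "poisson_int r u \<in> borel_measurable borel"
  unfolding poisson_int_def by measurable

lemma poisson_minus_commute: "poisson r (x - y) = poisson r (y - x)"
proof -
  have "circ (y - x) = cnj (circ (x - y))" by (simp add: circ_diff mult.commute)
  then have "cmod (1 - of_real r * circ (y - x)) = cmod (cnj (1 - of_real r * circ (x - y)))"
    by simp
  then show ?thesis unfolding poisson_def by (simp add: complex_mod_cnj del: complex_cnj_diff)
qed

lemma continuous_on_poisson:
  assumes "0 \<le> r" "r < 1" "continuous_on A f"
  shows "continuous_on A (\<lambda>x. poisson r (f x))"
  unfolding poisson_def
  by (intro continuous_intros assms) (use poisson_denom_pos[OF assms(1,2)] in \<open>auto simp: less_le\<close>)

text \<open>Cauchy's formula at \<open>a = r circ t\<close> for
  \<open>h z (1 - r^2) / (1 - cnj a z)\<close>: the extra factor is 1 at \<open>a\<close>, and on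
  the circle its product with the Cauchy kernel is the Poisson kernel.\<close>

theorem poisson_formula:
  assumes cont: "continuous_on (cball 0 1) h" and hol: "h holomorphic_on ball 0 1"
    and r: "0 \<le> r" "r < 1"
  shows "((\<lambda>y. of_real (poisson r (t - y)) * h (circ y)) has_integral h (of_real r * circ t)) {0..1}"
proof -
  define a where "a = of_real r * circ t"
  have na: "cmod a = r" using r by (simp add: a_def norm_mult)
  have nz: "1 - cnj a * z \<noteq> 0" if "cmod z \<le> 1" for z
  proof
    assume "1 - cnj a * z = 0"
    then have "cmod (cnj a * z) = 1" by (metis eq_iff_diff_eq_0 norm_one)
    then have "r * cmod z = 1" by (simp add: norm_mult na)
    then show False using r that
      by (metis mult_left_le_one_le norm_ge_zero not_le mult.commute less_le_not_le order_trans mult_left_le)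
  qed
  define g where "g = (\<lambda>z. h z * of_real (1 - r\<^sup>2) / (1 - cnj a * z))"
  have "continuous_on (cball 0 1) g" unfolding g_def
    using nz by (intro continuous_intros cont) auto
  moreover have "g holomorphic_on ball 0 1" unfolding g_def
    using nz by (intro holomorphic_intros hol) (auto simp: less_imp_le)
  ultimately have "((\<lambda>u. g u / (u - a)) has_contour_integral (2 * of_real pi * \<i> * g a)) (circlepath 0 1)"
    using Cauchy_integral_circlepath[of 0 1 g a] na r by simp
  then have "((\<lambda>x. g (circlepath 0 1 x) / (circlepath 0 1 x - a) *
      vector_derivative (circlepath 0 1) (at x within {0..1})) has_integral (2 * of_real pi * \<i> * g a)) {0..1}"
    by (simp only: has_contour_integral_def)
  then have I: "((\<lambda>x. inverse (2 * of_real pi * \<i>) * (g (circlepath 0 1 x) / (circlepath 0 1 x - a) *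
      vector_derivative (circlepath 0 1) (at x within {0..1}))) has_integral
        inverse (2 * of_real pi * \<i>) * (2 * of_real pi * \<i> * g a)) {0..1}"
    by (rule has_integral_mult_right)
  have E: "inverse (2 * of_real pi * \<i>) * (2 * of_real pi * \<i> * g a) = h a"
  proof -
    have "1 - cnj a * a = of_real (1 - r\<^sup>2)"
      using complex_norm_square[of a] na by (simp add: mult.commute)
    moreover have "complex_of_real (1 - r\<^sup>2) \<noteq> 0"
      unfolding of_real_eq_0_iff using r by (simp add: power2_eq_1_iff)
    ultimately have "g a = h a" by (simp add: g_def del: of_real_diff of_real_power)
    then show ?thesis by (simp add: field_simps)
  qed
  have "inverse (2 * of_real pi * \<i>) * (g (circlepath 0 1 x) / (circlepath 0 1 x - a) *
      vector_derivative (circlepath 0 1) (at x within {0..1})) =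
      of_real (poisson r (t - x)) * h (circ x)" if "x \<in> {0..1}" for x
  proof -
    have c: "circlepath 0 1 x = circ x"
      by (simp add: circlepath circ_def cis_conv_exp mult_ac)
    have d: "vector_derivative (circlepath 0 1) (at x within {0..1}) = (2 * of_real pi * \<i>) * circ x"
      using that by (simp add: vector_derivative_circlepath01 circ_def cis_conv_exp mult_ac)
    have 1: "circ x - a = circ x * (1 - of_real r * circ (t - x))"
      by (simp add: a_def circ_diff algebra_simps)
    have 2: "1 - cnj a * circ x = cnj (1 - of_real r * circ (t - x))"
      by (simp add: a_def circ_diff algebra_simps)
    have 3: "of_real ((cmod (1 - of_real r * circ (t - x)))\<^sup>2) =
      (1 - of_real r * circ (t - x)) * cnj (1 - of_real r * circ (t - x))"
      by (rule complex_norm_square)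
    have nzw: "(1 - of_real r * circ (t - x)) \<noteq> 0"
      using poisson_denom_pos[OF r, of "t - x"] by auto
    \<comment> \<open>The cancellation is stated for free variables, so that the arithmetic never
      meets the trigonometric terms.\<close>
    have gen: "inverse P * (H * K / w' / (v * w) * (P * v)) = K / (w * w') * H"
      if "P \<noteq> 0" "v \<noteq> 0" "w \<noteq> 0" "w' \<noteq> 0" for P H K v w w' :: complex
      using that by (simp add: field_simps)
    show ?thesis
      unfolding c d g_def 1 2 poisson_def of_real_divide 3
      by (rule gen) (use nzw in \<open>simp_all only: complex_cnj_zero_iff circ_nonzero, simp_all\<close>)
  qed
  note K = this
  show ?thesis
    unfolding a_def[symmetric] using has_integral_eq[OF K I] unfolding E .
qed

lemma poisson_formula_Re:
  assumes "continuous_on (cball 0 1) h" "h holomorphic_on ball 0 1" "0 \<le> r" "r < 1"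
  shows "integral {0..1} (\<lambda>y. poisson r (t - y) * Re (h (circ y))) = Re (h (of_real r * circ t))"
  using has_integral_linear[OF poisson_formula[OF assms, of t] bounded_linear_Re]
  by (simp add: o_def integral_unique)

lemma poisson_integral_1:
  assumes "0 \<le> r" "r < 1"
  shows "(\<integral>\<^sup>+ y. ennreal (poisson r (t - y)) \<partial>unit_lborel) = 1"
proof -
  have "integral {0..1} (\<lambda>y. poisson r (t - y)) = 1"
    using poisson_formula_Re[of "\<lambda>_. 1", OF _ _ assms] by simp
  then show ?thesis
    by (subst nn_integral_unit_lborel_integral)
       (auto intro!: continuous_on_poisson continuous_intros poisson_nonneg assms)
qed

lemma poisson_integral_1':
  assumes "0 \<le> r" "r < 1"
  shows "(\<integral>\<^sup>+ y. ennreal (poisson r (y - t)) \<partial>unit_lborel) = 1"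
  using poisson_integral_1[OF assms, of t] by (simp add: poisson_minus_commute[of r _ t])

text \<open>Subharmonicity of the modulus, by the triangle inequality under the Poisson integral.
  Applied to \<open>h^2\<close> it covers squares, applied to \<open>exp (p L)\<close> every power
  of a zero-free function.\<close>

lemma norm_le_poisson_int:
  assumes cont: "continuous_on (cball 0 1) h" and hol: "h holomorphic_on ball 0 1"
    and r: "0 \<le> r" "r < 1" and m: "(\<lambda>t. cmod (h (circ t))) \<in> borel_measurable borel"
  shows "ennreal (cmod (h (of_real r * circ t))) \<le> poisson_int r (\<lambda>y. ennreal (cmod (h (circ y)))) t"
proof -
  have c: "continuous_on {0..1} (\<lambda>y. h (circ y))"
    by (intro continuous_on_compose2[OF cont]) (auto intro!: continuous_intros)
  note I = poisson_formula[OF cont hol r, of t]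
  have "cmod (h (of_real r * circ t)) = cmod (integral {0..1} (\<lambda>y. of_real (poisson r (t - y)) * h (circ y)))"
    using integral_unique[OF I] by simp
  also have "\<dots> \<le> integral {0..1} (\<lambda>y. poisson r (t - y) * cmod (h (circ y)))"
    by (intro integral_norm_bound_integral has_integral_integrable[OF I] integrable_continuous_interval
        continuous_intros continuous_on_poisson r c)
       (auto simp: norm_mult poisson_nonneg r)
  finally have "ennreal (cmod (h (of_real r * circ t))) \<le>
     ennreal (integral {0..1} (\<lambda>y. poisson r (t - y) * cmod (h (circ y))))"
    by (rule ennreal_leI)
  also have "\<dots> = (\<integral>\<^sup>+ y. ennreal (poisson r (t - y) * cmod (h (circ y))) \<partial>unit_lborel)"
    using m by (subst nn_integral_unit_lborel_integral)
       (auto intro!: continuous_intros continuous_on_poisson r c mult_nonneg_nonneg poisson_nonneg)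
  also have "\<dots> = poisson_int r (\<lambda>y. ennreal (cmod (h (circ y)))) t"
    unfolding poisson_int_def by (simp add: ennreal_mult poisson_nonneg r)
  finally show ?thesis .
qed

lemma poisson_eq_Re:
  assumes "0 \<le> r" "r < 1"
  shows "poisson r (x - y) = Re ((1 + of_real r * circ (x - y)) / (1 - of_real r * circ (x - y)))"
proof -
  define w where "w = of_real r * circ (x - y)"
  have n: "cmod w = r" using assms by (simp add: w_def norm_mult)
  have "1 - w \<noteq> 0" using n assms by auto
  have "(1 + w) / (1 - w) = (1 + w) * cnj (1 - w) / of_real ((cmod (1 - w))\<^sup>2)"
    by (rule complex_div_cnj)
  also have "Re \<dots> = Re ((1 + w) * cnj (1 - w)) / (cmod (1 - w))\<^sup>2"
    by (rule Re_divide_of_real)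
  also have "Re ((1 + w) * cnj (1 - w)) = 1 - (cmod w)\<^sup>2"
    by (simp only: cmod_power2) (simp add: algebra_simps power2_eq_square)
  finally show ?thesis unfolding poisson_def w_def[symmetric] n ..
qed

text \<open>As a function of \<open>y\<close> the kernel is the real part of
  \<open>(1 + u) / (1 - u)\<close> with \<open>u = r circ (y - x)\<close>, which extends
  holomorphically into the disc; the Poisson formula at radius \<open>s\<close> evaluates this
  extension.\<close>

lemma poisson_semigroup:
  assumes r: "0 \<le> r" "r < 1" and s: "0 \<le> s" "s < 1"
  shows "(\<integral>\<^sup>+ y. ennreal (poisson r (y - x)) * ennreal (poisson s (z - y)) \<partial>unit_lborel)
         = ennreal (poisson (r * s) (z - x))"
proof -
  define h where "h = (\<lambda>w. (1 + of_real r * w * cnj (circ x)) / (1 - of_real r * w * cnj (circ x)))"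
  have nz: "1 - of_real r * w * cnj (circ x) \<noteq> 0" if "cmod w \<le> 1" for w
  proof
    assume "1 - of_real r * w * cnj (circ x) = 0"
    then have "cmod (of_real r * w * cnj (circ x)) = 1" by (metis eq_iff_diff_eq_0 norm_one)
    then have "r * cmod w = 1" using r by (simp add: norm_mult)
    moreover have "r * cmod w \<le> r * 1" using that r by (intro mult_left_mono) auto
    ultimately show False using r by simp
  qed
  have *: "integral {0..1} (\<lambda>y. poisson s (z - y) * Re (h (circ y))) = Re (h (of_real s * circ z))"
    unfolding h_def using nz
    by (intro poisson_formula_Re s continuous_intros holomorphic_intros) (auto simp: less_imp_le)
  have "r * s \<le> r" using r s by (intro mult_left_le) auto
  then have rs: "0 \<le> r * s" "r * s < 1" using r s by auto
  have 1: "Re (h (circ y)) = poisson r (y - x)" for y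
    unfolding h_def by (subst poisson_eq_Re[OF r]) (simp add: circ_diff mult_ac)
  have 2: "Re (h (of_real s * circ z)) = poisson (r * s) (z - x)"
    unfolding h_def by (subst poisson_eq_Re[OF rs]) (simp add: circ_diff mult_ac)
  have "(\<integral>\<^sup>+ y. ennreal (poisson r (y - x)) * ennreal (poisson s (z - y)) \<partial>unit_lborel) =
    (\<integral>\<^sup>+ y. ennreal (poisson s (z - y) * poisson r (y - x)) \<partial>unit_lborel)"
    by (simp add: ennreal_mult poisson_nonneg r s mult.commute)
  also have "\<dots> = ennreal (integral {0..1} (\<lambda>y. poisson s (z - y) * poisson r (y - x)))"
    by (subst nn_integral_unit_lborel_integral)
       (auto intro!: continuous_intros continuous_on_poisson r s mult_nonneg_nonneg poisson_nonneg)
  finally show ?thesis using * by (simp add: 1 2)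
qed

text \<open>Moving the radius from \<open>s\<close> to \<open>r\<close> changes the denominator,
  before squaring, by at most \<open>1 - s\<close>, which is itself at most the denominator at
  \<open>s\<close>. Squaring the factor 2 gives 4, and the numerators add another 2.\<close>

lemma poisson_compare:
  assumes r: "0 \<le> r" "r < 1" and s: "0 \<le> s" "s < 1"
    and 1: "\<bar>s - r\<bar> \<le> 1 - s" and 2: "1 - s\<^sup>2 \<le> 2 * (1 - r\<^sup>2)"
  shows "poisson s x \<le> 8 * poisson r x"
proof -
  let ?a = "cmod (1 - of_real r * circ x)" and ?b = "cmod (1 - of_real s * circ x)"
  have "?a \<le> ?b + cmod (of_real (s - r) * circ x)"
    using norm_triangle_ineq[of "1 - of_real s * circ x" "of_real (s - r) * circ x"]
    by (simp add: algebra_simps)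
  also have "cmod (of_real (s - r) * circ x) = \<bar>s - r\<bar>" by (simp only: norm_mult norm_of_real norm_circ mult_1_right)
  also have "\<dots> \<le> ?b" using 1 poisson_denom_ge[OF s(1), of x] by linarith
  finally have ab: "?a \<le> 2 * ?b" by simp
  have p: "0 < ?a" "0 < ?b" using poisson_denom_pos r s by auto
  have "?a\<^sup>2 \<le> (2 * ?b)\<^sup>2" using ab p by (intro power_mono) auto
  then have "(1 - s\<^sup>2) * ?a\<^sup>2 \<le> (2 * (1 - r\<^sup>2)) * (4 * ?b\<^sup>2)"
    using 2 s r by (intro mult_mono) (auto simp: power_mult_distrib power_le_one)
  then show ?thesis unfolding poisson_def using p
    by (simp add: field_simps)
qed

text \<open>\<open>1 - (r s)^2 \<le> 1 - r^4 = (1 - r^2) (1 + r^2)\<close>, at most twice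
  \<open>1 - r^2\<close>. A composition of two Poisson operators is thus no worse than the one of
  smaller radius.\<close>

lemma poisson_mult_compare:
  assumes r: "0 \<le> r" "r < 1" and s: "r \<le> s" "s < 1"
  shows "poisson (r * s) x \<le> 8 * poisson r x"
proof (rule poisson_compare)
  have "r * s \<le> r" using r s by (intro mult_left_le) auto
  then show "r * s < 1" using r by simp
  have "r * (1 - s) \<le> 1 * (1 - s)" using r s by (intro mult_right_mono) auto
  moreover have "r * s \<le> s" using r s by (intro mult_left_le_one_le) auto
  ultimately show "\<bar>r * s - r\<bar> \<le> 1 - r * s" using \<open>r * s \<le> r\<close> by (simp add: algebra_simps)
  have "r * r \<le> r * s" using r s by (intro mult_left_mono) auto
  then have "(r * r)\<^sup>2 \<le> (r * s)\<^sup>2" using r s by (intro power_mono) auto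
  moreover have "(1 - r\<^sup>2) * (1 + r\<^sup>2) \<le> (1 - r\<^sup>2) * 2" using r by (intro mult_left_mono) (auto simp: power_le_one)
  ultimately show "1 - (r * s)\<^sup>2 \<le> 2 * (1 - r\<^sup>2)" by (simp add: algebra_simps power2_eq_square)
qed (use r s in auto)

section \<open>The maximal function of Poisson integrals\<close>

lemma ennreal_power_le_imp_le:
  fixes x y :: ennreal
  assumes "x ^ k \<le> y ^ k" "0 < k"
  shows "x \<le> y"
proof (cases "y = top")
  case False
  then obtain b where b: "y = ennreal b" "0 \<le> b" by (cases y) auto
  have "x \<noteq> top" using assms b by (auto simp: ennreal_power top_unique)
  then obtain a where a: "x = ennreal a" "0 \<le> a" by (cases x) auto
  then have "a ^ k \<le> b ^ k" using assms b by (simp add: ennreal_power)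
  then show ?thesis using a b assms by (simp add: ennreal_leI)
qed simp

text \<open>The bound is written as the power of its own root; the root bounds each member and hence
  the supremum.\<close>

lemma SUP_power_le_ennreal:
  fixes X :: "'a \<Rightarrow> ennreal"
  assumes "\<And>i. i \<in> I \<Longrightarrow> X i ^ k \<le> B" "0 < k"
  shows "(SUP i\<in>I. X i) ^ k \<le> B"
proof (cases "B = top")
  case False
  then obtain b where b: "B = ennreal b" "0 \<le> b" by (cases B) auto
  have B: "B = ennreal (root k b) ^ k" using b assms(2) by (simp add: ennreal_power)
  have "(SUP i\<in>I. X i) \<le> ennreal (root k b)"
  proof (rule SUP_least)
    fix i assume "i \<in> I"
    then have "X i ^ k \<le> ennreal (root k b) ^ k" unfolding B[symmetric] by (rule assms)
    then show "X i \<le> ennreal (root k b)" using assms(2) by (rule ennreal_power_le_imp_le)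
  qed
  then have "(SUP i\<in>I. X i) ^ k \<le> ennreal (root k b) ^ k" by (rule power_mono_ennreal)
  then show ?thesis unfolding B[symmetric] .
qed simp

section \<open>Poisson operators on nonnegative functions\<close>

lemma poisson_int_mono:
  "(\<And>y. u y \<le> v y) \<Longrightarrow> poisson_int r u t \<le> poisson_int r v t"
  unfolding poisson_int_def by (intro nn_integral_mono mult_left_mono) auto

lemma poisson_int_sum:
  assumes [measurable]: "\<And>k. k \<in> K \<Longrightarrow> u k \<in> borel_measurable borel"
  shows "poisson_int r (\<lambda>y. \<Sum>k\<in>K. u k y) t = (\<Sum>k\<in>K. poisson_int r (u k) t)"
  unfolding poisson_int_def sum_distrib_left by (subst nn_integral_sum) auto

text \<open>The kernel is even, so the operator is self-adjoint; every later transfer of a kernel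
  from one factor to the other is this identity.\<close>

lemma poisson_int_symmetric:
  assumes [measurable]: "f \<in> borel_measurable borel" "g \<in> borel_measurable borel"
  shows "(\<integral>\<^sup>+ x. f x * poisson_int r g x \<partial>unit_lborel) = (\<integral>\<^sup>+ y. poisson_int r f y * g y \<partial>unit_lborel)"
proof -
  have "(\<integral>\<^sup>+ x. f x * poisson_int r g x \<partial>unit_lborel) =
    (\<integral>\<^sup>+ x. \<integral>\<^sup>+ y. f x * (ennreal (poisson r (x - y)) * g y) \<partial>unit_lborel \<partial>unit_lborel)"
    unfolding poisson_int_def by (subst nn_integral_cmult) auto
  also have "\<dots> = (\<integral>\<^sup>+ y. \<integral>\<^sup>+ x. f x * (ennreal (poisson r (x - y)) * g y) \<partial>unit_lborel \<partial>unit_lborel)"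
    by (rule ULP.Fubini') measurable
  also have "\<dots> = (\<integral>\<^sup>+ y. \<integral>\<^sup>+ x. (ennreal (poisson r (y - x)) * f x) * g y \<partial>unit_lborel \<partial>unit_lborel)"
    by (intro nn_integral_cong) (subst poisson_minus_commute, simp only: mult_ac)
  also have "\<dots> = (\<integral>\<^sup>+ y. poisson_int r f y * g y \<partial>unit_lborel)"
    unfolding poisson_int_def by (subst nn_integral_multc) auto
  finally show ?thesis .
qed

lemma poisson_int_compose:
  assumes [measurable]: "u \<in> borel_measurable borel"
    and r: "0 \<le> r" "r < 1" and s: "0 \<le> s" "s < 1"
  shows "poisson_int r (poisson_int s u) t = poisson_int (r * s) u t"
proof -
  have "poisson_int r (poisson_int s u) t =
    (\<integral>\<^sup>+ y. \<integral>\<^sup>+ z. ennreal (poisson r (t - y)) * (ennreal (poisson s (y - z)) * u z) \<partial>unit_lborel \<partial>unit_lborel)"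
    unfolding poisson_int_def by (subst nn_integral_cmult) auto
  also have "\<dots> = (\<integral>\<^sup>+ z. \<integral>\<^sup>+ y. ennreal (poisson r (t - y)) * (ennreal (poisson s (y - z)) * u z) \<partial>unit_lborel \<partial>unit_lborel)"
    by (rule ULP.Fubini') measurable
  also have "\<dots> = (\<integral>\<^sup>+ z. \<integral>\<^sup>+ y. (ennreal (poisson s (y - z)) * ennreal (poisson r (t - y))) * u z \<partial>unit_lborel \<partial>unit_lborel)"
    by (simp add: mult_ac)
  also have "\<dots> = (\<integral>\<^sup>+ z. ennreal (poisson (s * r) (t - z)) * u z \<partial>unit_lborel)"
    by (subst nn_integral_multc) (auto simp: poisson_semigroup r s)
  finally show ?thesis by (simp add: poisson_int_def mult.commute)
qed

lemma poisson_int_compare: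
  assumes [measurable]: "u \<in> borel_measurable borel"
    and r: "0 \<le> r" "r < 1" and s: "\<And>x. poisson s x \<le> 8 * poisson r x"
  shows "poisson_int s u t \<le> 8 * poisson_int r u t"
proof -
  have "poisson_int s u t \<le> (\<integral>\<^sup>+ y. 8 * (ennreal (poisson r (t - y)) * u y) \<partial>unit_lborel)"
    unfolding poisson_int_def
  proof (rule nn_integral_mono)
    fix y
    have "ennreal (poisson s (t - y)) \<le> ennreal (8 * poisson r (t - y))" by (intro ennreal_leI s)
    also have "\<dots> = 8 * ennreal (poisson r (t - y))"
      by (subst ennreal_mult) (auto simp: poisson_nonneg r)
    finally show "ennreal (poisson s (t - y)) * u y \<le> 8 * (ennreal (poisson r (t - y)) * u y)"
      by (metis mult.assoc mult_right_mono zero_le)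
  qed
  also have "\<dots> = 8 * poisson_int r u t"
    unfolding poisson_int_def by (rule nn_integral_cmult) measurable
  finally show ?thesis .
qed

lemma poisson_int_mult_le:
  assumes [measurable]: "u \<in> borel_measurable borel"
    and r: "0 \<le> r" "r < 1" and s: "0 \<le> s" "s < 1"
  shows "poisson_int (r * s) u t \<le> 8 * (poisson_int r u t + poisson_int s u t)"
proof (cases "r \<le> s")
  case True
  then have "poisson_int (r * s) u t \<le> 8 * poisson_int r u t"
    using r s by (intro poisson_int_compare poisson_mult_compare) auto
  then show ?thesis by (simp add: distrib_left add_increasing2)
next
  case False
  then have "poisson_int (s * r) u t \<le> 8 * poisson_int s u t"
    using r s by (intro poisson_int_compare poisson_mult_compare) auto
  then show ?thesis by (simp add: distrib_left add_increasing mult.commute)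
qed

text \<open>Countably many radii keep suprema measurable. The gaps \<open>1 - rad k\<close> are the
  reciprocals of the positive integers, so every radius in [0, 1) is comparable to one of them;
  \<open>rad 0 = 0\<close> covers the centre.\<close>

definition rad :: "nat \<Rightarrow> real" where
  "rad k = 1 - 1 / (real k + 1)"

lemma rad_bounds: "0 \<le> rad k" "rad k < 1"
  by (auto simp: rad_def)

text \<open>The truncated supremum is attained, so a maximising index can be selected, and it has
  some finite L^2 bound, without which no bound could be improved.\<close>

definition poisson_max_upto :: "nat \<Rightarrow> (real \<Rightarrow> ennreal) \<Rightarrow> real \<Rightarrow> ennreal" where
  "poisson_max_upto K u t = (SUP k\<in>{..K}. poisson_int (rad k) u t)"

definition poisson_max :: "(real \<Rightarrow> ennreal) \<Rightarrow> real \<Rightarrow> ennreal" where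
  "poisson_max u t = (SUP k. poisson_int (rad k) u t)"

lemma measurable_poisson_max_upto [measurable]:
  assumes [measurable]: "u \<in> borel_measurable borel"
  shows "poisson_max_upto K u \<in> borel_measurable borel"
  unfolding poisson_max_upto_def by measurable

lemma measurable_poisson_max [measurable]:
  assumes [measurable]: "u \<in> borel_measurable borel"
  shows "poisson_max u \<in> borel_measurable borel"
  unfolding poisson_max_def by measurable

lemma poisson_int_le_max_upto: "k \<le> K \<Longrightarrow> poisson_int (rad k) u t \<le> poisson_max_upto K u t"
  unfolding poisson_max_upto_def by (intro SUP_upper) auto

lemma poisson_max_upto_attained: "\<exists>k\<le>K. poisson_int (rad k) u t = poisson_max_upto K u t"
proof -
  let ?A = "(\<lambda>k. poisson_int (rad k) u t) ` {..K}"
  have "Max ?A \<in> ?A" by (rule Max_in) auto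
  moreover have "Max ?A = Sup ?A" by (rule Max_Sup) auto
  ultimately show ?thesis unfolding poisson_max_upto_def by auto
qed

text \<open>\<open>A\<close> bounds the square of the L^2 operator norm of the truncated maximal
  operator.\<close>

definition poisson_max_bound :: "nat \<Rightarrow> real \<Rightarrow> bool" where
  "poisson_max_bound K A \<longleftrightarrow> 0 \<le> A \<and> (\<forall>u \<in> borel_measurable borel.
     (\<integral>\<^sup>+ t. (poisson_max_upto K u t)\<^sup>2 \<partial>unit_lborel) \<le> ennreal A * (\<integral>\<^sup>+ t. (u t)\<^sup>2 \<partial>unit_lborel))"

text \<open>Jensen's inequality for the probability density given by the kernel: Cauchy-Schwarz
  after splitting off its square root.\<close>

lemma poisson_int_square_le:
  assumes [measurable]: "u \<in> borel_measurable borel" and r: "0 \<le> r" "r < 1"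
  shows "(poisson_int r u t)\<^sup>2 \<le> poisson_int r (\<lambda>y. (u y)\<^sup>2) t"
proof -
  let ?k = "\<lambda>y. ennreal (sqrt (poisson r (t - y)))"
  have k: "(?k y)\<^sup>2 = ennreal (poisson r (t - y))" for y
    by (simp add: ennreal_power poisson_nonneg r)
  have "(poisson_int r u t)\<^sup>2 = (\<integral>\<^sup>+ y. ?k y * (?k y * u y) \<partial>unit_lborel)\<^sup>2"
    unfolding poisson_int_def k[symmetric] by (simp add: power2_eq_square mult_ac)
  also have "\<dots> \<le> (\<integral>\<^sup>+ y. (?k y)\<^sup>2 \<partial>unit_lborel) * (\<integral>\<^sup>+ y. (?k y * u y)\<^sup>2 \<partial>unit_lborel)"
    by (rule Cauchy_Schwarz_nn_integral) measurable
  also have "\<dots> = poisson_int r (\<lambda>y. (u y)\<^sup>2) t"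
    unfolding power_mult_distrib k poisson_int_def by (simp add: poisson_integral_1 r)
  finally show ?thesis .
qed

lemma integral_poisson_int:
  assumes [measurable]: "u \<in> borel_measurable borel" and r: "0 \<le> r" "r < 1"
  shows "(\<integral>\<^sup>+ t. poisson_int r u t \<partial>unit_lborel) = (\<integral>\<^sup>+ t. u t \<partial>unit_lborel)"
proof -
  have "poisson_int r (\<lambda>_. 1) t = 1" for t
    by (simp add: poisson_int_def poisson_integral_1 r)
  then show ?thesis
    using poisson_int_symmetric[of "\<lambda>_. 1" u r] by simp
qed

text \<open>The square of a maximum is at most the sum of the squares, and Poisson operators
  preserve integrals. The constant grows with \<open>K\<close> and is only a starting point.\<close>

lemma poisson_max_bound_initial: "poisson_max_bound K (real (Suc K))"
  unfolding poisson_max_bound_def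
proof (intro conjI ballI)
  fix u :: "real \<Rightarrow> ennreal" assume [measurable]: "u \<in> borel_measurable borel"
  have "(\<integral>\<^sup>+ t. (poisson_max_upto K u t)\<^sup>2 \<partial>unit_lborel) \<le>
      (\<integral>\<^sup>+ t. (\<Sum>k\<le>K. poisson_int (rad k) (\<lambda>y. (u y)\<^sup>2) t) \<partial>unit_lborel)"
  proof (rule nn_integral_mono)
    fix t
    obtain k where k: "k \<le> K" "poisson_int (rad k) u t = poisson_max_upto K u t"
      using poisson_max_upto_attained by blast
    have "(poisson_max_upto K u t)\<^sup>2 \<le> poisson_int (rad k) (\<lambda>y. (u y)\<^sup>2) t"
      unfolding k(2)[symmetric] by (intro poisson_int_square_le rad_bounds) measurable
    also have "\<dots> \<le> (\<Sum>k\<le>K. poisson_int (rad k) (\<lambda>y. (u y)\<^sup>2) t)"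
      using k by (intro member_le_sum) auto
    finally show "(poisson_max_upto K u t)\<^sup>2 \<le> (\<Sum>k\<le>K. poisson_int (rad k) (\<lambda>y. (u y)\<^sup>2) t)" .
  qed
  also have "\<dots> = (\<Sum>k\<le>K. \<integral>\<^sup>+ t. poisson_int (rad k) (\<lambda>y. (u y)\<^sup>2) t \<partial>unit_lborel)"
    by (rule nn_integral_sum) measurable
  also have "\<dots> = ennreal (real (Suc K)) * (\<integral>\<^sup>+ t. (u t)\<^sup>2 \<partial>unit_lborel)"
    by (subst integral_poisson_int) (auto simp: rad_bounds ennreal_of_nat_eq_real_of_nat[symmetric] simp del: of_nat_Suc)
  finally show "(\<integral>\<^sup>+ t. (poisson_max_upto K u t)\<^sup>2 \<partial>unit_lborel) \<le> ennreal (real (Suc K)) * (\<integral>\<^sup>+ t. (u t)\<^sup>2 \<partial>unit_lborel)" .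
qed simp

text \<open>The TT* argument: for the linearised maximal operator, the operator and its adjoint
  compose to a kernel dominated by the operator itself, because the Poisson kernels form a
  semigroup whose members are comparable with the member of smaller index.\<close>

lemma poisson_max_adjoint:
  assumes [measurable]: "\<And>k. g k \<in> borel_measurable borel"
  shows "(\<integral>\<^sup>+ t. (\<Sum>k\<le>K. poisson_int (rad k) (g k) t)\<^sup>2 \<partial>unit_lborel)
    \<le> 16 * (\<integral>\<^sup>+ t. (\<Sum>k\<le>K. g k t) * poisson_max_upto K (\<lambda>t. \<Sum>k\<le>K. g k t) t \<partial>unit_lborel)"
proof -
  define G where "G t = (\<Sum>k\<le>K. g k t)" for t
  have [measurable]: "G \<in> borel_measurable borel" unfolding G_def by measurable
  define I where "I j k = (\<integral>\<^sup>+ t. g j t * poisson_int (rad j) (g k) t \<partial>unit_lborel)" for j k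
  have "(\<integral>\<^sup>+ t. (\<Sum>k\<le>K. poisson_int (rad k) (g k) t)\<^sup>2 \<partial>unit_lborel) =
    (\<Sum>j\<le>K. \<Sum>k\<le>K. \<integral>\<^sup>+ t. poisson_int (rad j) (g j) t * poisson_int (rad k) (g k) t \<partial>unit_lborel)"
    unfolding power2_eq_square sum_product by (simp add: nn_integral_sum)
  \<comment> \<open>Symmetry and the semigroup law turn the product into one operator of radius
    \<open>rad j * rad k\<close>, bounded by 8 times the sum of both operators. The two resulting
    double sums are transposes of each other, hence 16.\<close>
  also have "\<dots> \<le> (\<Sum>j\<le>K. \<Sum>k\<le>K. 8 * (I j k + I k j))"
  proof (intro sum_mono)
    fix j k
    have "(\<integral>\<^sup>+ t. poisson_int (rad j) (g j) t * poisson_int (rad k) (g k) t \<partial>unit_lborel)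
      = (\<integral>\<^sup>+ t. g j t * poisson_int (rad j * rad k) (g k) t \<partial>unit_lborel)"
      by (subst poisson_int_symmetric[symmetric]) (auto simp: poisson_int_compose rad_bounds)
    also have "\<dots> \<le> (\<integral>\<^sup>+ t. g j t * (8 * (poisson_int (rad j) (g k) t + poisson_int (rad k) (g k) t)) \<partial>unit_lborel)"
      by (intro nn_integral_mono mult_left_mono poisson_int_mult_le rad_bounds) auto
    also have "\<dots> = (\<integral>\<^sup>+ t. 8 * (g j t * poisson_int (rad j) (g k) t + g j t * poisson_int (rad k) (g k) t) \<partial>unit_lborel)"
      by (simp add: algebra_simps)
    also have "\<dots> = 8 * (I j k + (\<integral>\<^sup>+ t. g j t * poisson_int (rad k) (g k) t \<partial>unit_lborel))"
      unfolding I_def by (simp add: nn_integral_cmult nn_integral_add)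
    also have "(\<integral>\<^sup>+ t. g j t * poisson_int (rad k) (g k) t \<partial>unit_lborel) = I k j"
      unfolding I_def by (subst poisson_int_symmetric) (auto simp: mult.commute)
    finally show "(\<integral>\<^sup>+ t. poisson_int (rad j) (g j) t * poisson_int (rad k) (g k) t \<partial>unit_lborel) \<le> 8 * (I j k + I k j)" .
  qed
  also have "\<dots> = 8 * ((\<Sum>j\<le>K. \<Sum>k\<le>K. I j k) + (\<Sum>j\<le>K. \<Sum>k\<le>K. I k j))"
    by (simp add: sum.distrib sum_distrib_left distrib_left)
  also have "(\<Sum>j\<le>K. \<Sum>k\<le>K. I k j) = (\<Sum>j\<le>K. \<Sum>k\<le>K. I j k)"
    by (rule sum.swap)
  also have "(\<Sum>j\<le>K. \<Sum>k\<le>K. I j k) = (\<Sum>j\<le>K. \<integral>\<^sup>+ t. g j t * poisson_int (rad j) G t \<partial>unit_lborel)"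
    unfolding I_def G_def[abs_def]
    by (intro sum.cong refl) (simp add: poisson_int_sum sum_distrib_left nn_integral_sum)
  also have "8 * (\<dots> + \<dots>) = 16 * \<dots>" unfolding mult_2[symmetric] by (simp add: mult.assoc[symmetric])
  also have "(\<Sum>j\<le>K. \<integral>\<^sup>+ t. g j t * poisson_int (rad j) G t \<partial>unit_lborel) \<le>
      (\<Sum>j\<le>K. \<integral>\<^sup>+ t. g j t * poisson_max_upto K G t \<partial>unit_lborel)"
    by (intro sum_mono nn_integral_mono mult_left_mono poisson_int_le_max_upto) auto
  also have "\<dots> = (\<integral>\<^sup>+ t. G t * poisson_max_upto K G t \<partial>unit_lborel)"
    unfolding G_def[of t for t] sum_distrib_right
    by (subst nn_integral_sum) (auto simp flip: G_def[abs_def])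
  finally show ?thesis unfolding G_def[abs_def] by (simp add: mult_left_mono)
qed

text \<open>Let \<open>N\<close> be the squared norm and \<open>g\<close> the maximal function of
  \<open>u\<close>. Linearising gives \<open>(N g)^2 \<le> V * N u\<close>, with \<open>V\<close>
  the squared norm of the adjoint applied to the pieces of \<open>g\<close>. The adjoint estimate
  and the old bound give \<open>V \<le> 16 * sqrt A * N g\<close>, and one factor \<open>N g\<close>
  cancels.\<close>

lemma poisson_max_bound_improve:
  assumes A: "poisson_max_bound K A"
  shows "poisson_max_bound K (16 * sqrt A)"
  unfolding poisson_max_bound_def
proof (intro conjI ballI)
  have A0: "0 \<le> A" using A by (simp add: poisson_max_bound_def)
  then show "0 \<le> 16 * sqrt A" by simp
  fix u :: "real \<Rightarrow> ennreal" assume [measurable]: "u \<in> borel_measurable borel"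
  define N where "N v = (\<integral>\<^sup>+ t. (v t)\<^sup>2 \<partial>unit_lborel)" for v :: "real \<Rightarrow> ennreal"
  have AN: "N (poisson_max_upto K v) \<le> ennreal A * N v" if "v \<in> borel_measurable borel" for v
    using A that by (auto simp: poisson_max_bound_def N_def)
  define g where "g = poisson_max_upto K u"
  have [measurable]: "g \<in> borel_measurable borel" unfolding g_def by measurable
  \<comment> \<open>Taking the first maximising index makes the sets \<open>S k\<close> disjoint and
    measurable; on \<open>S k\<close> the maximal function is the Poisson integral with index
    \<open>k\<close>, so the supremum becomes a linear operation.\<close>
  define S where "S k = {t. poisson_int (rad k) u t = g t \<and> (\<forall>j<k. poisson_int (rad j) u t \<noteq> g t)}" for k
  have [measurable]: "S k \<in> sets borel" for k unfolding S_def by measurable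
  define h where "h k t = indicator (S k) t * g t" for k t
  have [measurable]: "h k \<in> borel_measurable borel" for k unfolding h_def by measurable
  have ind: "(\<Sum>k\<le>K. indicator (S k) t) = (1::ennreal)" for t
  proof -
    obtain k where k: "k \<le> K" "poisson_int (rad k) u t = g t"
      using poisson_max_upto_attained unfolding g_def by blast
    define k0 where "k0 = (LEAST k. poisson_int (rad k) u t = g t)"
    have k0: "poisson_int (rad k0) u t = g t" unfolding k0_def by (rule LeastI) (rule k)
    have least: "k0 \<le> j" if "poisson_int (rad j) u t = g t" for j
      unfolding k0_def using that by (rule Least_le)
    have "indicator (S j) t = (if j = k0 then 1 else 0 :: ennreal)" for j
      using k0 least unfolding S_def indicator_def by (auto simp: not_le dest: leD) (meson leD nat_neq_iff not_le)
    then show ?thesis using least[OF k(2)] k(1) by simp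
  qed
  have sumh: "(\<Sum>k\<le>K. h k t) = g t" for t
    unfolding h_def sum_distrib_right[symmetric] ind by simp
  have "N g = (\<integral>\<^sup>+ t. (\<Sum>k\<le>K. h k t * poisson_int (rad k) u t) \<partial>unit_lborel)"
    unfolding N_def
  proof (intro nn_integral_cong)
    fix t
    have "(\<Sum>k\<le>K. h k t * poisson_int (rad k) u t) = (\<Sum>k\<le>K. h k t * g t)"
      by (intro sum.cong refl) (auto simp: h_def S_def indicator_def)
    then show "(g t)\<^sup>2 = (\<Sum>k\<le>K. h k t * poisson_int (rad k) u t)"
      by (simp add: sum_distrib_right[symmetric] sumh power2_eq_square)
  qed
  also have "\<dots> = (\<Sum>k\<le>K. \<integral>\<^sup>+ t. poisson_int (rad k) (h k) t * u t \<partial>unit_lborel)"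
    by (subst nn_integral_sum) (auto simp: poisson_int_symmetric)
  also have "\<dots> = (\<integral>\<^sup>+ t. (\<Sum>k\<le>K. poisson_int (rad k) (h k) t) * u t \<partial>unit_lborel)"
    by (subst nn_integral_sum[symmetric]) (auto simp: sum_distrib_right)
  finally have Ng: "N g = \<dots>" .
  define V where "V = N (\<lambda>t. \<Sum>k\<le>K. poisson_int (rad k) (h k) t)"
  define W where "W = (\<integral>\<^sup>+ t. g t * poisson_max_upto K g t \<partial>unit_lborel)"
  have "(N g)\<^sup>2 \<le> V * N u"
    unfolding Ng V_def unfolding N_def by (rule Cauchy_Schwarz_nn_integral) measurable
  moreover have "V \<le> 16 * W"
    using poisson_max_adjoint[of h K] unfolding V_def N_def W_def sumh by simp
  moreover have "W\<^sup>2 \<le> N g * N (poisson_max_upto K g)"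
    unfolding W_def N_def by (rule Cauchy_Schwarz_nn_integral) measurable
  moreover have "N (poisson_max_upto K g) \<le> ennreal A * N g"
    by (rule AN) measurable
  moreover have "N g \<le> ennreal A * N u"
    unfolding g_def by (rule AN) measurable
  ultimately have "N g \<le> ennreal (16 * sqrt A) * N u"
  proof (cases "N u = top \<or> A = 0")
    case True
    then show ?thesis
    proof (cases "A = 0")
      case True
      then show ?thesis using \<open>N g \<le> ennreal A * N u\<close> by simp
    next
      case False
      then show ?thesis using True A0 by (simp add: ennreal_mult_top)
    qed
  next
    case False
    assume 1: "(N g)\<^sup>2 \<le> V * N u" and 2: "V \<le> 16 * W" and 3: "W\<^sup>2 \<le> N g * N (poisson_max_upto K g)"
      and 4: "N (poisson_max_upto K g) \<le> ennreal A * N g" and 5: "N g \<le> ennreal A * N u"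
    obtain a where a: "N u = ennreal a" "a \<ge> 0" using False by (cases "N u") auto
    \<comment> \<open>At this place the old bound supplies finiteness of \<open>N g\<close>, which
      makes the cancellation below legitimate.\<close>
    then obtain b where b: "N g = ennreal b" "b \<ge> 0" using 5 A0
      by (cases "N g") (auto simp: ennreal_mult[symmetric] top_unique)
    have "W\<^sup>2 \<le> ennreal b * (ennreal A * ennreal b)"
      unfolding b(1)[symmetric] by (intro order_trans[OF 3] mult_left_mono 4) auto
    also have "\<dots> = (ennreal (sqrt A * b))\<^sup>2"
      using A0 b by (simp add: ennreal_mult[symmetric] ennreal_power power_mult_distrib)
         (simp add: power2_eq_square mult_ac)
    finally have "W \<le> ennreal (sqrt A * b)"
      by (rule ennreal_power_le_imp_le) simp
    then have "V \<le> 16 * ennreal (sqrt A * b)" by (intro order_trans[OF 2] mult_left_mono) auto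
    also have "\<dots> = ennreal (16 * (sqrt A * b))" using A0 b by (simp add: ennreal_mult)
    finally have "(N g)\<^sup>2 \<le> ennreal (16 * (sqrt A * b)) * ennreal a"
      unfolding a(1)[symmetric] by (intro order_trans[OF 1] mult_right_mono) auto
    then have "ennreal (b\<^sup>2) \<le> ennreal (16 * (sqrt A * b) * a)"
      using a b A0 by (simp add: ennreal_power ennreal_mult)
    then have "b * b \<le> b * (16 * sqrt A * a)"
      using a b A0 by (subst (asm) ennreal_le_iff) (auto simp: power2_eq_square mult_ac)
    then have "b \<le> 16 * sqrt A * a"
      using b a A0 by (cases "b = 0") auto
    then show ?thesis using a b A0 by (simp add: ennreal_mult[symmetric] ennreal_leI)
  qed
  then show "(\<integral>\<^sup>+ t. (poisson_max_upto K u t)\<^sup>2 \<partial>unit_lborel) \<le> ennreal (16 * sqrt A) * (\<integral>\<^sup>+ t. (u t)\<^sup>2 \<partial>unit_lborel)"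
    by (simp add: N_def g_def)
qed

text \<open>The infimum \<open>m\<close> of the admissible constants satisfies
  \<open>m^2 / 256 \<le> m\<close>, so it is at most 256. One unit of slack yields an admissible
  constant independent of \<open>K\<close>, whether or not the infimum is attained.\<close>

lemma poisson_max_bound_257: "poisson_max_bound K 257"
proof -
  define S where "S = {A. poisson_max_bound K A}"
  have ne: "S \<noteq> {}" using poisson_max_bound_initial unfolding S_def by blast
  have bdd: "bdd_below S" by (intro bdd_belowI[of _ 0]) (auto simp: S_def poisson_max_bound_def)
  define m where "m = Inf S"
  have m0: "0 \<le> m" unfolding m_def using ne by (intro cInf_greatest) (auto simp: S_def poisson_max_bound_def)
  have "m\<^sup>2 / 256 \<le> m"
    unfolding m_def
  proof (rule cInf_greatest[OF ne])
    fix A assume "A \<in> S"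
    then have "0 \<le> A" "16 * sqrt A \<in> S" using poisson_max_bound_improve by (auto simp: S_def poisson_max_bound_def)
    then have "Inf S \<le> 16 * sqrt A" using bdd by (intro cInf_lower)
    then have "(Inf S)\<^sup>2 \<le> (16 * sqrt A)\<^sup>2" using m0 unfolding m_def by (intro power_mono)
    then show "(Inf S)\<^sup>2 / 256 \<le> A" using \<open>0 \<le> A\<close> by (simp add: power_mult_distrib)
  qed
  then have "m < 257" using m0 by (cases "m = 0") (auto simp: power2_eq_square field_simps)
  then obtain A where A: "poisson_max_bound K A" "A < 257"
    unfolding m_def using ne bdd by (subst (asm) cInf_less_iff) (auto simp: S_def)
  show ?thesis unfolding poisson_max_bound_def
  proof (intro conjI ballI)
    fix u :: "real \<Rightarrow> ennreal" assume "u \<in> borel_measurable borel"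
    then have "(\<integral>\<^sup>+ t. (poisson_max_upto K u t)\<^sup>2 \<partial>unit_lborel) \<le> ennreal A * (\<integral>\<^sup>+ t. (u t)\<^sup>2 \<partial>unit_lborel)"
      using A by (auto simp: poisson_max_bound_def)
    also have "\<dots> \<le> ennreal 257 * (\<integral>\<^sup>+ t. (u t)\<^sup>2 \<partial>unit_lborel)"
      using A by (intro mult_right_mono ennreal_leI) auto
    finally show "(\<integral>\<^sup>+ t. (poisson_max_upto K u t)\<^sup>2 \<partial>unit_lborel) \<le> \<dots>" .
  qed simp
qed

theorem poisson_max_L2:
  assumes [measurable]: "u \<in> borel_measurable borel"
  shows "(\<integral>\<^sup>+ t. (poisson_max u t)\<^sup>2 \<partial>unit_lborel) \<le> 257 * (\<integral>\<^sup>+ t. (u t)\<^sup>2 \<partial>unit_lborel)"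
proof -
  have inc: "incseq (\<lambda>K. poisson_max_upto K u t)" for t
    unfolding poisson_max_upto_def by (intro incseq_SucI SUP_subset_mono) auto
  have "(poisson_max u t)\<^sup>2 \<le> (SUP K. (poisson_max_upto K u t)\<^sup>2)" for t
    unfolding poisson_max_def
  proof (rule SUP_power_le_ennreal)
    fix k
    have "(poisson_int (rad k) u t)\<^sup>2 \<le> (poisson_max_upto k u t)\<^sup>2"
      by (intro power_mono_ennreal poisson_int_le_max_upto order_refl)
    also have "\<dots> \<le> (SUP K. (poisson_max_upto K u t)\<^sup>2)" by (rule SUP_upper) simp
    finally show "(poisson_int (rad k) u t)\<^sup>2 \<le> (SUP K. (poisson_max_upto K u t)\<^sup>2)" .
  qed simp
  then have "(\<integral>\<^sup>+ t. (poisson_max u t)\<^sup>2 \<partial>unit_lborel) \<le>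
      (\<integral>\<^sup>+ t. (SUP K. (poisson_max_upto K u t)\<^sup>2) \<partial>unit_lborel)"
    by (intro nn_integral_mono)
  also have "\<dots> = (SUP K. \<integral>\<^sup>+ t. (poisson_max_upto K u t)\<^sup>2 \<partial>unit_lborel)"
    using inc by (intro nn_integral_monotone_convergence_SUP)
       (auto simp: incseq_def le_fun_def intro!: power_mono_ennreal)
  also have "\<dots> \<le> 257 * (\<integral>\<^sup>+ t. (u t)\<^sup>2 \<partial>unit_lborel)"
    using poisson_max_bound_257 unfolding poisson_max_bound_def
    by (intro SUP_least) auto
  finally show ?thesis .
qed

lemma poisson_int_le_max:
  assumes [measurable]: "u \<in> borel_measurable borel" and r: "0 \<le> r" "r < 1"
  shows "poisson_int r u t \<le> 8 * poisson_max u t"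
proof -
  \<comment> \<open>\<open>k + 1\<close> is the integer part of \<open>1 / (1 - r)\<close>, so that
    \<open>rad k \<le> r\<close> and the gap \<open>1 - rad k\<close> is at most
    \<open>2 * (1 - r)\<close>, as the kernel comparison asks.\<close>
  define k where "k = nat \<lfloor>1 / (1 - r)\<rfloor> - 1"
  have "1 \<le> 1 / (1 - r)" using r by simp
  then have "1 \<le> \<lfloor>1 / (1 - r)\<rfloor>" by linarith
  then have "real k + 1 = of_int \<lfloor>1 / (1 - r)\<rfloor>" unfolding k_def by linarith
  then have k: "real k + 1 \<le> 1 / (1 - r)" "1 / (1 - r) < real k + 2" by linarith+
  have 1: "1 - r \<le> 1 / (real k + 1)" using k r by (simp add: field_simps)
  have "1 < (real k + 2) * (1 - r)" using k r by (simp add: field_simps)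
  also have "\<dots> \<le> (2 * (real k + 1)) * (1 - r)" using r by (intro mult_right_mono) auto
  finally have 2: "1 / (real k + 1) \<le> 2 * (1 - r)" by (simp add: field_simps)
  have le: "rad k \<le> r" using 1 by (simp add: rad_def)
  have "poisson r x \<le> 8 * poisson (rad k) x" for x
  proof (rule poisson_compare)
    show "\<bar>r - rad k\<bar> \<le> 1 - r" using le 2 by (simp add: rad_def)
    have "(rad k)\<^sup>2 \<le> r\<^sup>2" using le rad_bounds[of k] by (intro power_mono) auto
    moreover have "r\<^sup>2 \<le> 1" using r by (simp add: power_le_one)
    ultimately have a: "1 - r\<^sup>2 \<le> 1 - (rad k)\<^sup>2" and b: "0 \<le> 1 - (rad k)\<^sup>2" by linarith+
    have "1 * (1 - (rad k)\<^sup>2) \<le> 2 * (1 - (rad k)\<^sup>2)" using b by (intro mult_right_mono) auto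
    with a show "1 - r\<^sup>2 \<le> 2 * (1 - (rad k)\<^sup>2)" unfolding mult_1 by (rule order_trans)
  qed (use r rad_bounds in auto)
  then have "poisson_int r u t \<le> 8 * poisson_int (rad k) u t"
    by (intro poisson_int_compare rad_bounds) auto
  also have "\<dots> \<le> 8 * poisson_max u t"
    unfolding poisson_max_def by (intro mult_left_mono SUP_upper) auto
  finally show ?thesis .
qed

lemma poisson_int_power_le:
  assumes [measurable]: "u \<in> borel_measurable borel" and r: "0 \<le> r" "r < 1"
  shows "(poisson_int r u t) ^ (2 ^ i) \<le> poisson_int r (\<lambda>y. (u y) ^ (2 ^ i)) t"
proof (induction i)
  case (Suc i)
  have "(poisson_int r u t) ^ (2 ^ Suc i) = ((poisson_int r u t) ^ (2 ^ i))\<^sup>2"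
    by (simp add: power_mult[symmetric] mult.commute)
  also have "\<dots> \<le> (poisson_int r (\<lambda>y. (u y) ^ (2 ^ i)) t)\<^sup>2"
    using Suc by (intro power_mono) auto
  also have "\<dots> \<le> poisson_int r (\<lambda>y. ((u y) ^ (2 ^ i))\<^sup>2) t"
    by (intro poisson_int_square_le r) measurable
  finally show ?case by (simp add: power_mult[symmetric] mult.commute)
qed simp

text \<open>By Jensen, the power \<open>2 ^ i\<close> of the maximal function is at most the maximal
  function of the power; the L^2 bound then applies with the same constant.\<close>

theorem poisson_max_power:
  assumes [measurable]: "u \<in> borel_measurable borel"
  shows "(\<integral>\<^sup>+ t. (poisson_max u t) ^ (2 ^ Suc i) \<partial>unit_lborel) \<le> 257 * (\<integral>\<^sup>+ t. (u t) ^ (2 ^ Suc i) \<partial>unit_lborel)"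
proof -
  have "(poisson_max u t) ^ (2 ^ i) \<le> poisson_max (\<lambda>t. u t ^ (2 ^ i)) t" for t
    unfolding poisson_max_def
  proof (rule SUP_power_le_ennreal)
    fix k
    have "(poisson_int (rad k) u t) ^ (2 ^ i) \<le> poisson_int (rad k) (\<lambda>t. u t ^ (2 ^ i)) t"
      by (intro poisson_int_power_le rad_bounds) measurable
    also have "\<dots> \<le> (SUP k. poisson_int (rad k) (\<lambda>t. u t ^ (2 ^ i)) t)"
      by (rule SUP_upper) simp
    finally show "(poisson_int (rad k) u t) ^ (2 ^ i) \<le> \<dots>" .
  qed simp
  then have "((poisson_max u t) ^ (2 ^ i))\<^sup>2 \<le> (poisson_max (\<lambda>t. u t ^ (2 ^ i)) t)\<^sup>2" for t
    by (intro power_mono) auto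
  then have "(\<integral>\<^sup>+ t. (poisson_max u t) ^ (2 ^ Suc i) \<partial>unit_lborel) \<le>
      (\<integral>\<^sup>+ t. (poisson_max (\<lambda>t. u t ^ (2 ^ i)) t)\<^sup>2 \<partial>unit_lborel)"
    by (intro nn_integral_mono) (simp add: power_mult[symmetric] mult.commute)
  also have "\<dots> \<le> 257 * (\<integral>\<^sup>+ t. (u t ^ (2 ^ i))\<^sup>2 \<partial>unit_lborel)"
    by (intro poisson_max_L2) measurable
  finally show ?thesis by (simp add: power_mult[symmetric] mult.commute)
qed

section \<open>Semicontinuity of the quasinorm and density of polynomials\<close>

lemma enn_powr_top [simp]: "enn_powr top a = top"
  by (simp add: enn_powr_def)

lemma enn_powr_0 [simp]: "enn_powr 0 a = 0"
  by (simp add: enn_powr_def)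

lemma enn_powr_ennreal: "0 \<le> x \<Longrightarrow> enn_powr (ennreal x) a = ennreal (x powr a)"
  by (simp add: enn_powr_def)

lemma enn_powr_mono: "x \<le> y \<Longrightarrow> 0 \<le> a \<Longrightarrow> enn_powr x a \<le> enn_powr y a"
  by (cases x; cases y) (auto simp: enn_powr_ennreal top_unique intro!: ennreal_leI powr_mono2)

lemma enn_powr_powr: "enn_powr (enn_powr x a) b = enn_powr x (a * b)"
  by (cases x) (auto simp: enn_powr_ennreal powr_powr)

lemma enn_powr_1 [simp]: "enn_powr x 1 = x"
  by (cases x) (auto simp: enn_powr_ennreal)

lemma enn_powr_cmult:
  "0 < c \<Longrightarrow> enn_powr (ennreal c * x) a = ennreal (c powr a) * enn_powr x a"
  by (cases x) (auto simp: enn_powr_ennreal ennreal_mult[symmetric] powr_mult ennreal_mult_top)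

lemma enn_powr_add_le:
  assumes "0 \<le> a"
  shows "enn_powr (x + y) a \<le> ennreal (2 powr a) * (enn_powr x a + enn_powr y a)"
proof -
  have "x + y \<le> ennreal 2 * max x y" by (auto simp: mult_2 max_def intro: add_mono)
  then have "enn_powr (x + y) a \<le> enn_powr (ennreal 2 * max x y) a" using assms by (rule enn_powr_mono)
  also have "\<dots> = ennreal (2 powr a) * enn_powr (max x y) a" by (rule enn_powr_cmult) simp
  also have "enn_powr (max x y) a \<le> enn_powr x a + enn_powr y a"
    by (auto simp: max_def add_increasing add_increasing2)
  finally show ?thesis by (simp add: mult_left_mono)
qed

lemma measurable_enn_powr [measurable (raw)]:
  assumes [measurable]: "f \<in> borel_measurable M"
  shows "(\<lambda>x. enn_powr (f x) a) \<in> borel_measurable M"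
  unfolding enn_powr_def by measurable

text \<open>For \<open>0 < a\<close> the power is an order isomorphism of [0, top] with inverse
  exponent \<open>1 / a\<close>, so the strict inequalities that characterise a lower limit pass
  through it.\<close>

lemma enn_powr_liminf_le:
  assumes "0 < a"
  shows "enn_powr (liminf X) a \<le> liminf (\<lambda>n. enn_powr (X n) a)"
  unfolding le_Liminf_iff
proof (intro allI impI)
  fix y assume y: "y < enn_powr (liminf X) a"
  have "\<not> liminf X \<le> enn_powr y (1 / a)"
  proof
    assume "liminf X \<le> enn_powr y (1 / a)"
    then have "enn_powr (liminf X) a \<le> enn_powr (enn_powr y (1 / a)) a"
      using assms by (intro enn_powr_mono) auto
    with y assms show False by (simp add: enn_powr_powr)
  qed
  then have "\<forall>\<^sub>F n in sequentially. enn_powr y (1 / a) < X n"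
    using le_Liminf_iff[of "liminf X" sequentially X] by (auto simp: not_le)
  then show "\<forall>\<^sub>F n in sequentially. y < enn_powr (X n) a"
  proof eventually_elim
    case (elim n)
    have "\<not> enn_powr (X n) a \<le> y"
    proof
      assume "enn_powr (X n) a \<le> y"
      then have "enn_powr (enn_powr (X n) a) (1 / a) \<le> enn_powr y (1 / a)"
        using assms by (intro enn_powr_mono) auto
      with elim assms show False by (simp add: enn_powr_powr)
    qed
    then show ?case by simp
  qed
qed

section \<open>Measurability and lower semicontinuity of the quasinorm of order one\<close>

lemma entire_measurable [measurable_dest]:
  "f holomorphic_on UNIV \<Longrightarrow> f \<in> borel_measurable borel"
  by (intro borel_measurable_continuous_onI holomorphic_on_imp_continuous_on)

lemma entire_deriv: "f holomorphic_on UNIV \<Longrightarrow> deriv f holomorphic_on UNIV"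
  by (intro holomorphic_deriv) auto

lemma F_inner_order1:
  "F_inner f 0 1 q t = (\<integral>\<^sup>+ r. ennreal (cmod (deriv f (of_real r * circ t)) powr q * (1 - r) powr (q - 1)) * indicator {0..<1} r \<partial>lborel)"
  by (simp add: F_inner_def circ_def)

lemma F_inner_inf_order1:
  "F_inner_inf f 0 1 t = (SUP r\<in>{0..<1}. ennreal (cmod (deriv f (of_real r * circ t)) * (1 - r)))"
  unfolding F_inner_inf_def by (intro SUP_cong) (auto simp: circ_def)

lemma measurable_F_inner:
  assumes "f holomorphic_on UNIV"
  shows "(\<lambda>t. F_inner f 0 1 q t) \<in> borel_measurable borel"
proof -
  note [measurable] = entire_measurable[OF entire_deriv[OF assms]]
  show ?thesis unfolding F_inner_order1 by measurable
qed

text \<open>The supremum runs over uncountably many radii. Measurability comes from lower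
  semicontinuity: superlevel sets are unions of open sets.\<close>

lemma measurable_F_inner_inf:
  assumes "f holomorphic_on UNIV"
  shows "(\<lambda>t. F_inner_inf f 0 1 t) \<in> borel_measurable borel"
proof (rule borel_measurableI_greater)
  fix y
  have c: "continuous_on UNIV (deriv f)"
    by (intro holomorphic_on_imp_continuous_on entire_deriv assms)
  have "{t \<in> space borel. y < F_inner_inf f 0 1 t} =
     (\<Union>r\<in>{0..<1}. {t. y < ennreal (cmod (deriv f (of_real r * circ t)) * (1 - r))})"
    by (auto simp: F_inner_inf_order1[unfolded One_nat_def] less_SUP_iff)
  moreover have "open {t. y < ennreal (cmod (deriv f (of_real r * circ t)) * (1 - r))}" for r
    by (intro open_Collect_less continuous_on_ennreal continuous_intros continuous_on_compose2[OF c]) auto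
  ultimately show "{t \<in> space borel. y < F_inner_inf f 0 1 t} \<in> sets borel"
    by (auto intro!: borel_open)
qed

text \<open>Uniform convergence passes to derivatives inside the disc, a supremum of limits is at
  most the lower limit of the suprema, and Fatou's lemma treats both integrals. This carries
  inequalities from entire functions to the disc algebra.\<close>

theorem F_pow_liminf:
  assumes f: "\<And>i. f i holomorphic_on UNIV" and lim: "uniform_limit (ball 0 1) f g sequentially"
    and p: "0 < p" and q: "0 < q"
  shows "F_pow g 0 p q 1 \<le> liminf (\<lambda>i. F_pow (f i) 0 p q 1)"
proof -
  have d: "(\<lambda>i. cmod (deriv (f i) (of_real r * circ t))) \<longlonglongrightarrow> cmod (deriv g (of_real r * circ t))"
    if "0 \<le> r" "r < 1" for r t
    using that by (intro tendsto_norm deriv_complex_uniform_limit[OF lim])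
      (auto simp: norm_mult intro!: always_eventually holomorphic_on_subset[OF f])
  show ?thesis
  proof (cases "q = top")
    case True
    have "enn_powr (F_inner_inf g 0 1 t) p \<le> liminf (\<lambda>i. enn_powr (F_inner_inf (f i) 0 1 t) p)" for t
    proof -
      have "F_inner_inf g 0 1 t \<le> liminf (\<lambda>i. F_inner_inf (f i) 0 1 t)"
        unfolding F_inner_inf_order1
      proof (rule SUP_least)
        fix r :: real assume r: "r \<in> {0..<1}"
        have "(\<lambda>i. ennreal (cmod (deriv (f i) (of_real r * circ t)) * (1 - r))) \<longlonglongrightarrow>
            ennreal (cmod (deriv g (of_real r * circ t)) * (1 - r))"
          using r by (intro tendsto_ennrealI tendsto_mult_right d) auto
        then have "ennreal (cmod (deriv g (of_real r * circ t)) * (1 - r)) =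
            liminf (\<lambda>i. ennreal (cmod (deriv (f i) (of_real r * circ t)) * (1 - r)))"
          by (simp add: lim_imp_Liminf)
        also have "\<dots> \<le> liminf (\<lambda>i. SUP r\<in>{0..<1}. ennreal (cmod (deriv (f i) (of_real r * circ t)) * (1 - r)))"
          using r by (intro Liminf_mono always_eventually allI SUP_upper)
        finally show "ennreal (cmod (deriv g (of_real r * circ t)) * (1 - r)) \<le> \<dots>" .
      qed
      then have "enn_powr (F_inner_inf g 0 1 t) p \<le> enn_powr (liminf (\<lambda>i. F_inner_inf (f i) 0 1 t)) p"
        using p by (intro enn_powr_mono) auto
      also have "\<dots> \<le> liminf (\<lambda>i. enn_powr (F_inner_inf (f i) 0 1 t) p)"
        by (rule enn_powr_liminf_le[OF p])
      finally show ?thesis .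
    qed
    then have "F_pow g 0 p q 1 \<le> (\<integral>\<^sup>+ t. liminf (\<lambda>i. enn_powr (F_inner_inf (f i) 0 1 t) p * indicator {0..1} t) \<partial>lborel)"
      unfolding F_pow_def using True
      by (auto intro!: nn_integral_mono simp: indicator_def)
    also have "\<dots> \<le> liminf (\<lambda>i. F_pow (f i) 0 p q 1)"
      unfolding F_pow_def using True measurable_F_inner_inf[OF f] by (auto intro!: nn_integral_liminf)
    finally show ?thesis .
  next
    case False
    define a where "a = enn2real q"
    have a: "0 < a" using q False unfolding a_def by (simp add: enn2real_positive_iff top.not_eq_extremum)
    have "enn_powr (F_inner g 0 1 a t) (p / a) \<le> liminf (\<lambda>i. enn_powr (F_inner (f i) 0 1 a t) (p / a))" for t
    proof -
      define J where "J h r = ennreal (cmod (deriv h (of_real r * circ t)) powr a * (1 - r) powr (a - 1)) * indicator {0..<1} r" for h r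
      have [measurable]: "J (f i) \<in> borel_measurable borel" for i
      proof -
        note [measurable] = entire_measurable[OF entire_deriv[OF f]]
        show ?thesis unfolding J_def by measurable
      qed
      have "J g r = liminf (\<lambda>i. J (f i) r)" for r
      proof (cases "r \<in> {0..<1}")
        case True
        have "(\<lambda>i. ennreal (cmod (deriv (f i) (of_real r * circ t)) powr a * (1 - r) powr (a - 1))) \<longlonglongrightarrow>
           ennreal (cmod (deriv g (of_real r * circ t)) powr a * (1 - r) powr (a - 1))"
          using True a by (intro tendsto_ennrealI tendsto_mult_right tendsto_powr' d) auto
        from lim_imp_Liminf[OF trivial_limit_sequentially this] True
        show ?thesis unfolding J_def by (simp only: indicator_simps mult_1_right)
      next
        case False
        then show ?thesis by (simp add: J_def Liminf_const)
      qed
      then have "F_inner g 0 1 a t = (\<integral>\<^sup>+ r. liminf (\<lambda>i. J (f i) r) \<partial>lborel)"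
        unfolding F_inner_order1 J_def[symmetric] by simp
      also have "\<dots> \<le> liminf (\<lambda>i. F_inner (f i) 0 1 a t)"
        unfolding F_inner_order1 J_def[symmetric] by (rule nn_integral_liminf) measurable
      finally have "enn_powr (F_inner g 0 1 a t) (p / a) \<le> enn_powr (liminf (\<lambda>i. F_inner (f i) 0 1 a t)) (p / a)"
        using p a by (intro enn_powr_mono) auto
      also have "\<dots> \<le> liminf (\<lambda>i. enn_powr (F_inner (f i) 0 1 a t) (p / a))"
        using p a by (intro enn_powr_liminf_le) auto
      finally show ?thesis .
    qed
    then have "F_pow g 0 p q 1 \<le> (\<integral>\<^sup>+ t. liminf (\<lambda>i. enn_powr (F_inner (f i) 0 1 a t) (p / a) * indicator {0..1} t) \<partial>lborel)"
      unfolding F_pow_def using False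
      by (auto intro!: nn_integral_mono simp: indicator_def a_def)
    also have "\<dots> \<le> liminf (\<lambda>i. F_pow (f i) 0 p q 1)"
      unfolding F_pow_def a_def using False measurable_F_inner[OF f] by (auto intro!: nn_integral_liminf)
    finally show ?thesis .
  qed
qed

definition circ_pow_int :: "real \<Rightarrow> (complex \<Rightarrow> complex) \<Rightarrow> ennreal" where
  "circ_pow_int p f = (\<integral>\<^sup>+ t. ennreal (cmod (f (circ t)) powr p) \<partial>unit_lborel)"

section \<open>Circle integrals and polynomial approximation in the disc algebra\<close>

lemma measurable_circ_comp:
  assumes "continuous_on (cball 0 1) f"
  shows "(\<lambda>t. f (circ t)) \<in> borel_measurable borel"
  by (intro borel_measurable_continuous_onI continuous_on_compose2[OF assms] continuous_intros) auto

lemma bounded_on_cball: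
  assumes "continuous_on (cball 0 1) (f :: complex \<Rightarrow> complex)"
  obtains K where "0 < K" "\<And>z. cmod z \<le> 1 \<Longrightarrow> cmod (f z) \<le> K"
proof -
  have "compact (f ` cball 0 1)" by (intro compact_continuous_image assms) auto
  then obtain K where "0 < K" "\<forall>y\<in>f ` cball 0 1. cmod y \<le> K"
    by (metis bounded_pos compact_imp_bounded)
  then show ?thesis by (intro that[of K]) auto
qed

lemma circ_pow_int_tendsto:
  assumes f: "\<And>i. continuous_on (cball 0 1) (f i)" and g: "continuous_on (cball 0 1) g"
    and lim: "uniform_limit (cball 0 1) f g sequentially" and p: "0 < p"
  shows "(\<lambda>i. circ_pow_int p (f i)) \<longlonglongrightarrow> circ_pow_int p g"
proof -
  obtain K where K: "0 < K" "\<And>z. cmod z \<le> 1 \<Longrightarrow> cmod (g z) \<le> K"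
    using bounded_on_cball[OF g] by blast
  have "\<forall>\<^sub>F i in sequentially. \<forall>z\<in>cball 0 1. dist (f i z) (g z) < 1"
    using lim unfolding uniform_limit_iff by auto
  then obtain N where "\<forall>i\<ge>N. \<forall>z\<in>cball 0 1. dist (f i z) (g z) < 1"
    unfolding eventually_sequentially by blast
  then have N: "\<And>i z. i \<ge> N \<Longrightarrow> cmod z \<le> 1 \<Longrightarrow> cmod (f i z - g z) < 1"
    by (auto simp: dist_norm)
  have bd: "cmod (f (i + N) z) \<le> K + 1" if "cmod z \<le> 1" for i z
    using norm_triangle_ineq2[of "f (i + N) z" "g z"] N[of "i + N" z] K(2)[of z] that by simp
  have "(\<lambda>i. circ_pow_int p (f (i + N))) \<longlonglongrightarrow> circ_pow_int p g"
    unfolding circ_pow_int_def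
  proof (rule nn_integral_dominated_convergence[where w = "\<lambda>_. ennreal ((K + 1) powr p)"])
    show "AE t in unit_lborel. ennreal (cmod (f (i + N) (circ t)) powr p) \<le> ennreal ((K + 1) powr p)" for i
      using p K(1) bd by (intro always_eventually allI ennreal_leI powr_mono2) auto
    show "(\<integral>\<^sup>+ x. ennreal ((K + 1) powr p) \<partial>unit_lborel) < \<infinity>" by simp
    show "AE t in unit_lborel. (\<lambda>i. ennreal (cmod (f (i + N) (circ t)) powr p)) \<longlonglongrightarrow> ennreal (cmod (g (circ t)) powr p)"
    proof (intro always_eventually allI)
      fix t
      have "(\<lambda>i. f i (circ t)) \<longlonglongrightarrow> g (circ t)"
        by (rule tendsto_uniform_limitI[OF lim]) simp
      then have "(\<lambda>i. f (i + N) (circ t)) \<longlonglongrightarrow> g (circ t)" by (rule LIMSEQ_ignore_initial_segment)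
      then show "(\<lambda>i. ennreal (cmod (f (i + N) (circ t)) powr p)) \<longlonglongrightarrow> ennreal (cmod (g (circ t)) powr p)"
        using p by (intro tendsto_ennrealI tendsto_powr' tendsto_norm) auto
    qed
  qed (use measurable_circ_comp[OF f] measurable_circ_comp[OF g] in auto)
  then show ?thesis by (rule LIMSEQ_offset)
qed

text \<open>By uniform continuity \<open>f z\<close> may be replaced by \<open>f (r z)\<close>,
  whose Taylor series converges uniformly on the closed disc and can be truncated.\<close>

lemma poly_dense_disc_algebra:
  assumes cont: "continuous_on (cball 0 1) f" and hol: "f holomorphic_on ball 0 1" and e: "0 < e"
  obtains P :: "complex poly" where "\<And>z. cmod z \<le> 1 \<Longrightarrow> cmod (poly P z - f z) < e"
proof -
  have "uniformly_continuous_on (cball 0 1) f"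
    by (rule compact_uniformly_continuous[OF cont]) simp
  then obtain d where d: "d > 0" and "\<forall>z\<in>cball 0 1. \<forall>w\<in>cball 0 1. dist w z < d \<longrightarrow> dist (f w) (f z) < e / 2"
    unfolding uniformly_continuous_on_def using e half_gt_zero by blast
  then have fd: "\<And>z w. cmod z \<le> 1 \<Longrightarrow> cmod w \<le> 1 \<Longrightarrow> cmod (w - z) < d \<Longrightarrow> cmod (f w - f z) < e / 2"
    by (auto simp: dist_norm)
  define r where "r = max (1 / 2) (1 - d / 2)"
  have r: "0 < r" "r < 1" "1 - r < d" using d by (auto simp: r_def)
  define a where "a n = (deriv ^^ n) f 0 / fact n" for n
  have sums: "(\<lambda>n. a n * w ^ n) sums f w" if "cmod w < 1" for w
    using holomorphic_power_series[OF hol, of w] that by (simp add: a_def)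
  \<comment> \<open>The point \<open>(1 + r) / 2\<close> lies strictly between \<open>r\<close> and
    1; convergence there makes the convergence radius strictly larger than \<open>r\<close>.\<close>
  have "ereal (cmod (of_real ((1 + r) / 2))) \<le> conv_radius a"
    by (intro conv_radius_geI sums_summable[OF sums]) (use r in \<open>simp only: norm_of_real, simp\<close>)
  also have "cmod (of_real ((1 + r) / 2)) = (1 + r) / 2" using r by (simp only: norm_of_real, simp)
  finally have "ereal ((1 + r) / 2) \<le> conv_radius a" .
  moreover have "ereal r < ereal ((1 + r) / 2)" using r by simp
  ultimately have "ereal r < conv_radius a" by (rule less_le_trans[rotated])
  then have "uniform_limit (cball 0 r) (\<lambda>n x. \<Sum>i<n. a i * (x - 0) ^ i) (\<lambda>x. suminf (\<lambda>i. a i * (x - 0) ^ i)) sequentially"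
    by (rule powser_uniform_limit)
  then have "\<forall>\<^sub>F n in sequentially. \<forall>x\<in>cball 0 r. dist (\<Sum>i<n. a i * (x - 0) ^ i) (suminf (\<lambda>i. a i * (x - 0) ^ i)) < e / 2"
    unfolding uniform_limit_iff using e half_gt_zero by blast
  then obtain n where "\<forall>x\<in>cball 0 r. dist (\<Sum>i<n. a i * (x - 0) ^ i) (suminf (\<lambda>i. a i * (x - 0) ^ i)) < e / 2"
    unfolding eventually_sequentially by blast
  then have n: "\<And>x. cmod x \<le> r \<Longrightarrow> cmod ((\<Sum>i<n. a i * x ^ i) - (\<Sum>i. a i * x ^ i)) < e / 2"
    by (auto simp: dist_norm)
  define P where "P = (\<Sum>i<n. monom (a i * of_real r ^ i) i)"
  have "cmod (poly P z - f z) < e" if z: "cmod z \<le> 1" for z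
  proof -
    have rz: "cmod (of_real r * z) \<le> r" using z r by (simp add: norm_mult)
    have "poly P z = (\<Sum>i<n. a i * (of_real r * z) ^ i)"
      by (simp add: P_def poly_sum poly_monom power_mult_distrib mult_ac)
    moreover have "(\<Sum>i. a i * (of_real r * z) ^ i) = f (of_real r * z)"
      using rz r by (intro sums_unique[symmetric] sums) auto
    ultimately have 1: "cmod (poly P z - f (of_real r * z)) < e / 2" using n[OF rz] by simp
    have "of_real r * z - z = of_real (r - 1) * z" by (simp add: algebra_simps)
    then have "cmod (of_real r * z - z) = \<bar>r - 1\<bar> * cmod z" by (simp only: norm_mult norm_of_real)
    also have "\<dots> \<le> \<bar>r - 1\<bar> * 1" using z by (intro mult_left_mono) auto
    finally have "cmod (of_real r * z - z) < d" using r by simp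
    then have "cmod (f (of_real r * z) - f z) < e / 2"
      using z rz r by (intro fd) auto
    then show ?thesis
      using 1 norm_triangle_ineq[of "poly P z - f (of_real r * z)" "f (of_real r * z) - f z"] by simp
  qed
  then show ?thesis by (rule that)
qed

lemma poly_seq_disc_algebra:
  assumes cont: "continuous_on (cball 0 1) f" and hol: "f holomorphic_on ball 0 1"
  obtains P :: "nat \<Rightarrow> complex poly" where "uniform_limit (cball 0 1) (\<lambda>n. poly (P n)) f sequentially"
proof -
  have "\<exists>P :: complex poly. \<forall>z. cmod z \<le> 1 \<longrightarrow> cmod (poly P z - f z) < inverse (real (Suc n))" for n
    using poly_dense_disc_algebra[OF cont hol, of "inverse (real (Suc n))"] by (metis inverse_positive_iff_positive of_nat_0_less_iff zero_less_Suc)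
  then obtain P :: "nat \<Rightarrow> complex poly" where P: "\<And>n z. cmod z \<le> 1 \<Longrightarrow> cmod (poly (P n) z - f z) < inverse (real (Suc n))"
    by metis
  have "uniform_limit (cball 0 1) (\<lambda>n. poly (P n)) f sequentially"
    unfolding uniform_limit_iff
  proof (intro allI impI)
    fix e :: real assume "0 < e"
    then have "\<forall>\<^sub>F n in sequentially. inverse (real (Suc n)) < e"
      using LIMSEQ_inverse_real_of_nat order_tendstoD(2) by blast
    then show "\<forall>\<^sub>F n in sequentially. \<forall>z\<in>cball 0 1. dist (poly (P n) z) (f z) < e"
      by eventually_elim (auto simp: dist_norm intro!: less_trans[OF P])
  qed
  then show ?thesis by (rule that)
qed

section \<open>Parseval's identity and area integrals\<close>

lemma poly_altdef_atMost:
  fixes P :: "'a :: comm_semiring_1 poly"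
  assumes "degree P \<le> m"
  shows "poly P z = (\<Sum>i\<le>m. coeff P i * z ^ i)"
  unfolding poly_altdef using assms
  by (intro sum.mono_neutral_left) (auto simp: coeff_eq_0)

text \<open>Induction peels off the constant term. The rest is \<open>circ t\<close> times a shorter
  sum, and the cross term is the real part of a polynomial vanishing at 0: orthogonality becomes the
  mean value property, which is the Poisson formula at radius 0.\<close>

lemma integral_norm_square_trig_sum:
  "integral {0..1} (\<lambda>t. (cmod (\<Sum>n<N. b n * circ t ^ n))\<^sup>2) = (\<Sum>n<N. (cmod (b n))\<^sup>2)"
proof (induction N arbitrary: b)
  case (Suc N)
  define h where "h z = cnj (b 0) * (z * (\<Sum>n<N. b (Suc n) * z ^ n))" for z
  define w where "w t = circ t * (\<Sum>n<N. b (Suc n) * circ t ^ n)" for t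
  have cw: "continuous_on {0..1} w" unfolding w_def by (intro continuous_intros)
  have nw: "cmod (w t) = cmod (\<Sum>n<N. b (Suc n) * circ t ^ n)" for t
    by (simp add: w_def norm_mult)
  have zero: "integral {0..1} (\<lambda>t. Re (h (circ t))) = 0"
  proof -
    have "continuous_on (cball 0 1) h" "h holomorphic_on ball 0 1"
      unfolding h_def by (intro continuous_intros holomorphic_intros)+
    from poisson_formula_Re[OF this, of 0 0] have "integral {0..1} (\<lambda>t. Re (h (circ t))) = Re (h 0)"
      by (simp add: poisson_def)
    then show ?thesis by (simp add: h_def)
  qed
  have "(cmod (\<Sum>n<Suc N. b n * circ t ^ n))\<^sup>2 = (cmod (b 0))\<^sup>2 + (cmod (w t))\<^sup>2 + 2 * Re (h (circ t))" for t
  proof -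
    have "(\<Sum>n<Suc N. b n * circ t ^ n) = b 0 + w t"
      unfolding sum.lessThan_Suc_shift by (simp add: w_def sum_distrib_left mult_ac)
    moreover have "h (circ t) = cnj (b 0) * w t" by (simp add: h_def w_def)
    ultimately show ?thesis
      by (simp only: cmod_power2) (simp add: power2_eq_square algebra_simps)
  qed
  then have "integral {0..1} (\<lambda>t. (cmod (\<Sum>n<Suc N. b n * circ t ^ n))\<^sup>2) =
      integral {0..1} (\<lambda>t. (cmod (b 0))\<^sup>2 + (cmod (w t))\<^sup>2 + 2 * Re (h (circ t)))" by simp
  also have "\<dots> = (cmod (b 0))\<^sup>2 + integral {0..1} (\<lambda>t. (cmod (w t))\<^sup>2) + 2 * integral {0..1} (\<lambda>t. Re (h (circ t)))"
    unfolding h_def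
    by (subst Henstock_Kurzweil_Integration.integral_add
        | (intro integrable_continuous_interval continuous_intros cw; fail)
        | simp)+
  also have "\<dots> = (\<Sum>n<Suc N. (cmod (b n))\<^sup>2)"
    unfolding zero nw Suc sum.lessThan_Suc_shift by simp
  finally show ?case .
qed simp

lemma nn_integral_norm_square_trig_sum:
  "(\<integral>\<^sup>+ t. ennreal ((cmod (\<Sum>n<N. b n * circ t ^ n))\<^sup>2) \<partial>unit_lborel) = ennreal (\<Sum>n<N. (cmod (b n))\<^sup>2)"
  by (subst nn_integral_unit_lborel_integral)
     (auto intro!: continuous_intros simp: integral_norm_square_trig_sum)

lemma nn_integral_beta:
  "(\<integral>\<^sup>+ r. ennreal ((1 - r) * r ^ (2 * n)) \<partial>unit_lborel) = ennreal (1 / ((2 * real n + 1) * (2 * real n + 2)))"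
proof -
  define G where "G m r = r ^ Suc m / real (Suc m)" for m and r :: real
  have G: "(G m has_real_derivative r ^ m) (at r within {0..1})" for m r
    unfolding G_def by (auto intro!: derivative_eq_intros simp del: of_nat_Suc power_Suc)
  have "((\<lambda>r. (1 - r) * r ^ (2 * n)) has_integral
     (G (2 * n) 1 - G (Suc (2 * n)) 1) - (G (2 * n) 0 - G (Suc (2 * n)) 0)) {0..1}"
  proof (rule fundamental_theorem_of_calculus)
    fix r :: real
    have "((\<lambda>r. G (2 * n) r - G (Suc (2 * n)) r) has_real_derivative r ^ (2 * n) - r ^ Suc (2 * n)) (at r within {0..1})"
      by (intro DERIV_diff G)
    then show "((\<lambda>r. G (2 * n) r - G (Suc (2 * n)) r) has_vector_derivative
       (1 - r) * r ^ (2 * n)) (at r within {0..1})"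
      by (simp add: has_real_derivative_iff_has_vector_derivative algebra_simps)
  qed simp
  then have "integral {0..1} (\<lambda>r. (1 - r) * r ^ (2 * n)) = 1 / (2 * real n + 1) - 1 / (2 * real n + 2)"
    by (simp add: integral_unique G_def add.commute)
  also have "\<dots> = 1 / ((2 * real n + 1) * (2 * real n + 2))"
    by (simp add: divide_simps)
  finally show ?thesis
    by (subst nn_integral_unit_lborel_integral) (auto intro!: continuous_intros)
qed

text \<open>The square of the Littlewood-Paley function of a primitive of \<open>D\<close>. The
  derivative is a separate argument since \<open>deriv f\<close> is controlled only inside the disc,
  while \<open>D\<close> must be Borel on the plane.\<close>

definition lp_square :: "(complex \<Rightarrow> complex) \<Rightarrow> real \<Rightarrow> ennreal" where
  "lp_square D t = (\<integral>\<^sup>+ r. ennreal ((cmod (D (of_real r * circ t)))\<^sup>2 * (1 - r)) \<partial>unit_lborel)"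

lemma F_inner_eq_lp_square:
  assumes [measurable]: "D \<in> borel_measurable borel" and D: "\<And>z. cmod z < 1 \<Longrightarrow> deriv f z = D z"
  shows "F_inner f 0 1 2 t = lp_square D t"
  unfolding F_inner_order1 lp_square_def
  by (subst nn_integral_unit_lborel)
     (auto intro!: nn_integral_cong simp: indicator_def D norm_mult powr_numeral)

lemma F_pow_2_2:
  assumes [measurable]: "D \<in> borel_measurable borel" and D: "\<And>z. cmod z < 1 \<Longrightarrow> deriv f z = D z"
  shows "F_pow f 0 2 2 1 = (\<integral>\<^sup>+ t. lp_square D t \<partial>unit_lborel)"
proof -
  have "lp_square D \<in> borel_measurable borel" unfolding lp_square_def by measurable
  then show ?thesis
    unfolding F_pow_def F_inner_eq_lp_square[OF assms, unfolded One_nat_def]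
    by (subst nn_integral_unit_lborel) (auto simp: F_inner_eq_lp_square[OF assms, unfolded One_nat_def])
qed

text \<open>Fubini and Parseval at each radius reduce the claim to coefficients: the weight turns
  \<open>(n + 1)^2\<close> into \<open>(n + 1)^2 / ((2 n + 1) (2 n + 2))\<close>, which is at most
  1/2.\<close>

lemma lp_square_integral_poly:
  fixes P :: "complex poly"
  shows "(\<integral>\<^sup>+ t. lp_square (poly (pderiv P)) t \<partial>unit_lborel) \<le> ennreal (1 / 2) * circ_pow_int 2 (poly P)"
proof -
  have [measurable]: "poly (pderiv P) \<in> borel_measurable borel"
    by (intro borel_measurable_continuous_onI continuous_intros)
  define N where "N = Suc (degree P)"
  define c where "c = coeff P"
  have P: "poly P z = (\<Sum>n<Suc N. c n * z ^ n)" for z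
    unfolding c_def N_def lessThan_Suc_atMost by (rule poly_altdef_atMost) simp
  have P': "poly (pderiv P) (of_real r * z) = (\<Sum>n<N. (of_nat (Suc n) * c (Suc n) * of_real (r ^ n)) * z ^ n)" for r z
  proof -
    have "poly (pderiv P) (of_real r * z) = (\<Sum>n\<le>degree P. coeff (pderiv P) n * (of_real r * z) ^ n)"
      by (rule poly_altdef_atMost) (simp add: degree_pderiv)
    then show ?thesis
      unfolding N_def lessThan_Suc_atMost c_def by (simp add: coeff_pderiv power_mult_distrib mult_ac)
  qed
  have inner: "(\<integral>\<^sup>+ t. ennreal ((cmod (poly (pderiv P) (of_real r * circ t)))\<^sup>2) \<partial>unit_lborel)
     = ennreal (\<Sum>n<N. (real (Suc n))\<^sup>2 * (cmod (c (Suc n)))\<^sup>2 * r ^ (2 * n))" for r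
    unfolding P' nn_integral_norm_square_trig_sum
    by (simp add: norm_mult power_mult_distrib norm_power power_even_abs power_mult[symmetric] mult.commute del: of_nat_Suc)
  have "(\<integral>\<^sup>+ t. lp_square (poly (pderiv P)) t \<partial>unit_lborel) =
     (\<integral>\<^sup>+ r. \<integral>\<^sup>+ t. ennreal ((cmod (poly (pderiv P) (of_real r * circ t)))\<^sup>2 * (1 - r)) \<partial>unit_lborel \<partial>unit_lborel)"
    unfolding lp_square_def by (rule ULP.Fubini') measurable
  also have "\<dots> \<le> (\<integral>\<^sup>+ r. (\<Sum>n<N. ennreal ((real (Suc n))\<^sup>2 * (cmod (c (Suc n)))\<^sup>2) * ennreal ((1 - r) * r ^ (2 * n))) \<partial>unit_lborel)"
  proof (rule nn_integral_unit_lborel_mono)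
    fix r :: real assume r: "0 \<le> r" "r \<le> 1"
    have "(\<integral>\<^sup>+ t. ennreal ((cmod (poly (pderiv P) (of_real r * circ t)))\<^sup>2 * (1 - r)) \<partial>unit_lborel) =
      (\<integral>\<^sup>+ t. ennreal ((cmod (poly (pderiv P) (of_real r * circ t)))\<^sup>2) * ennreal (1 - r) \<partial>unit_lborel)"
      using r by (simp add: ennreal_mult)
    also have "\<dots> = ennreal (\<Sum>n<N. (real (Suc n))\<^sup>2 * (cmod (c (Suc n)))\<^sup>2 * r ^ (2 * n)) * ennreal (1 - r)"
      unfolding inner[symmetric] by (rule nn_integral_multc) measurable
    also have "\<dots> = ennreal (\<Sum>n<N. ((real (Suc n))\<^sup>2 * (cmod (c (Suc n)))\<^sup>2) * ((1 - r) * r ^ (2 * n)))"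
    proof (subst ennreal_mult[symmetric])
      have "(\<Sum>n<N. (real (Suc n))\<^sup>2 * (cmod (c (Suc n)))\<^sup>2 * r ^ (2 * n)) * (1 - r) =
        (\<Sum>n<N. ((real (Suc n))\<^sup>2 * (cmod (c (Suc n)))\<^sup>2) * ((1 - r) * r ^ (2 * n)))"
        unfolding sum_distrib_right by (intro sum.cong refl) simp
      then show "ennreal ((\<Sum>n<N. (real (Suc n))\<^sup>2 * (cmod (c (Suc n)))\<^sup>2 * r ^ (2 * n)) * (1 - r)) =
        ennreal (\<Sum>n<N. ((real (Suc n))\<^sup>2 * (cmod (c (Suc n)))\<^sup>2) * ((1 - r) * r ^ (2 * n)))" by simp
    qed (use r in \<open>auto intro!: sum_nonneg\<close>)
    also have "\<dots> = (\<Sum>n<N. ennreal (((real (Suc n))\<^sup>2 * (cmod (c (Suc n)))\<^sup>2) * ((1 - r) * r ^ (2 * n))))"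
      using r by (subst sum_ennreal) auto
    also have "\<dots> = (\<Sum>n<N. ennreal ((real (Suc n))\<^sup>2 * (cmod (c (Suc n)))\<^sup>2) * ennreal ((1 - r) * r ^ (2 * n)))"
      using r by (intro sum.cong refl ennreal_mult) auto
    finally show "(\<integral>\<^sup>+ t. ennreal ((cmod (poly (pderiv P) (of_real r * circ t)))\<^sup>2 * (1 - r)) \<partial>unit_lborel) \<le> \<dots>" by simp
  qed
  also have "\<dots> = (\<Sum>n<N. ennreal ((real (Suc n))\<^sup>2 * (cmod (c (Suc n)))\<^sup>2) * ennreal (1 / ((2 * real n + 1) * (2 * real n + 2))))"
    by (subst nn_integral_sum) (auto simp: nn_integral_cmult nn_integral_beta)
  also have "\<dots> \<le> (\<Sum>n<N. ennreal (1 / 2 * (cmod (c (Suc n)))\<^sup>2))"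
  proof (intro sum_mono)
    fix n
    have "(real (Suc n))\<^sup>2 * (1 / ((2 * real n + 1) * (2 * real n + 2))) \<le> 1 / 2"
      by (simp add: divide_simps) (simp add: power2_eq_square algebra_simps)
    then have "(real (Suc n))\<^sup>2 * (1 / ((2 * real n + 1) * (2 * real n + 2))) * (cmod (c (Suc n)))\<^sup>2 \<le> 1 / 2 * (cmod (c (Suc n)))\<^sup>2"
      by (rule mult_right_mono) simp
    then show "ennreal ((real (Suc n))\<^sup>2 * (cmod (c (Suc n)))\<^sup>2) * ennreal (1 / ((2 * real n + 1) * (2 * real n + 2))) \<le> ennreal (1 / 2 * (cmod (c (Suc n)))\<^sup>2)"
      by (subst ennreal_mult[symmetric]) (auto intro!: ennreal_leI simp: mult_ac)
  qed
  also have "\<dots> = ennreal (1 / 2 * (\<Sum>n<N. (cmod (c (Suc n)))\<^sup>2))"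
    unfolding sum_distrib_left by (rule sum_ennreal) simp
  also have "\<dots> \<le> ennreal (1 / 2 * (\<Sum>n<Suc N. (cmod (c n))\<^sup>2))"
    unfolding sum.lessThan_Suc_shift by (intro ennreal_leI) simp
  also have "\<dots> = ennreal (1 / 2) * circ_pow_int 2 (poly P)"
    unfolding circ_pow_int_def P powr_numeral[OF norm_ge_zero] nn_integral_norm_square_trig_sum
    by (rule ennreal_mult) (auto intro!: add_nonneg_nonneg sum_nonneg)
  finally show ?thesis .
qed

theorem area_integral_le:
  assumes cont: "continuous_on (cball 0 1) f" and hol: "f holomorphic_on ball 0 1"
  shows "F_pow f 0 2 2 1 \<le> ennreal (1 / 2) * circ_pow_int 2 f"
proof -
  obtain P :: "nat \<Rightarrow> complex poly" where lim: "uniform_limit (cball 0 1) (\<lambda>n. poly (P n)) f sequentially"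
    using poly_seq_disc_algebra[OF cont hol] .
  have "F_pow f 0 2 2 1 \<le> liminf (\<lambda>i. F_pow (poly (P i)) 0 2 2 1)"
    by (rule F_pow_liminf)
       (auto intro!: holomorphic_intros uniform_limit_on_subset[OF lim])
  also have "\<dots> \<le> liminf (\<lambda>i. ennreal (1 / 2) * circ_pow_int 2 (poly (P i)))"
  proof (intro Liminf_mono always_eventually allI)
    fix i
    have "deriv (poly (P i)) z = poly (pderiv (P i)) z" for z
      by (intro DERIV_imp_deriv poly_DERIV)
    moreover have "poly (pderiv (P i)) \<in> borel_measurable borel"
      by (intro borel_measurable_continuous_onI continuous_intros)
    ultimately have "F_pow (poly (P i)) 0 2 2 1 = (\<integral>\<^sup>+ t. lp_square (poly (pderiv (P i))) t \<partial>unit_lborel)"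
      by (intro F_pow_2_2)
    then show "F_pow (poly (P i)) 0 2 2 1 \<le> ennreal (1 / 2) * circ_pow_int 2 (poly (P i))"
      using lp_square_integral_poly by simp
  qed
  also have "\<dots> = ennreal (1 / 2) * circ_pow_int 2 f"
  proof -
    have "(\<lambda>i. circ_pow_int 2 (poly (P i))) \<longlonglongrightarrow> circ_pow_int 2 f"
      by (intro circ_pow_int_tendsto lim cont) (auto intro!: continuous_intros)
    then have "(\<lambda>i. ennreal (1 / 2) * circ_pow_int 2 (poly (P i))) \<longlonglongrightarrow> ennreal (1 / 2) * circ_pow_int 2 f"
      by (intro ennreal_tendsto_cmult ennreal_less_top)
    then show ?thesis by (intro lim_imp_Liminf) auto
  qed
  finally show ?thesis .
qed

section \<open>Localised area integrals\<close>

lemma integral_norm_square_radius_le: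
  assumes cont: "continuous_on (cball 0 1) h" and hol: "h holomorphic_on ball 0 1"
    and s: "0 \<le> s" "s \<le> 1"
  shows "(\<integral>\<^sup>+ t. ennreal ((cmod (h (of_real s * circ t)))\<^sup>2) \<partial>unit_lborel) \<le>
    (\<integral>\<^sup>+ t. ennreal ((cmod (h (circ t)))\<^sup>2) \<partial>unit_lborel)"
proof (cases "s = 1")
  case False
  then have s1: "s < 1" using s by simp
  note [measurable] = measurable_circ_comp[OF cont]
  have "(\<integral>\<^sup>+ t. ennreal ((cmod (h (of_real s * circ t)))\<^sup>2) \<partial>unit_lborel) \<le>
      (\<integral>\<^sup>+ t. poisson_int s (\<lambda>y. ennreal ((cmod (h (circ y)))\<^sup>2)) t \<partial>unit_lborel)"
  proof (rule nn_integral_mono)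
    fix t
    show "ennreal ((cmod (h (of_real s * circ t)))\<^sup>2) \<le> poisson_int s (\<lambda>y. ennreal ((cmod (h (circ y)))\<^sup>2)) t"
      using norm_le_poisson_int[of "\<lambda>z. (h z)\<^sup>2" s t] cont hol s s1
      by (simp add: norm_power continuous_intros holomorphic_intros)
  qed
  also have "\<dots> = (\<integral>\<^sup>+ t. ennreal ((cmod (h (circ t)))\<^sup>2) \<partial>unit_lborel)"
    by (rule integral_poisson_int) (use s s1 in auto)
  finally show ?thesis .
qed simp

text \<open>The global area estimate is applied to \<open>k = F / d\<close> with
  \<open>d z = 1 - cnj a * z\<close> and \<open>a = r circ x\<close>. On the circle
  \<open>(1 - r^2) |k|^2\<close> is the Poisson kernel times \<open>|F|^2\<close>; at radii beyond
  \<open>r\<close>, \<open>d\<close> is still controlled by the kernel's denominator, so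
  \<open>|F'|\<close> is recovered from \<open>k'\<close> up to the term added by the quotient
  rule.\<close>

theorem local_area_integral_le:
  assumes F: "F holomorphic_on UNIV" and r: "0 \<le> r" "r < 1"
  shows "(\<integral>\<^sup>+ t. ennreal (poisson r (x - t)) *
      (\<integral>\<^sup>+ s. ennreal ((cmod (deriv F (of_real s * circ t)))\<^sup>2 * (1 - s)) * indicator {r..} s \<partial>unit_lborel) \<partial>unit_lborel)
    \<le> 8 * poisson_int r (\<lambda>t. ennreal ((cmod (F (circ t)))\<^sup>2)) x"
proof -
  note [measurable] = entire_measurable[OF F] entire_measurable[OF entire_deriv[OF F]]
  define a where "a = of_real r * circ x"
  have na: "cmod a = r" using r by (simp add: a_def norm_mult)
  define d where "d z = 1 - cnj a * z" for z
  have dge: "1 - r \<le> cmod (d z)" if "cmod z \<le> 1" for z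
  proof -
    have "1 - cmod (cnj a * z) \<le> cmod (d z)" unfolding d_def using norm_triangle_ineq2[of 1 "cnj a * z"] by simp
    moreover have "cmod (cnj a * z) \<le> r" using that r by (simp add: norm_mult na mult_left_le)
    ultimately show ?thesis by linarith
  qed
  have dnz: "d z \<noteq> 0" if "cmod z \<le> 1" for z using dge[OF that] r by auto
  define k where "k z = F z / d z" for z
  define k' where "k' z = deriv F z / d z + cnj a * k z / d z" for z
  have [measurable]: "k \<in> borel_measurable borel" "k' \<in> borel_measurable borel" "d \<in> borel_measurable borel"
    unfolding k_def k'_def d_def by measurable
  have hd: "(F has_field_derivative deriv F z) (at z)" for z
    using F by (intro holomorphic_derivI) auto
  have dk: "deriv k z = k' z" if "cmod z < 1" for z
  proof (rule DERIV_imp_deriv)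
    have "(d has_field_derivative - cnj a) (at z)"
      unfolding d_def by (auto intro!: derivative_eq_intros)
    from DERIV_divide[OF hd this dnz] that
    have "(k has_field_derivative (deriv F z * d z - F z * - cnj a) / (d z * d z)) (at z)"
      unfolding k_def by simp
    moreover have "(deriv F z * d z - F z * - cnj a) / (d z * d z) = k' z"
      using dnz[of z] that by (simp add: k'_def k_def field_simps)
    ultimately show "(k has_field_derivative k' z) (at z)" by simp
  qed
  have kc: "continuous_on (cball 0 1) k" unfolding k_def d_def
    using dnz by (intro continuous_intros holomorphic_on_imp_continuous_on holomorphic_on_subset[OF F]) (auto simp: d_def)
  have kh: "k holomorphic_on ball 0 1" unfolding k_def d_def
    using dnz by (intro holomorphic_intros holomorphic_on_subset[OF F]) (auto simp: d_def less_imp_le)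
  define K where "K = (\<integral>\<^sup>+ t. ennreal ((cmod (k (circ t)))\<^sup>2) \<partial>unit_lborel)"
  \<comment> \<open>\<open>A\<close> carries the derivative of \<open>k\<close>, and
    \<open>B\<close> the quotient rule remainder, in which \<open>1 / |d|\<close> is replaced by
    \<open>1 / (1 - r)\<close>.\<close>
  define A where "A t s = ennreal ((cmod (k' (of_real s * circ t)))\<^sup>2 * (1 - s))" for t s
  define B where "B t s = ennreal ((cmod (k (of_real s * circ t)))\<^sup>2 * ((1 - s) / (1 - r)\<^sup>2)) * indicator {r..} s" for t s
  have [measurable]: "case_prod A \<in> borel_measurable (borel \<Otimes>\<^sub>M borel)" "case_prod B \<in> borel_measurable (borel \<Otimes>\<^sub>M borel)"
    unfolding A_def B_def by measurable
  have IA: "(\<integral>\<^sup>+ t. \<integral>\<^sup>+ s. A t s \<partial>unit_lborel \<partial>unit_lborel) \<le> ennreal (1 / 2) * K"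
  proof -
    have "(\<integral>\<^sup>+ t. \<integral>\<^sup>+ s. A t s \<partial>unit_lborel \<partial>unit_lborel) = F_pow k 0 2 2 1"
      by (subst F_pow_2_2[of k' k]) (auto simp: dk A_def[abs_def] lp_square_def[abs_def])
    also have "\<dots> \<le> ennreal (1 / 2) * K"
      using area_integral_le[OF kc kh] by (simp add: K_def circ_pow_int_def powr_numeral)
    finally show ?thesis .
  qed
  have IB: "(\<integral>\<^sup>+ t. \<integral>\<^sup>+ s. B t s \<partial>unit_lborel \<partial>unit_lborel) \<le> ennreal (1 / 2) * K"
  proof -
    have "(\<integral>\<^sup>+ t. \<integral>\<^sup>+ s. B t s \<partial>unit_lborel \<partial>unit_lborel) = (\<integral>\<^sup>+ s. \<integral>\<^sup>+ t. B t s \<partial>unit_lborel \<partial>unit_lborel)"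
      by (rule ULP.Fubini') measurable
    also have "\<dots> \<le> (\<integral>\<^sup>+ s. ennreal ((1 - s) / (1 - r)\<^sup>2) * indicator {r..} s * K \<partial>unit_lborel)"
    proof (rule nn_integral_unit_lborel_mono)
      fix s :: real assume s: "0 \<le> s" "s \<le> 1"
      have "(\<integral>\<^sup>+ t. B t s \<partial>unit_lborel) = (\<integral>\<^sup>+ t. (ennreal ((1 - s) / (1 - r)\<^sup>2) * indicator {r..} s) * ennreal ((cmod (k (of_real s * circ t)))\<^sup>2) \<partial>unit_lborel)"
      proof (rule nn_integral_cong)
        fix t
        have "ennreal ((cmod (k (of_real s * circ t)))\<^sup>2 * ((1 - s) / (1 - r)\<^sup>2)) =
           ennreal ((cmod (k (of_real s * circ t)))\<^sup>2) * ennreal ((1 - s) / (1 - r)\<^sup>2)"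
          using s by (intro ennreal_mult) auto
        then show "B t s = ennreal ((1 - s) / (1 - r)\<^sup>2) * indicator {r..} s * ennreal ((cmod (k (of_real s * circ t)))\<^sup>2)"
          unfolding B_def by (simp only: mult_ac)
      qed
      also have "\<dots> = (ennreal ((1 - s) / (1 - r)\<^sup>2) * indicator {r..} s) * (\<integral>\<^sup>+ t. ennreal ((cmod (k (of_real s * circ t)))\<^sup>2) \<partial>unit_lborel)"
        by (rule nn_integral_cmult) measurable
      also have "\<dots> \<le> (ennreal ((1 - s) / (1 - r)\<^sup>2) * indicator {r..} s) * K"
        unfolding K_def by (intro mult_left_mono integral_norm_square_radius_le kc kh s) auto
      finally show "(\<integral>\<^sup>+ t. B t s \<partial>unit_lborel) \<le> ennreal ((1 - s) / (1 - r)\<^sup>2) * indicator {r..} s * K" .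
    qed
    also have "\<dots> = (\<integral>\<^sup>+ s. ennreal ((1 - s) / (1 - r)\<^sup>2) * indicator {r..} s \<partial>unit_lborel) * K"
      by (rule nn_integral_multc) measurable
    \<comment> \<open>Over \<open>[r, 1]\<close> the weight \<open>1 - s\<close> integrates to
      \<open>(1 - r)^2 / 2\<close>, which pays exactly for the denominator of the remainder.\<close>
    also have "(\<integral>\<^sup>+ s. ennreal ((1 - s) / (1 - r)\<^sup>2) * indicator {r..} s \<partial>unit_lborel) = ennreal (1 / 2)"
    proof -
      define c where "c = 1 / (1 - r)\<^sup>2"
      have c: "(1 - r)\<^sup>2 * c = 1" using r by (simp add: c_def)
      have E: "(1 - 1\<^sup>2 / 2) * c - (r - r\<^sup>2 / 2) * c = 1 / 2"
        using c by (simp add: power2_eq_square algebra_simps)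
      have "((\<lambda>s. (1 - s) * c) has_integral (1 - 1\<^sup>2 / 2) * c - (r - r\<^sup>2 / 2) * c) {r..1}"
      proof (rule fundamental_theorem_of_calculus)
        fix s :: real
        have "((\<lambda>s. (s - s\<^sup>2 / 2) * c) has_real_derivative (1 - s) * c) (at s within {r..1})"
          by (auto intro!: derivative_eq_intros)
        then show "((\<lambda>s. (s - s\<^sup>2 / 2) * c) has_vector_derivative (1 - s) * c) (at s within {r..1})"
          by (simp add: has_real_derivative_iff_has_vector_derivative)
      qed (use r in simp)
      then have "((\<lambda>s. (1 - s) * c) has_integral 1 / 2) {r..1}"
        unfolding E .
      then have I: "((\<lambda>s. (1 - s) / (1 - r)\<^sup>2) has_integral (1 / 2)) {r..1}"
        by (simp add: c_def)
      have "(\<integral>\<^sup>+ s. ennreal ((1 - s) / (1 - r)\<^sup>2) * indicator {r..} s \<partial>unit_lborel) =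
         (\<integral>\<^sup>+ s. ennreal ((1 - s) / (1 - r)\<^sup>2) * indicator {r..1} s \<partial>lborel)"
        using r by (subst nn_integral_unit_lborel) (auto intro!: nn_integral_cong simp: indicator_def)
      then show ?thesis
        using nn_integral_has_integral_lebesgue'[OF _ I] by simp
    qed
    finally show ?thesis .
  qed
  have bound: "ennreal (poisson r (x - t)) * (ennreal ((cmod (deriv F (of_real s * circ t)))\<^sup>2 * (1 - s)) * indicator {r..} s)
     \<le> ennreal (8 * (1 - r\<^sup>2)) * (A t s + B t s)" if s: "0 \<le> s" "s \<le> 1" for t s
  proof (cases "r \<le> s")
    case True
    define z where "z = of_real s * circ t"
    have nz: "cmod z \<le> 1" using s by (simp add: z_def norm_mult)
    define w where "w = 1 - of_real r * circ (t - x)"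
    have w: "cmod (1 - of_real r * circ (t - x)) = cmod w" by (simp add: w_def)
    have wge: "1 - r \<le> cmod w" unfolding w_def by (rule poisson_denom_ge[OF r(1)])
    \<comment> \<open>\<open>d z\<close> and \<open>w\<close> differ by at most
      \<open>r (1 - s) \<le> 1 - r \<le> |w|\<close>; here \<open>r \<le> s\<close> enters. The
      resulting factor 2, squared, and the 2 from squaring a sum give the constant 8.\<close>
    have "d z = w + of_real (r * (1 - s)) * circ (t - x)"
      by (simp add: d_def z_def a_def w_def circ_diff algebra_simps)
    then have "cmod (d z) \<le> cmod w + cmod (of_real (r * (1 - s)) * circ (t - x))"
      by (metis norm_triangle_ineq)
    also have "cmod (of_real (r * (1 - s)) * circ (t - x)) = \<bar>r * (1 - s)\<bar>"
      by (simp only: norm_mult norm_of_real norm_circ mult_1_right)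
    also have "\<dots> = r * (1 - s)" using r s by simp
    also have "r * (1 - s) \<le> 1 * (1 - r)" using r s True by (intro mult_mono) auto
    finally have dw: "cmod (d z) \<le> 2 * cmod w" using wge by simp
    have pos: "0 < cmod (d z)" "0 < cmod w" using dnz[OF nz] wge r by auto
    have e: "deriv F z / d z = k' z - cnj a * k z / d z" by (simp add: k'_def)
    have "(cmod (deriv F z) / cmod (d z))\<^sup>2 \<le> (cmod (k' z) + cmod (k z) / (1 - r))\<^sup>2"
    proof (rule power_mono)
      have "cmod (deriv F z / d z) \<le> cmod (k' z) + cmod (cnj a * k z / d z)"
        unfolding e by (rule norm_triangle_ineq4)
      also have "cmod (cnj a * k z / d z) \<le> cmod (k z) / (1 - r)"
        unfolding norm_divide norm_mult complex_mod_cnj na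
        using dge[OF nz] r by (intro frac_le mult_left_le_one_le) auto
      finally show "cmod (deriv F z) / cmod (d z) \<le> cmod (k' z) + cmod (k z) / (1 - r)"
        by (simp add: norm_divide)
    qed simp
    also have "\<dots> \<le> 2 * (cmod (k' z))\<^sup>2 + 2 * (cmod (k z) / (1 - r))\<^sup>2"
      using sum_squares_ge_zero[of "cmod (k' z) - cmod (k z) / (1 - r)" 0]
      by (simp add: power2_eq_square algebra_simps)
    finally have 1: "(cmod (deriv F z))\<^sup>2 / (cmod (d z))\<^sup>2 \<le> 2 * ((cmod (k' z))\<^sup>2 + (cmod (k z))\<^sup>2 / (1 - r)\<^sup>2)"
      by (simp add: power_divide)
    have "(cmod (d z))\<^sup>2 \<le> (2 * cmod w)\<^sup>2" using dw by (intro power_mono) auto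
    then have "(cmod (deriv F z))\<^sup>2 / (2 * cmod w)\<^sup>2 \<le> (cmod (deriv F z))\<^sup>2 / (cmod (d z))\<^sup>2"
      using pos by (intro divide_left_mono) auto
    also note 1
    finally have 2: "(cmod (deriv F z))\<^sup>2 / (cmod w)\<^sup>2 \<le> 8 * ((cmod (k' z))\<^sup>2 + (cmod (k z))\<^sup>2 / (1 - r)\<^sup>2)"
      by (simp add: power_mult_distrib)
    have "(1 - r\<^sup>2) * (1 - s) * ((cmod (deriv F z))\<^sup>2 / (cmod w)\<^sup>2) \<le>
        (1 - r\<^sup>2) * (1 - s) * (8 * ((cmod (k' z))\<^sup>2 + (cmod (k z))\<^sup>2 / (1 - r)\<^sup>2))"
      using r s by (intro mult_left_mono 2) (auto simp: power_le_one)
    then have "poisson r (t - x) * ((cmod (deriv F z))\<^sup>2 * (1 - s)) \<le>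
        (8 * (1 - r\<^sup>2)) * ((cmod (k' z))\<^sup>2 * (1 - s) + (cmod (k z))\<^sup>2 * ((1 - s) / (1 - r)\<^sup>2))"
    proof -
      have L: "u / W * (N * v) = u * v * (N / W)" and R: "(8 * u) * (A * v + B * (v / Q)) = u * v * (8 * (A + B / Q))"
        for u v W N A B Q :: real
        by (simp_all add: divide_inverse algebra_simps)
      assume "(1 - r\<^sup>2) * (1 - s) * ((cmod (deriv F z))\<^sup>2 / (cmod w)\<^sup>2) \<le>
        (1 - r\<^sup>2) * (1 - s) * (8 * ((cmod (k' z))\<^sup>2 + (cmod (k z))\<^sup>2 / (1 - r)\<^sup>2))"
      then show ?thesis unfolding poisson_def w L R .
    qed
    then have "ennreal (poisson r (x - t) * ((cmod (deriv F z))\<^sup>2 * (1 - s))) \<le>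
        ennreal ((8 * (1 - r\<^sup>2)) * ((cmod (k' z))\<^sup>2 * (1 - s) + (cmod (k z))\<^sup>2 * ((1 - s) / (1 - r)\<^sup>2)))"
      by (intro ennreal_leI) (simp add: poisson_minus_commute[of r t x])
    moreover have "ennreal (poisson r (x - t) * ((cmod (deriv F z))\<^sup>2 * (1 - s))) =
        ennreal (poisson r (x - t)) * (ennreal ((cmod (deriv F z))\<^sup>2 * (1 - s)) * indicator {r..} s)"
      using r s True by (simp add: ennreal_mult poisson_nonneg)
    moreover have "ennreal ((8 * (1 - r\<^sup>2)) * ((cmod (k' z))\<^sup>2 * (1 - s) + (cmod (k z))\<^sup>2 * ((1 - s) / (1 - r)\<^sup>2))) =
        ennreal (8 * (1 - r\<^sup>2)) * (A t s + B t s)"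
      unfolding A_def B_def z_def[symmetric] using r s True
      by (simp add: ennreal_mult[symmetric] ennreal_plus[symmetric] power_le_one del: ennreal_plus)
    ultimately show ?thesis unfolding z_def by simp
  qed simp
  have "(\<integral>\<^sup>+ t. ennreal (poisson r (x - t)) *
      (\<integral>\<^sup>+ s. ennreal ((cmod (deriv F (of_real s * circ t)))\<^sup>2 * (1 - s)) * indicator {r..} s \<partial>unit_lborel) \<partial>unit_lborel) =
    (\<integral>\<^sup>+ t. \<integral>\<^sup>+ s. ennreal (poisson r (x - t)) *
      (ennreal ((cmod (deriv F (of_real s * circ t)))\<^sup>2 * (1 - s)) * indicator {r..} s) \<partial>unit_lborel \<partial>unit_lborel)"
    by (subst nn_integral_cmult) auto
  also have "\<dots> \<le> (\<integral>\<^sup>+ t. \<integral>\<^sup>+ s. ennreal (8 * (1 - r\<^sup>2)) * (A t s + B t s) \<partial>unit_lborel \<partial>unit_lborel)"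
    by (intro nn_integral_unit_lborel_mono bound)
  also have "\<dots> = ennreal (8 * (1 - r\<^sup>2)) *
     ((\<integral>\<^sup>+ t. \<integral>\<^sup>+ s. A t s \<partial>unit_lborel \<partial>unit_lborel) + (\<integral>\<^sup>+ t. \<integral>\<^sup>+ s. B t s \<partial>unit_lborel \<partial>unit_lborel))"
    by (simp add: nn_integral_cmult nn_integral_add)
  also have "\<dots> \<le> ennreal (8 * (1 - r\<^sup>2)) * (ennreal (1 / 2) * K + ennreal (1 / 2) * K)"
    by (intro mult_left_mono add_mono IA IB) auto
  also have "ennreal (1 / 2) * K + ennreal (1 / 2) * K = K"
  proof -
    have "ennreal (1 / 2) + ennreal (1 / 2) = ennreal (1 / 2 + 1 / 2)" by (rule ennreal_plus[symmetric]) auto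
    then show ?thesis unfolding distrib_right[symmetric] by simp
  qed
  also have "ennreal (8 * (1 - r\<^sup>2)) * K = 8 * (\<integral>\<^sup>+ t. ennreal (1 - r\<^sup>2) * ennreal ((cmod (k (circ t)))\<^sup>2) \<partial>unit_lborel)"
  proof -
    have "ennreal (8 * (1 - r\<^sup>2)) = ennreal 8 * ennreal (1 - r\<^sup>2)"
      using r by (intro ennreal_mult) (auto simp: power_le_one)
    moreover have "(\<integral>\<^sup>+ t. ennreal (1 - r\<^sup>2) * ennreal ((cmod (k (circ t)))\<^sup>2) \<partial>unit_lborel) = ennreal (1 - r\<^sup>2) * K"
      unfolding K_def by (rule nn_integral_cmult) measurable
    ultimately show ?thesis by (simp add: mult.assoc)
  qed
  also have "(\<integral>\<^sup>+ t. ennreal (1 - r\<^sup>2) * ennreal ((cmod (k (circ t)))\<^sup>2) \<partial>unit_lborel) =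
     poisson_int r (\<lambda>t. ennreal ((cmod (F (circ t)))\<^sup>2)) x"
    unfolding poisson_int_def
  proof (rule nn_integral_cong)
    fix t
    have "d (circ t) = 1 - of_real r * circ (t - x)"
      by (simp add: d_def a_def circ_diff algebra_simps)
    then have "(1 - r\<^sup>2) * (cmod (k (circ t)))\<^sup>2 = poisson r (t - x) * (cmod (F (circ t)))\<^sup>2"
      by (simp add: k_def norm_divide power_divide poisson_def)
    then show "ennreal (1 - r\<^sup>2) * ennreal ((cmod (k (circ t)))\<^sup>2) = ennreal (poisson r (x - t)) * ennreal ((cmod (F (circ t)))\<^sup>2)"
      using r by (simp add: ennreal_mult[symmetric] poisson_nonneg power_le_one poisson_minus_commute[of r x t])
  qed
  finally show ?thesis .
qed

section \<open>Large powers of the square function\<close>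

lemma AE_unit_lborel_less_1: "AE x in unit_lborel. 0 \<le> x \<and> x < 1"
proof -
  have "AE x in lborel. x \<noteq> (1::real)" by (rule AE_lborel_singleton)
  then show ?thesis unfolding unit_lborel_def
    by (subst AE_density) (auto simp: indicator_def elim!: eventually_mono)
qed

lemma nn_integral_unit_lborel_mono_less_1:
  assumes "\<And>x. 0 \<le> x \<Longrightarrow> x < 1 \<Longrightarrow> f x \<le> g x"
  shows "(\<integral>\<^sup>+ x. f x \<partial>unit_lborel) \<le> (\<integral>\<^sup>+ x. g x \<partial>unit_lborel)"
proof (rule nn_integral_mono_AE)
  show "AE x in unit_lborel. f x \<le> g x"
    using AE_unit_lborel_less_1 by eventually_elim (auto intro: assms)
qed

lemma nn_integral_unit_lborel_interval:
  fixes w :: "real \<Rightarrow> real"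
  assumes [measurable]: "w \<in> borel_measurable borel" and w: "continuous_on {0..1} w" "\<And>x. x \<in> {0..1} \<Longrightarrow> 0 \<le> w x"
    and ab: "0 \<le> a" "b \<le> 1" and A: "A \<inter> {0..1} = {a..b}" and [measurable]: "A \<in> sets borel"
  shows "(\<integral>\<^sup>+ x. ennreal (w x) * indicator A x \<partial>unit_lborel) = ennreal (integral {a..b} w)"
proof -
  have "continuous_on {a..b} w" using w(1) by (rule continuous_on_subset) (use ab in auto)
  then have "(w has_integral integral {a..b} w) {a..b}"
    by (intro integrable_integral integrable_continuous_interval)
  from nn_integral_has_integral_lebesgue'[OF _ this]
  have "(\<integral>\<^sup>+ x. ennreal (w x) * indicator {a..b} x \<partial>lborel) = ennreal (integral {a..b} w)"
    using w(2) ab by auto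
  moreover have "(\<integral>\<^sup>+ x. ennreal (w x) * indicator A x \<partial>unit_lborel) = (\<integral>\<^sup>+ x. ennreal (w x) * indicator {a..b} x \<partial>lborel)"
    unfolding A[symmetric] by (subst nn_integral_unit_lborel) (auto intro!: nn_integral_cong simp: indicator_def)
  ultimately show ?thesis by simp
qed

text \<open>An iterated form of \<open>X ^ n = n * (n - 1) * \<integral> y ^ (n - 2) * (X - y) dy\<close> with the
  variable \<open>\<sigma> = sqrt r\<close>, which leaves room to smooth the integrand at radius \<open>\<sigma>\<^sup>2\<close> from
  values at radius \<open>\<sigma>\<close>.\<close>

lemma integral_power_iterated:
  fixes w :: "real \<Rightarrow> real" and m :: nat
  assumes [measurable]: "w \<in> borel_measurable borel" and w: "continuous_on {0..1} w" "\<And>x. x \<in> {0..1} \<Longrightarrow> 0 \<le> w x"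
  defines "X \<equiv> (\<integral>\<^sup>+ x. ennreal (w x) \<partial>unit_lborel)"
  shows "X ^ (m + 2) = (\<integral>\<^sup>+ s. ennreal (2 * real (m + 2) * real (m + 1) * s * w (s\<^sup>2)) *
     (\<integral>\<^sup>+ x. ennreal (w x) * indicator {..s\<^sup>2} x \<partial>unit_lborel) ^ m *
     (\<integral>\<^sup>+ x. ennreal (w x) * indicator {s\<^sup>2..} x \<partial>unit_lborel) \<partial>unit_lborel)"
proof -
  define G where "G r = integral {0..r} w" for r
  define Y where "Y = G 1"
  have X: "X = ennreal Y" unfolding X_def Y_def G_def by (rule nn_integral_unit_lborel_integral) (use assms in auto)
  have int: "w integrable_on {a..b}" if "0 \<le> a" "b \<le> 1" for a b
    by (intro integrable_continuous_interval continuous_on_subset[OF w(1)]) (use that in auto)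
  have split: "integral {r..1} w = Y - G r" if "0 \<le> r" "r \<le> 1" for r
    using Henstock_Kurzweil_Integration.integral_combine[of 0 r 1 w] that int[of 0 1] unfolding Y_def G_def by simp
  have G0: "0 \<le> G r" if "r \<le> 1" for r
    unfolding G_def using that int[of 0 r] w(2) by (intro integral_nonneg) auto
  have Gle: "0 \<le> Y - G r" if "0 \<le> r" "r \<le> 1" for r
    unfolding split[OF that, symmetric] using that int[of r 1] w(2) by (intro integral_nonneg) auto
  have dG: "(G has_real_derivative w r) (at r within {0..1})" if "r \<in> {0..1}" for r
    unfolding G_def by (rule integral_has_real_derivative[OF w(1) that])
  have dG2: "((\<lambda>s. G (s\<^sup>2)) has_real_derivative w (s\<^sup>2) * (2 * s)) (at s within {0..1})" if s: "s \<in> {0..1}" for s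
  proof -
    have im: "(\<lambda>s. s\<^sup>2) ` {0..1} \<subseteq> {0..1::real}" by (auto simp: power_le_one)
    have "(G has_real_derivative w (s\<^sup>2)) (at (s\<^sup>2) within (\<lambda>s. s\<^sup>2) ` {0..1})"
      using s by (intro DERIV_subset[OF dG im]) (auto simp: power_le_one)
    moreover have "((\<lambda>s. s\<^sup>2) has_real_derivative 2 * s) (at s within {0..1})"
      by (auto intro!: derivative_eq_intros)
    ultimately show ?thesis using DERIV_image_chain[of G "w (s\<^sup>2)" "\<lambda>s. s\<^sup>2" s "{0..1}" "2 * s"]
      by (simp add: o_def)
  qed
  define u where "u s = 2 * real (m + 2) * real (m + 1) * s * w (s\<^sup>2) * G (s\<^sup>2) ^ m * (Y - G (s\<^sup>2))" for s
  \<comment> \<open>\<open>\<Psi>\<close> is an antiderivative of \<open>u\<close> that vanishes at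
    0; at 1, where \<open>G\<close> is the full integral \<open>Y\<close>, its two terms combine to
    \<open>Y ^ (m + 2)\<close>.\<close>
  define \<Psi> where "\<Psi> s = real (m + 2) * Y * G (s\<^sup>2) ^ (m + 1) - real (m + 1) * G (s\<^sup>2) ^ (m + 2)" for s
  have d\<Psi>: "(\<Psi> has_real_derivative u s) (at s within {0..1})" if "s \<in> {0..1}" for s
  proof -
    have "(\<Psi> has_real_derivative real (m + 2) * Y * (real (m + 1) * (w (s\<^sup>2) * (2 * s)) * G (s\<^sup>2) ^ m)
         - real (m + 1) * (real (m + 2) * (w (s\<^sup>2) * (2 * s)) * G (s\<^sup>2) ^ (m + 1))) (at s within {0..1})"
      unfolding \<Psi>_def by (auto intro!: derivative_eq_intros dG2[OF that] simp del: power_Suc simp: mult_ac)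
    then show ?thesis by (simp add: u_def algebra_simps)
  qed
  have "(u has_integral \<Psi> 1 - \<Psi> 0) {0..1}"
    using d\<Psi> by (intro fundamental_theorem_of_calculus) (auto simp: has_real_derivative_iff_has_vector_derivative)
  moreover have "\<Psi> 1 - \<Psi> 0 = Y ^ (m + 2)"
    by (simp add: \<Psi>_def G_def Y_def algebra_simps)
  ultimately have I: "(u has_integral Y ^ (m + 2)) {0..1}" by simp
  have u0: "0 \<le> u s" if "s \<in> {0..1}" for s
    unfolding u_def using that G0[of "s\<^sup>2"] Gle[of "s\<^sup>2"] w(2)[of "s\<^sup>2"]
    by (intro mult_nonneg_nonneg) (auto simp: power_le_one)
  define v where "v s = ennreal (2 * real (m + 2) * real (m + 1) * s * w (s\<^sup>2)) *
     (\<integral>\<^sup>+ x. ennreal (w x) * indicator {..s\<^sup>2} x \<partial>unit_lborel) ^ m *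
     (\<integral>\<^sup>+ x. ennreal (w x) * indicator {s\<^sup>2..} x \<partial>unit_lborel)" for s
  have [measurable]: "v \<in> borel_measurable borel"
    unfolding v_def indicator_def atMost_iff atLeast_iff by measurable
  have uv: "v s = ennreal (u s)" if s: "s \<in> {0..1}" for s
  proof -
    have s2: "0 \<le> s\<^sup>2" "s\<^sup>2 \<le> 1" using s by (auto simp: power_le_one)
    have "(\<integral>\<^sup>+ x. ennreal (w x) * indicator {..s\<^sup>2} x \<partial>unit_lborel) = ennreal (G (s\<^sup>2))"
      unfolding G_def using s2 by (intro nn_integral_unit_lborel_interval w) auto
    moreover have "(\<integral>\<^sup>+ x. ennreal (w x) * indicator {s\<^sup>2..} x \<partial>unit_lborel) = ennreal (Y - G (s\<^sup>2))"
      unfolding split[OF s2, symmetric] using s2 by (intro nn_integral_unit_lborel_interval w) auto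
    moreover have "0 \<le> 2 * real (m + 2) * real (m + 1) * s * w (s\<^sup>2)"
      using s s2 w(2)[of "s\<^sup>2"] by (intro mult_nonneg_nonneg) auto
    ultimately show ?thesis
      unfolding v_def u_def using G0[OF s2(2)] Gle[OF s2]
      by (simp add: ennreal_power ennreal_mult[symmetric] del: of_nat_add)
  qed
  have "(\<integral>\<^sup>+ s. v s \<partial>unit_lborel) = (\<integral>\<^sup>+ s. ennreal (u s) * indicator {0..1} s \<partial>lborel)"
    by (subst nn_integral_unit_lborel) (auto intro!: nn_integral_cong simp: indicator_def uv)
  also have "\<dots> = ennreal (Y ^ (m + 2))" by (rule nn_integral_has_integral_lebesgue'[OF u0 I])
  also have "\<dots> = X ^ (m + 2)" unfolding X by (rule ennreal_power[symmetric]) (use G0[of 1] in \<open>simp add: Y_def\<close>)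
  finally show ?thesis by (simp add: v_def)
qed

text \<open>The base point is a complex number instead of an angle: for fixed \<open>x\<close> the
  integrand is, up to the weight, the squared modulus of a function of \<open>z\<close> that is
  holomorphic when \<open>D\<close> is.\<close>

definition lp_square_upto :: "(complex \<Rightarrow> complex) \<Rightarrow> real \<Rightarrow> complex \<Rightarrow> ennreal" where
  "lp_square_upto D s z = (\<integral>\<^sup>+ x. ennreal ((cmod (D (of_real x * z)))\<^sup>2 * (1 - x)) * indicator {..s} x \<partial>unit_lborel)"

lemma measurable_lp_square [measurable]:
  assumes [measurable]: "D \<in> borel_measurable borel"
  shows "lp_square D \<in> borel_measurable borel"
  unfolding lp_square_def by measurable

lemma measurable_lp_square_upto [measurable (raw)]:
  assumes [measurable]: "D \<in> borel_measurable borel" "f \<in> borel_measurable M" "g \<in> borel_measurable M"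
  shows "(\<lambda>x. lp_square_upto D (f x) (g x)) \<in> borel_measurable M"
  unfolding lp_square_upto_def indicator_def atMost_iff by measurable

text \<open>\<open>\<bar>h\<bar>\<^sup>2 \<Gamma>\<^sup>m\<close> is an integral of squared moduli of holomorphic functions, hence subharmonic.\<close>

lemma lp_square_upto_subharmonic:
  assumes D: "D holomorphic_on UNIV" and h: "h holomorphic_on UNIV" and r: "0 \<le> r" "r < 1"
  shows "ennreal ((cmod (h (of_real r * circ t)))\<^sup>2) * lp_square_upto D s (of_real r * circ t) ^ m \<le>
    poisson_int r (\<lambda>y. ennreal ((cmod (h (circ y)))\<^sup>2) * lp_square_upto D s (circ y) ^ m) t"
  using h
proof (induction m arbitrary: h)
  case 0
  have "ennreal (cmod ((h (of_real r * circ t))\<^sup>2)) \<le> poisson_int r (\<lambda>y. ennreal (cmod ((h (circ y))\<^sup>2))) t"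
  proof (rule norm_le_poisson_int)
    have "(\<lambda>z. (h z)\<^sup>2) holomorphic_on UNIV" by (intro holomorphic_intros 0)
    then show "continuous_on (cball 0 1) (\<lambda>z. (h z)\<^sup>2)" "(\<lambda>z. (h z)\<^sup>2) holomorphic_on ball 0 1"
      by (auto intro: holomorphic_on_imp_continuous_on holomorphic_on_subset)
    show "(\<lambda>t. cmod ((h (circ t))\<^sup>2)) \<in> borel_measurable borel"
      using entire_measurable[OF 0] by measurable
  qed (use r in auto)
  then show ?case by (simp add: norm_power)
next
  case (Suc m)
  note [measurable] = entire_measurable[OF D] entire_measurable[OF Suc.prems]
  define a where "a = of_real r * circ t"
  define q where "q x = ennreal (1 - x) * indicator {..s} x" for x
  have [measurable]: "q \<in> borel_measurable borel" unfolding q_def by measurable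
  define J where "J z x = ennreal ((cmod (h z * D (of_real x * z)))\<^sup>2) * lp_square_upto D s z ^ m" for z x
  have [measurable]: "case_prod J \<in> borel_measurable (borel \<Otimes>\<^sub>M borel)" unfolding J_def by measurable
  have expand: "ennreal ((cmod (h z))\<^sup>2) * lp_square_upto D s z ^ Suc m = (\<integral>\<^sup>+ x. q x * J z x \<partial>unit_lborel)" for z
  proof -
    have "ennreal ((cmod (h z))\<^sup>2) * lp_square_upto D s z ^ Suc m =
      (ennreal ((cmod (h z))\<^sup>2) * lp_square_upto D s z ^ m) * lp_square_upto D s z"
      by (simp add: mult_ac)
    also have "\<dots> = (\<integral>\<^sup>+ x. (ennreal ((cmod (h z))\<^sup>2) * lp_square_upto D s z ^ m) *
       (ennreal ((cmod (D (of_real x * z)))\<^sup>2 * (1 - x)) * indicator {..s} x) \<partial>unit_lborel)"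
      unfolding lp_square_upto_def[of D s z] by (rule nn_integral_cmult[symmetric]) measurable
    also have "\<dots> = (\<integral>\<^sup>+ x. q x * J z x \<partial>unit_lborel)"
    proof (rule nn_integral_cong)
      fix x
      have 1: "ennreal ((cmod (D (of_real x * z)))\<^sup>2 * (1 - x)) = ennreal ((cmod (D (of_real x * z)))\<^sup>2) * ennreal (1 - x)"
        by (rule ennreal_mult') simp
      have 2: "ennreal ((cmod (h z * D (of_real x * z)))\<^sup>2) = ennreal ((cmod (h z))\<^sup>2) * ennreal ((cmod (D (of_real x * z)))\<^sup>2)"
        by (simp add: norm_mult power_mult_distrib ennreal_mult)
      show "ennreal ((cmod (h z))\<^sup>2) * lp_square_upto D s z ^ m *
        (ennreal ((cmod (D (of_real x * z)))\<^sup>2 * (1 - x)) * indicator {..s} x) = q x * J z x"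
        unfolding q_def J_def 1 2 by (simp only: mult_ac)
    qed
    finally show ?thesis .
  qed
  have "(\<integral>\<^sup>+ x. q x * J a x \<partial>unit_lborel) \<le> (\<integral>\<^sup>+ x. q x * poisson_int r (\<lambda>y. J (circ y) x) t \<partial>unit_lborel)"
  proof (intro nn_integral_mono mult_left_mono)
    fix x
    have "(\<lambda>z. D (of_real x * z)) holomorphic_on UNIV"
      using holomorphic_on_compose_gen[of "\<lambda>z. of_real x * z" UNIV D UNIV] D
      by (simp add: o_def holomorphic_intros)
    \<comment> \<open>One factor of the power has been written as an integral over \<open>x\<close>,
      and its integrand is merged into \<open>h\<close>; this is why the induction quantifies over
      \<open>h\<close>.\<close>
    then have "(\<lambda>z. h z * D (of_real x * z)) holomorphic_on UNIV"
      by (intro holomorphic_on_mult Suc.prems)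
    from Suc.IH[OF this] show "J a x \<le> poisson_int r (\<lambda>y. J (circ y) x) t"
      unfolding J_def a_def .
  qed simp
  also have "\<dots> = (\<integral>\<^sup>+ x. \<integral>\<^sup>+ y. q x * (ennreal (poisson r (t - y)) * J (circ y) x) \<partial>unit_lborel \<partial>unit_lborel)"
    unfolding poisson_int_def by (subst nn_integral_cmult) auto
  also have "\<dots> = (\<integral>\<^sup>+ y. \<integral>\<^sup>+ x. q x * (ennreal (poisson r (t - y)) * J (circ y) x) \<partial>unit_lborel \<partial>unit_lborel)"
    by (rule ULP.Fubini') measurable
  also have "\<dots> = (\<integral>\<^sup>+ y. \<integral>\<^sup>+ x. ennreal (poisson r (t - y)) * (q x * J (circ y) x) \<partial>unit_lborel \<partial>unit_lborel)"
    by (simp add: mult_ac)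
  also have "\<dots> = (\<integral>\<^sup>+ y. ennreal (poisson r (t - y)) * (\<integral>\<^sup>+ x. q x * J (circ y) x \<partial>unit_lborel) \<partial>unit_lborel)"
    by (subst nn_integral_cmult) auto
  finally show ?case unfolding expand[symmetric] poisson_int_def a_def .
qed

text \<open>Substituting \<open>s x\<close> for \<open>x\<close> maps \<open>[0, s]\<close> onto
  \<open>[0, s^2]\<close>, where \<open>1 - s x \<le> 1 - x^2 \<le> 2 (1 - x)\<close>. The part up
  to radius \<open>s^2\<close> is thus expressed through the point \<open>s z\<close> inside the
  disc, where subharmonicity can be used.\<close>

lemma lp_square_upto_scale:
  assumes [measurable]: "D \<in> borel_measurable borel" and s: "0 < s" "s \<le> 1"
  shows "lp_square_upto D (s\<^sup>2) z \<le> 2 * lp_square_upto D s (of_real s * z)"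
proof -
  define f where "f x = ennreal ((cmod (D (of_real x * z)))\<^sup>2 * (1 - x)) * indicator {0..s\<^sup>2} x" for x
  have s2: "s\<^sup>2 \<le> 1" using s by (simp add: power_le_one)
  have [measurable]: "f \<in> borel_measurable borel" unfolding f_def by measurable
  have "lp_square_upto D (s\<^sup>2) z = (\<integral>\<^sup>+ x. f x \<partial>lborel)"
    unfolding lp_square_upto_def f_def using s2
    by (subst nn_integral_unit_lborel) (auto intro!: nn_integral_cong simp: indicator_def)
  also have "\<dots> = ennreal s * (\<integral>\<^sup>+ x. f (s * x) \<partial>lborel)"
    using nn_integral_real_affine[of f s 0] s by simp
  also have "\<dots> \<le> 1 * (\<integral>\<^sup>+ x. f (s * x) \<partial>lborel)"
    using s by (intro mult_right_mono) auto
  also have "\<dots> \<le> 1 * (\<integral>\<^sup>+ x. 2 * (ennreal ((cmod (D (of_real x * (of_real s * z))))\<^sup>2 * (1 - x)) * indicator {..s} x * indicator {0..1} x) \<partial>lborel)"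
  proof (intro mult_left_mono nn_integral_mono)
    fix x
    show "f (s * x) \<le> 2 * (ennreal ((cmod (D (of_real x * (of_real s * z))))\<^sup>2 * (1 - x)) * indicator {..s} x * indicator {0..1} x)"
    proof (cases "s * x \<in> {0..s\<^sup>2}")
      case True
      then have x: "0 \<le> x" "x \<le> s" using s by (auto simp: zero_le_mult_iff power2_eq_square)
      have "x * x \<le> s * x" using x by (intro mult_right_mono) auto
      moreover have "(1 - x) * (1 + x) \<le> (1 - x) * 2" using x s by (intro mult_left_mono) auto
      ultimately have "1 - s * x \<le> 2 * (1 - x)" by (simp add: algebra_simps)
      then have "ennreal ((cmod (D (of_real x * (of_real s * z))))\<^sup>2 * (1 - s * x)) \<le>
          ennreal ((cmod (D (of_real x * (of_real s * z))))\<^sup>2 * (2 * (1 - x)))"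
        by (intro ennreal_leI mult_left_mono) auto
      also have "\<dots> = 2 * ennreal ((cmod (D (of_real x * (of_real s * z))))\<^sup>2 * (1 - x))"
      proof -
        have "ennreal (2 * ((cmod (D (of_real x * (of_real s * z))))\<^sup>2 * (1 - x))) =
            ennreal 2 * ennreal ((cmod (D (of_real x * (of_real s * z))))\<^sup>2 * (1 - x))"
          by (rule ennreal_mult') simp
        then show ?thesis by (simp only: mult.left_commute ennreal_numeral)
      qed
      finally show ?thesis using True x s by (simp add: f_def mult_ac)
    qed (simp add: f_def)
  qed auto
  also have "\<dots> = 2 * lp_square_upto D s (of_real s * z)"
    unfolding lp_square_upto_def by (subst nn_integral_unit_lborel) (auto simp: nn_integral_cmult)
  finally show ?thesis .
qed

lemma lp_square_upto_le: "lp_square_upto D s (circ y) \<le> lp_square D y"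
  unfolding lp_square_upto_def lp_square_def by (intro nn_integral_mono) (auto simp: indicator_def)

text \<open>The averages are of \<open>|F|^2\<close>, not \<open>|F|\<close>, so this has the
  homogeneity of \<open>lp_square (deriv F)\<close> and both compare without roots.\<close>

definition boundary_max :: "(complex \<Rightarrow> complex) \<Rightarrow> real \<Rightarrow> ennreal" where
  "boundary_max F = poisson_max (\<lambda>t. ennreal ((cmod (F (circ t)))\<^sup>2))"

lemma measurable_boundary_max [measurable]:
  assumes [measurable]: "F \<in> borel_measurable borel"
  shows "boundary_max F \<in> borel_measurable borel"
  unfolding boundary_max_def by measurable

text \<open>In the iterated integral the front factor at radius \<open>s^2\<close> is at most a
  Poisson integral, of index \<open>s\<close>, of values at radius \<open>s\<close>. By symmetry the
  kernel moves to the tail, where the local area estimate turns it into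
  \<open>boundary_max F\<close>; the remaining integral over \<open>s\<close> restores one factor
  \<open>lp_square D\<close>.\<close>

theorem lp_square_power_le:
  fixes m :: nat
  assumes F: "F holomorphic_on UNIV"
  defines "D \<equiv> deriv F" and "C \<equiv> 2 ^ (m + 1) * (2 * real (m + 2) * real (m + 1)) * 512"
  shows "(\<integral>\<^sup>+ t. lp_square D t ^ (m + 2) \<partial>unit_lborel) \<le>
    ennreal C * (\<integral>\<^sup>+ t. lp_square D t ^ (m + 1) * boundary_max F t \<partial>unit_lborel)"
proof -
  have Dh: "D holomorphic_on UNIV" unfolding D_def by (rule entire_deriv[OF F])
  note [measurable] = entire_measurable[OF F] entire_measurable[OF Dh]
  define w where "w t x = (cmod (D (of_real x * circ t)))\<^sup>2 * (1 - x)" for t x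
  define H where "H s t = (\<integral>\<^sup>+ x. ennreal (w t x) * indicator {s..} x \<partial>unit_lborel)" for s t
  define c where "c = 2 * real (m + 2) * real (m + 1)"
  have c0: "0 \<le> c" unfolding c_def by simp
  define f where "f s y = ennreal ((cmod (D (of_real s * circ y)))\<^sup>2) * lp_square_upto D s (circ y) ^ m" for s y
  have [measurable]: "case_prod H \<in> borel_measurable (borel \<Otimes>\<^sub>M borel)"
    unfolding H_def w_def indicator_def atLeast_iff by measurable
  have [measurable]: "case_prod f \<in> borel_measurable (borel \<Otimes>\<^sub>M borel)" unfolding f_def by measurable
  have Hs [measurable]: "H s \<in> borel_measurable borel" "f s \<in> borel_measurable borel" for s by measurable
  have [measurable]: "(\<lambda>x. poisson_int (fst x) (f (fst x)) (snd x)) \<in> borel_measurable (borel \<Otimes>\<^sub>M borel)"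
    unfolding poisson_int_def by measurable
  have X: "lp_square D t ^ (m + 2) = (\<integral>\<^sup>+ s. ennreal (c * s * w t (s\<^sup>2)) *
     lp_square_upto D (s\<^sup>2) (circ t) ^ m * H (s\<^sup>2) t \<partial>unit_lborel)" for t
  proof -
    have [measurable]: "w t \<in> borel_measurable borel" unfolding w_def by measurable
    have "continuous_on {0..1} (w t)" unfolding w_def
      by (intro continuous_intros continuous_on_compose2[OF holomorphic_on_imp_continuous_on[OF Dh]]) auto
    moreover have "0 \<le> w t x" if "x \<in> {0..1}" for x using that by (simp add: w_def)
    ultimately show ?thesis
      using integral_power_iterated[of "w t" m]
      unfolding lp_square_def lp_square_upto_def H_def c_def w_def by simp
  qed
  have step1: "ennreal (c * s * w t (s\<^sup>2)) * lp_square_upto D (s\<^sup>2) (circ t) ^ m \<le>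
     ennreal (c * 2 ^ (m + 1)) * (ennreal (1 - s) * poisson_int s (f s) t)" if s: "0 \<le> s" "s < 1" for s t
  proof (cases "s = 0")
    case False
    then have s0: "0 < s" using s by simp
    define h where "h z = D (of_real s * z)" for z
    have hh: "h holomorphic_on UNIV" unfolding h_def
      using holomorphic_on_compose_gen[of "\<lambda>z. of_real s * z" UNIV D UNIV] Dh
      by (simp add: o_def holomorphic_intros)
    define a where "a = of_real s * circ t"
    \<comment> \<open>The weight at radius \<open>s^2\<close>, together with the Jacobian
      \<open>s\<close>, is at most twice the weight at radius \<open>s\<close>.\<close>
    have "s * (1 - s\<^sup>2) \<le> 1 * ((1 - s) * 2)"
    proof (intro mult_mono)
      have "(1 - s) * (1 + s) \<le> (1 - s) * 2" using s by (intro mult_left_mono) auto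
      then show "1 - s\<^sup>2 \<le> (1 - s) * 2" by (simp add: algebra_simps power2_eq_square)
    qed (use s in \<open>auto simp: power_le_one\<close>)
    then have "(c * (cmod (h a))\<^sup>2) * (s * (1 - s\<^sup>2)) \<le> (c * (cmod (h a))\<^sup>2) * (1 * ((1 - s) * 2))"
      using c0 by (intro mult_left_mono) auto
    moreover have "of_real (s\<^sup>2) * circ t = of_real s * a" by (simp add: a_def power2_eq_square)
    then have "w t (s\<^sup>2) = (cmod (h a))\<^sup>2 * (1 - s\<^sup>2)" by (simp add: w_def h_def)
    ultimately have "c * s * w t (s\<^sup>2) \<le> (c * 2) * ((1 - s) * (cmod (h a))\<^sup>2)"
      by (simp only: mult_ac mult_1)
    then have 1: "ennreal (c * s * w t (s\<^sup>2)) \<le> ennreal (c * 2) * (ennreal (1 - s) * ennreal ((cmod (h a))\<^sup>2))"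
      using c0 s by (subst ennreal_mult[symmetric]; simp)+
    have "lp_square_upto D (s\<^sup>2) (circ t) ^ m \<le> (2 * lp_square_upto D s a) ^ m"
      unfolding a_def using s s0 by (intro power_mono_ennreal lp_square_upto_scale) auto
    also have "\<dots> = ennreal (2 ^ m) * lp_square_upto D s a ^ m"
      by (simp add: power_mult_distrib ennreal_power[symmetric])
    finally have "ennreal (c * s * w t (s\<^sup>2)) * lp_square_upto D (s\<^sup>2) (circ t) ^ m \<le>
       (ennreal (c * 2) * (ennreal (1 - s) * ennreal ((cmod (h a))\<^sup>2))) * (ennreal (2 ^ m) * lp_square_upto D s a ^ m)"
      by (intro mult_mono 1) auto
    also have "\<dots> = (ennreal (c * 2) * ennreal (2 ^ m)) * (ennreal (1 - s) * (ennreal ((cmod (h a))\<^sup>2) * lp_square_upto D s a ^ m))"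
      by (simp add: mult_ac)
    also have "ennreal (c * 2) * ennreal (2 ^ m) = ennreal (c * 2 ^ (m + 1))"
      using c0 by (simp add: ennreal_mult[symmetric] mult_ac)
    also have "ennreal ((cmod (h a))\<^sup>2) * lp_square_upto D s a ^ m \<le> poisson_int s (f s) t"
      using lp_square_upto_subharmonic[OF Dh hh s, of t s m] unfolding f_def a_def h_def .
    finally show ?thesis by (simp add: mult_left_mono)
  qed simp
  \<comment> \<open>512 = 8 * 8 * 8: the kernel passes from radius \<open>s\<close> to
    \<open>s^2\<close>, the local area estimate is used, and the radius \<open>s^2\<close> is
    replaced by the discrete ones.\<close>
  have step2: "poisson_int s (H (s\<^sup>2)) y \<le> 512 * boundary_max F y" if s: "0 \<le> s" "s < 1" for s y
  proof -
    have s2: "0 \<le> s\<^sup>2" "s\<^sup>2 < 1" using s by (auto simp: power_less_one_iff)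
    have le: "s\<^sup>2 \<le> s" using s by (simp add: power2_eq_square mult_left_le)
    have "poisson s x \<le> 8 * poisson (s\<^sup>2) x" for x
    proof (rule poisson_compare)
      have "s * (1 - s) \<le> 1 * (1 - s)" using s by (intro mult_right_mono) auto
      then show "\<bar>s - s\<^sup>2\<bar> \<le> 1 - s" using le by (simp add: algebra_simps power2_eq_square)
      have "(s\<^sup>2)\<^sup>2 \<le> s\<^sup>2" using le s by (intro power_mono) auto
      moreover have "(s\<^sup>2)\<^sup>2 \<le> 1" by (rule power_le_one) (use s2 in auto)
      moreover have "1 - y \<le> 2 * (1 - x)" if "x \<le> y" "x \<le> 1" for x y :: real
        using that by simp
      ultimately show "1 - s\<^sup>2 \<le> 2 * (1 - (s\<^sup>2)\<^sup>2)" by blast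
    qed (use s s2 in auto)
    then have "poisson_int s (H (s\<^sup>2)) y \<le> 8 * poisson_int (s\<^sup>2) (H (s\<^sup>2)) y"
      using s2 by (intro poisson_int_compare) auto
    also have "\<dots> \<le> 8 * (8 * poisson_int (s\<^sup>2) (\<lambda>t. ennreal ((cmod (F (circ t)))\<^sup>2)) y)"
      using local_area_integral_le[OF F s2, of y]
      by (intro mult_left_mono) (auto simp: poisson_int_def H_def w_def D_def)
    also have "\<dots> \<le> 8 * (8 * (8 * boundary_max F y))"
      unfolding boundary_max_def using s2 by (intro mult_left_mono poisson_int_le_max) auto
    also have "\<dots> = 512 * boundary_max F y" by (simp add: mult.assoc[symmetric])
    finally show ?thesis .
  qed
  have "(\<integral>\<^sup>+ t. lp_square D t ^ (m + 2) \<partial>unit_lborel) \<le> (\<integral>\<^sup>+ t. \<integral>\<^sup>+ s.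
     ennreal (c * 2 ^ (m + 1)) * (ennreal (1 - s) * (poisson_int s (f s) t * H (s\<^sup>2) t)) \<partial>unit_lborel \<partial>unit_lborel)"
    unfolding X
  proof (rule nn_integral_mono, rule nn_integral_unit_lborel_mono_less_1)
    fix t s :: real assume s: "0 \<le> s" "s < 1"
    show "ennreal (c * s * w t (s\<^sup>2)) * lp_square_upto D (s\<^sup>2) (circ t) ^ m * H (s\<^sup>2) t \<le>
       ennreal (c * 2 ^ (m + 1)) * (ennreal (1 - s) * (poisson_int s (f s) t * H (s\<^sup>2) t))"
      using mult_right_mono[OF step1[OF s, of t], of "H (s\<^sup>2) t"] by (simp add: mult.assoc)
  qed
  also have "\<dots> = (\<integral>\<^sup>+ s. \<integral>\<^sup>+ t.
     ennreal (c * 2 ^ (m + 1)) * (ennreal (1 - s) * (poisson_int s (f s) t * H (s\<^sup>2) t)) \<partial>unit_lborel \<partial>unit_lborel)"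
    by (rule ULP.Fubini') measurable
  also have "\<dots> = ennreal (c * 2 ^ (m + 1)) * (\<integral>\<^sup>+ s. ennreal (1 - s) * (\<integral>\<^sup>+ t. poisson_int s (f s) t * H (s\<^sup>2) t \<partial>unit_lborel) \<partial>unit_lborel)"
    by (simp add: nn_integral_cmult)
  also have "(\<integral>\<^sup>+ s. ennreal (1 - s) * (\<integral>\<^sup>+ t. poisson_int s (f s) t * H (s\<^sup>2) t \<partial>unit_lborel) \<partial>unit_lborel) \<le>
     (\<integral>\<^sup>+ s. \<integral>\<^sup>+ y. 512 * (ennreal (w y s) * (lp_square D y ^ m * boundary_max F y)) \<partial>unit_lborel \<partial>unit_lborel)"
  proof (rule nn_integral_unit_lborel_mono_less_1)
    fix s :: real assume s: "0 \<le> s" "s < 1"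
    have "(\<integral>\<^sup>+ t. poisson_int s (f s) t * H (s\<^sup>2) t \<partial>unit_lborel) = (\<integral>\<^sup>+ y. f s y * poisson_int s (H (s\<^sup>2)) y \<partial>unit_lborel)"
      by (rule poisson_int_symmetric[symmetric]) measurable
    also have "\<dots> \<le> (\<integral>\<^sup>+ y. (ennreal ((cmod (D (of_real s * circ y)))\<^sup>2) * lp_square D y ^ m) * (512 * boundary_max F y) \<partial>unit_lborel)"
      unfolding f_def[of s] using s by (intro nn_integral_mono mult_mono step2 power_mono_ennreal lp_square_upto_le) auto
    finally have "ennreal (1 - s) * (\<integral>\<^sup>+ t. poisson_int s (f s) t * H (s\<^sup>2) t \<partial>unit_lborel) \<le>
        ennreal (1 - s) * \<dots>" by (rule mult_left_mono) simp
    also have "\<dots> = (\<integral>\<^sup>+ y. ennreal (1 - s) * ((ennreal ((cmod (D (of_real s * circ y)))\<^sup>2) * lp_square D y ^ m) * (512 * boundary_max F y)) \<partial>unit_lborel)"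
      by (rule nn_integral_cmult[symmetric]) measurable
    also have "\<dots> = (\<integral>\<^sup>+ y. 512 * (ennreal (w y s) * (lp_square D y ^ m * boundary_max F y)) \<partial>unit_lborel)"
      using s by (intro nn_integral_cong) (simp add: w_def ennreal_mult mult_ac)
    finally show "ennreal (1 - s) * (\<integral>\<^sup>+ t. poisson_int s (f s) t * H (s\<^sup>2) t \<partial>unit_lborel) \<le> \<dots>" .
  qed
  also have "(\<integral>\<^sup>+ s. \<integral>\<^sup>+ y. 512 * (ennreal (w y s) * (lp_square D y ^ m * boundary_max F y)) \<partial>unit_lborel \<partial>unit_lborel) =
     (\<integral>\<^sup>+ y. \<integral>\<^sup>+ s. 512 * (ennreal (w y s) * (lp_square D y ^ m * boundary_max F y)) \<partial>unit_lborel \<partial>unit_lborel)"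
    unfolding w_def by (rule ULP.Fubini') measurable
  also have "\<dots> = (\<integral>\<^sup>+ y. 512 * (lp_square D y ^ (m + 1) * boundary_max F y) \<partial>unit_lborel)"
  proof (rule nn_integral_cong)
    fix y
    have "(\<integral>\<^sup>+ s. 512 * (ennreal (w y s) * (lp_square D y ^ m * boundary_max F y)) \<partial>unit_lborel) =
      (\<integral>\<^sup>+ s. ennreal (w y s) * (512 * (lp_square D y ^ m * boundary_max F y)) \<partial>unit_lborel)"
      by (simp add: mult_ac)
    also have "\<dots> = lp_square D y * (512 * (lp_square D y ^ m * boundary_max F y))"
      unfolding lp_square_def[of D y] w_def by (rule nn_integral_multc) measurable
    finally show "(\<integral>\<^sup>+ s. 512 * (ennreal (w y s) * (lp_square D y ^ m * boundary_max F y)) \<partial>unit_lborel) =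
      512 * (lp_square D y ^ (m + 1) * boundary_max F y)" by (simp add: mult_ac)
  qed
  also have "\<dots> = 512 * (\<integral>\<^sup>+ y. lp_square D y ^ (m + 1) * boundary_max F y \<partial>unit_lborel)"
    by (rule nn_integral_cmult) measurable
  also have "ennreal (c * 2 ^ (m + 1)) * (512 * (\<integral>\<^sup>+ y. lp_square D y ^ (m + 1) * boundary_max F y \<partial>unit_lborel)) =
     ennreal C * (\<integral>\<^sup>+ y. lp_square D y ^ (m + 1) * boundary_max F y \<partial>unit_lborel)"
  proof -
    have "C = (c * 2 ^ (m + 1)) * 512" by (simp add: C_def c_def)
    then have "ennreal C = ennreal (c * 2 ^ (m + 1)) * ennreal 512"
      using c0 by (simp only: ennreal_mult zero_le_power zero_le_numeral mult_nonneg_nonneg)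
    then show ?thesis by (simp add: mult.assoc)
  qed
  finally show ?thesis by (simp add: mult_left_mono)
qed

section \<open>Boundary norm estimates without zeros\<close>

text \<open>With \<open>B = 2 C M\<close>, comparing \<open>B\<close> and \<open>X\<close> pointwise
  gives \<open>B X^(m+1) \<le> X^(m+2) + B^(m+2)\<close>. Doubling the hypothesis leaves a spare
  copy of the left integral, and the other copy cancels because it is finite.\<close>

lemma nn_integral_power_absorb:
  fixes X M :: "real \<Rightarrow> ennreal"
  assumes [measurable]: "X \<in> borel_measurable borel" "M \<in> borel_measurable borel"
    and C: "0 \<le> C"
    and le: "(\<integral>\<^sup>+ t. X t ^ (m + 2) \<partial>unit_lborel) \<le> ennreal C * (\<integral>\<^sup>+ t. X t ^ (m + 1) * M t \<partial>unit_lborel)"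
    and fin: "(\<integral>\<^sup>+ t. X t ^ (m + 2) \<partial>unit_lborel) < top"
  shows "(\<integral>\<^sup>+ t. X t ^ (m + 2) \<partial>unit_lborel) \<le> ennreal ((2 * C) ^ (m + 2)) * (\<integral>\<^sup>+ t. M t ^ (m + 2) \<partial>unit_lborel)"
proof -
  define Y where "Y = (\<integral>\<^sup>+ t. X t ^ (m + 2) \<partial>unit_lborel)"
  define B where "B t = ennreal (2 * C) * M t" for t
  have [measurable]: "B \<in> borel_measurable borel" unfolding B_def by measurable
  have *: "B t * X t ^ (m + 1) \<le> X t ^ (m + 2) + B t ^ (m + 2)" for t
  proof (cases "B t \<le> X t")
    case True
    then have "B t * X t ^ (m + 1) \<le> X t * X t ^ (m + 1)" by (rule mult_right_mono) simp
    then show ?thesis by (simp add: add_increasing2)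
  next
    case False
    then have "B t * X t ^ (m + 1) \<le> B t * B t ^ (m + 1)"
      by (intro mult_left_mono power_mono_ennreal) auto
    then show ?thesis by (simp add: add_increasing)
  qed
  have "Y + Y = 2 * Y" by (simp add: mult_2)
  also have "\<dots> \<le> 2 * (ennreal C * (\<integral>\<^sup>+ t. X t ^ (m + 1) * M t \<partial>unit_lborel))"
    using le unfolding Y_def by (rule mult_left_mono) simp
  also have "\<dots> = ennreal (2 * C) * (\<integral>\<^sup>+ t. X t ^ (m + 1) * M t \<partial>unit_lborel)"
    using C by (simp add: ennreal_mult mult.assoc)
  also have "\<dots> = (\<integral>\<^sup>+ t. ennreal (2 * C) * (X t ^ (m + 1) * M t) \<partial>unit_lborel)"
    by (rule nn_integral_cmult[symmetric]) measurable
  also have "\<dots> = (\<integral>\<^sup>+ t. B t * X t ^ (m + 1) \<partial>unit_lborel)"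
    by (simp only: B_def mult_ac)
  also have "\<dots> \<le> (\<integral>\<^sup>+ t. X t ^ (m + 2) + B t ^ (m + 2) \<partial>unit_lborel)"
    by (intro nn_integral_mono *)
  also have "\<dots> = Y + (\<integral>\<^sup>+ t. B t ^ (m + 2) \<partial>unit_lborel)"
    unfolding Y_def by (rule nn_integral_add) measurable
  finally have "Y \<le> (\<integral>\<^sup>+ t. B t ^ (m + 2) \<partial>unit_lborel)"
    using fin unfolding Y_def[symmetric] by (auto simp: ennreal_add_left_cancel_le)
  also have "\<dots> = (\<integral>\<^sup>+ t. ennreal ((2 * C) ^ (m + 2)) * M t ^ (m + 2) \<partial>unit_lborel)"
  proof -
    have "(ennreal (2 * C) * M t) ^ (m + 2) = ennreal ((2 * C) ^ (m + 2)) * M t ^ (m + 2)" for t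
      using C by (subst power_mult_distrib, subst ennreal_power) auto
    then show ?thesis by (simp only: B_def)
  qed
  also have "\<dots> = ennreal ((2 * C) ^ (m + 2)) * (\<integral>\<^sup>+ t. M t ^ (m + 2) \<partial>unit_lborel)"
    by (rule nn_integral_cmult) measurable
  finally show ?thesis unfolding Y_def .
qed

text \<open>This supplies the finiteness that absorption requires: the derivative of an entire
  function is bounded on the closed disc.\<close>

lemma lp_square_bounded:
  assumes "F holomorphic_on UNIV"
  obtains K where "\<And>t. lp_square (deriv F) t \<le> ennreal K"
proof -
  have "continuous_on (cball 0 1) (deriv F)"
    by (intro holomorphic_on_imp_continuous_on holomorphic_on_subset[OF entire_deriv[OF assms]]) auto
  then obtain K where K: "0 < K" "\<And>z. cmod z \<le> 1 \<Longrightarrow> cmod (deriv F z) \<le> K"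
    using bounded_on_cball by blast
  have "lp_square (deriv F) t \<le> ennreal (K\<^sup>2)" for t
  proof -
    have "lp_square (deriv F) t \<le> (\<integral>\<^sup>+ x. ennreal (K\<^sup>2) \<partial>unit_lborel)"
      unfolding lp_square_def
    proof (rule nn_integral_unit_lborel_mono)
      fix x :: real assume x: "0 \<le> x" "x \<le> 1"
      have "(cmod (deriv F (of_real x * circ t)))\<^sup>2 * (1 - x) \<le> K\<^sup>2 * 1"
        using x by (intro mult_mono power_mono K) (auto simp: norm_mult)
      then show "ennreal ((cmod (deriv F (of_real x * circ t)))\<^sup>2 * (1 - x)) \<le> ennreal (K\<^sup>2)"
        by (intro ennreal_leI) simp
    qed
    then show ?thesis by simp
  qed
  then show ?thesis by (rule that)
qed

lemma boundary_max_power: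
  assumes "F holomorphic_on UNIV"
  shows "(\<integral>\<^sup>+ t. boundary_max F t ^ (2 ^ Suc i) \<partial>unit_lborel) \<le>
    257 * (\<integral>\<^sup>+ t. ennreal ((cmod (F (circ t)))\<^sup>2) ^ (2 ^ Suc i) \<partial>unit_lborel)"
proof -
  note [measurable] = entire_measurable[OF assms]
  show ?thesis unfolding boundary_max_def by (rule poisson_max_power) measurable
qed

theorem lp_square_power_bound:
  obtains C where "0 < C"
    "\<And>F. F holomorphic_on UNIV \<Longrightarrow> (\<integral>\<^sup>+ t. lp_square (deriv F) t ^ (2 ^ Suc i) \<partial>unit_lborel) \<le>
      ennreal C * (\<integral>\<^sup>+ t. ennreal ((cmod (F (circ t)))\<^sup>2) ^ (2 ^ Suc i) \<partial>unit_lborel)"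
proof -
  \<comment> \<open>The exponent is dyadic, as in the maximal inequality, and at least 2, as the
    iterated integral requires.\<close>
  define m :: nat where "m = 2 ^ Suc i - 2"
  have "(2::nat) ^ 1 \<le> 2 ^ Suc i" by (rule power_increasing) auto
  then have "(2::nat) \<le> 2 ^ Suc i" by (simp only: power_one_right)
  then have m: "2 ^ Suc i = m + 2" unfolding m_def by (rule le_add_diff_inverse2[symmetric])
  define C where "C = 2 ^ (m + 1) * (2 * real (m + 2) * real (m + 1)) * 512"
  have C: "0 < C" unfolding C_def by simp
  have "(\<integral>\<^sup>+ t. lp_square (deriv F) t ^ (2 ^ Suc i) \<partial>unit_lborel) \<le>
      ennreal ((2 * C) ^ (m + 2) * 257) * (\<integral>\<^sup>+ t. ennreal ((cmod (F (circ t)))\<^sup>2) ^ (2 ^ Suc i) \<partial>unit_lborel)"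
    if F: "F holomorphic_on UNIV" for F
  proof -
    note [measurable] = entire_measurable[OF F] entire_measurable[OF entire_deriv[OF F]]
    obtain K where K: "\<And>t. lp_square (deriv F) t \<le> ennreal K" using lp_square_bounded[OF F] by blast
    have "(\<integral>\<^sup>+ t. lp_square (deriv F) t ^ (m + 2) \<partial>unit_lborel) \<le> (\<integral>\<^sup>+ t. ennreal K ^ (m + 2) \<partial>unit_lborel)"
      by (intro nn_integral_mono power_mono_ennreal K)
    also have "\<dots> < top" by (simp add: ennreal_mult_less_top power_less_top_ennreal)
    finally have fin: "(\<integral>\<^sup>+ t. lp_square (deriv F) t ^ (m + 2) \<partial>unit_lborel) < top" .
    have "(\<integral>\<^sup>+ t. lp_square (deriv F) t ^ (m + 2) \<partial>unit_lborel) \<le>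
       ennreal ((2 * C) ^ (m + 2)) * (\<integral>\<^sup>+ t. boundary_max F t ^ (m + 2) \<partial>unit_lborel)"
      by (rule nn_integral_power_absorb[OF _ _ _ _ fin])
         (use C lp_square_power_le[OF F, of m] in \<open>auto simp: C_def\<close>)
    also have "\<dots> \<le> ennreal ((2 * C) ^ (m + 2)) * (257 * (\<integral>\<^sup>+ t. ennreal ((cmod (F (circ t)))\<^sup>2) ^ (2 ^ Suc i) \<partial>unit_lborel))"
      unfolding m[symmetric] by (intro mult_left_mono boundary_max_power F) auto
    also have "\<dots> = ennreal ((2 * C) ^ (m + 2) * 257) * (\<integral>\<^sup>+ t. ennreal ((cmod (F (circ t)))\<^sup>2) ^ (2 ^ Suc i) \<partial>unit_lborel)"
    proof -
      have "ennreal ((2 * C) ^ (m + 2) * 257) = ennreal ((2 * C) ^ (m + 2)) * ennreal 257"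
        using C by (intro ennreal_mult) auto
      then show ?thesis by (simp add: mult.assoc)
    qed
    finally show ?thesis unfolding m .
  qed
  moreover have "0 < (2 * C) ^ (m + 2) * 257" using C by simp
  ultimately show ?thesis using that by blast
qed

text \<open>For the derivative, subharmonicity is applied to the difference quotient of
  \<open>F\<close> at \<open>a\<close>, whose value at \<open>a\<close> is \<open>F'\<close>; on the
  circle its denominator is at least \<open>1 - r\<close>. The factor \<open>(1 - r)^2\<close>
  leaves 4 Poisson averages of \<open>|F|^2\<close>, each at most
  \<open>8 * boundary_max F t\<close>.\<close>

lemma norm_square_le_boundary_max:
  assumes F: "F holomorphic_on UNIV" and r: "0 \<le> r" "r < 1"
  shows "ennreal ((cmod (F (of_real r * circ t)))\<^sup>2) \<le> 8 * boundary_max F t"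
    and "ennreal (((1 - r) * cmod (deriv F (of_real r * circ t)))\<^sup>2) \<le> 32 * boundary_max F t"
proof -
  note [measurable] = entire_measurable[OF F] entire_measurable[OF entire_deriv[OF F]]
  define a where "a = of_real r * circ t"
  have na: "cmod a = r" using r by (simp add: a_def norm_mult)
  define P where "P = poisson_int r (\<lambda>y. ennreal ((cmod (F (circ y)))\<^sup>2)) t"
  have sq: "ennreal ((cmod (h a))\<^sup>2) \<le> poisson_int r (\<lambda>y. ennreal ((cmod (h (circ y)))\<^sup>2)) t"
    if h: "h holomorphic_on UNIV" for h
  proof -
    have "(\<lambda>z. (h z)\<^sup>2) holomorphic_on UNIV" by (intro holomorphic_intros h)
    then have "continuous_on (cball 0 1) (\<lambda>z. (h z)\<^sup>2)" "(\<lambda>z. (h z)\<^sup>2) holomorphic_on ball 0 1"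
      by (auto intro: holomorphic_on_imp_continuous_on holomorphic_on_subset)
    from norm_le_poisson_int[OF this r, of t] entire_measurable[OF h] show ?thesis
      unfolding a_def by (simp add: norm_power)
  qed
  have FP: "ennreal ((cmod (F a))\<^sup>2) \<le> P" unfolding P_def by (rule sq[OF F])
  have PM: "P \<le> 8 * boundary_max F t"
    unfolding P_def boundary_max_def by (rule poisson_int_le_max) (use r in auto)
  show "ennreal ((cmod (F (of_real r * circ t)))\<^sup>2) \<le> 8 * boundary_max F t"
    using FP PM unfolding a_def by (rule order_trans)
  define h where "h z = (if z = a then deriv F a else (F z - F a) / (z - a))" for z
  have hh: "h holomorphic_on UNIV" unfolding h_def by (rule pole_lemma[OF F]) simp
  define c where "c = 2 / (1 - r)\<^sup>2"
  have c: "0 < c" using r by (simp add: c_def)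
  have "ennreal ((cmod (deriv F a))\<^sup>2) \<le> poisson_int r (\<lambda>y. ennreal ((cmod (h (circ y)))\<^sup>2)) t"
    using sq[OF hh] by (simp add: h_def)
  also have "\<dots> \<le> poisson_int r (\<lambda>y. ennreal c * (ennreal ((cmod (F (circ y)))\<^sup>2) + ennreal ((cmod (F a))\<^sup>2))) t"
  proof (rule poisson_int_mono)
    fix y
    have ne: "circ y \<noteq> a" using na r norm_circ[of y] by auto
    have d: "1 - r \<le> cmod (circ y - a)" using norm_triangle_ineq2[of "circ y" a] na by simp
    have "cmod (h (circ y)) = cmod (F (circ y) - F a) / cmod (circ y - a)"
      using ne by (simp add: h_def norm_divide)
    also have "\<dots> \<le> (cmod (F (circ y)) + cmod (F a)) / (1 - r)"
      using d r by (intro frac_le norm_triangle_ineq4) auto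
    finally have "(cmod (h (circ y)))\<^sup>2 \<le> ((cmod (F (circ y)) + cmod (F a)) / (1 - r))\<^sup>2"
      by (intro power_mono) auto
    also have "\<dots> \<le> c * ((cmod (F (circ y)))\<^sup>2 + (cmod (F a))\<^sup>2)"
    proof -
      have "(u + v)\<^sup>2 \<le> 2 * (u\<^sup>2 + v\<^sup>2)" for u v :: real
        using sum_squares_ge_zero[of "u - v" 0] by (simp add: power2_eq_square algebra_simps)
      then show ?thesis unfolding c_def power_divide times_divide_eq_left
        using r by (intro divide_right_mono) auto
    qed
    finally show "ennreal ((cmod (h (circ y)))\<^sup>2) \<le> ennreal c * (ennreal ((cmod (F (circ y)))\<^sup>2) + ennreal ((cmod (F a))\<^sup>2))"
      using c by (simp add: ennreal_mult[symmetric] ennreal_plus[symmetric] ennreal_leI del: ennreal_plus)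
  qed
  also have "\<dots> = ennreal c * (P + ennreal ((cmod (F a))\<^sup>2))"
  proof -
    have "poisson_int r (\<lambda>y. ennreal c * (ennreal ((cmod (F (circ y)))\<^sup>2) + ennreal ((cmod (F a))\<^sup>2))) t =
      (\<integral>\<^sup>+ y. ennreal c * (ennreal (poisson r (t - y)) * ennreal ((cmod (F (circ y)))\<^sup>2) + ennreal (poisson r (t - y)) * ennreal ((cmod (F a))\<^sup>2)) \<partial>unit_lborel)"
      unfolding poisson_int_def by (simp add: distrib_left mult_ac)
    also have "\<dots> = ennreal c * (P + (\<integral>\<^sup>+ y. ennreal (poisson r (t - y)) * ennreal ((cmod (F a))\<^sup>2) \<partial>unit_lborel))"
      unfolding P_def poisson_int_def by (simp add: nn_integral_cmult nn_integral_add)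
    also have "(\<integral>\<^sup>+ y. ennreal (poisson r (t - y)) * ennreal ((cmod (F a))\<^sup>2) \<partial>unit_lborel) = ennreal ((cmod (F a))\<^sup>2)"
      by (subst nn_integral_multc) (auto simp: poisson_integral_1 r)
    finally show ?thesis .
  qed
  also have "\<dots> \<le> ennreal c * (P + P)" by (intro mult_left_mono add_mono FP order_refl) auto
  finally have "ennreal ((1 - r)\<^sup>2) * ennreal ((cmod (deriv F a))\<^sup>2) \<le> ennreal ((1 - r)\<^sup>2) * (ennreal c * (P + P))"
    by (rule mult_left_mono) simp
  also have "\<dots> = ennreal ((1 - r)\<^sup>2 * c) * (P + P)"
    using c by (simp add: ennreal_mult mult.assoc)
  also have "(1 - r)\<^sup>2 * c = 2" using r by (simp add: c_def)
  also have "ennreal 2 * (P + P) = 4 * P" unfolding mult_2[symmetric] by (simp add: mult.assoc[symmetric])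
  also have "\<dots> \<le> 4 * (8 * boundary_max F t)" by (intro mult_left_mono PM) auto
  also have "\<dots> = 32 * boundary_max F t" by (simp add: mult.assoc[symmetric])
  finally show "ennreal (((1 - r) * cmod (deriv F (of_real r * circ t)))\<^sup>2) \<le> 32 * boundary_max F t"
    unfolding a_def power_mult_distrib by (simp add: ennreal_mult)
qed

lemma enn_powr_nat: "0 < n \<Longrightarrow> enn_powr x (real n) = x ^ n"
proof (cases x)
  case (real y)
  assume "0 < n"
  then show ?thesis using real
    by (cases "y = 0") (auto simp: enn_powr_ennreal powr_realpow ennreal_power)
qed (auto simp: power_top_ennreal)

text \<open>For \<open>f = F^\<alpha>\<close> one has
  \<open>|f'| = \<alpha> |F|^(\<alpha> - 1) |F'|\<close>, and \<open>Y\<close> dominates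
  \<open>|F|^2\<close>, \<open>((1 - r) |F'|)^2\<close> and the square function on the radius. Of
  the \<open>a\<close> powers of \<open>|F'|\<close>, two are integrated by the square function and
  \<open>a - 2\<close> are bounded pointwise, which is where \<open>2 \<le> a\<close>
  matters.\<close>

lemma exp_pow_derivative_bounds:
  fixes \<alpha> :: real
  assumes L: "L holomorphic_on UNIV" and \<alpha>: "1 \<le> \<alpha>"
  defines "F \<equiv> (\<lambda>z. exp (L z / of_real \<alpha>))"
  defines "Y \<equiv> (\<lambda>t. 32 * boundary_max F t + lp_square (deriv F) t)"
  shows "2 \<le> a \<Longrightarrow> F_inner (\<lambda>z. exp (L z)) 0 1 a t \<le> ennreal (\<alpha> powr a) * enn_powr (Y t) (\<alpha> * a / 2)"
    and "F_inner_inf (\<lambda>z. exp (L z)) 0 1 t \<le> ennreal \<alpha> * enn_powr (Y t) (\<alpha> / 2)"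
proof -
  have F: "F holomorphic_on UNIV" unfolding F_def using \<alpha> by (intro holomorphic_intros L) auto
  note [measurable] = entire_measurable[OF F] entire_measurable[OF entire_deriv[OF F]]
  have dL: "(L has_field_derivative deriv L z) (at z)" for z
    using L by (intro holomorphic_derivI) auto
  have d1: "deriv (\<lambda>z. exp (L z)) z = exp (L z) * deriv L z" for z
    by (rule DERIV_imp_deriv) (auto intro!: derivative_eq_intros dL)
  have d2: "deriv F z = F z * (deriv L z / of_real \<alpha>)" for z
    unfolding F_def by (rule DERIV_imp_deriv) (use \<alpha> in \<open>auto intro!: derivative_eq_intros dL\<close>)
  have Fpos: "0 < cmod (F z)" for z by (simp add: F_def)
  have nf: "cmod (exp (L z)) = cmod (F z) powr \<alpha>" for z
  proof -
    have "Re (L z / of_real \<alpha>) * \<alpha> = Re (L z)" using \<alpha> by simp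
    then show ?thesis unfolding F_def norm_exp_eq_Re by (simp add: powr_def mult.commute)
  qed
  have key: "cmod (deriv (\<lambda>z. exp (L z)) z) = \<alpha> * cmod (F z) powr (\<alpha> - 1) * cmod (deriv F z)" for z
    unfolding d1 d2 norm_mult norm_divide nf using \<alpha> Fpos[of z]
    by (simp add: powr_diff)
  \<comment> \<open>The condition on \<open>a\<close> is carried as a disjunct so that both
    estimates share one real value \<open>y\<close> of \<open>Y t\<close>.\<close>
  have "F_inner (\<lambda>z. exp (L z)) 0 1 a t \<le> ennreal (\<alpha> powr a) * enn_powr (Y t) (\<alpha> * a / 2) \<or> a < 2"
    and "F_inner_inf (\<lambda>z. exp (L z)) 0 1 t \<le> ennreal \<alpha> * enn_powr (Y t) (\<alpha> / 2)"
  proof -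
    consider "Y t = top" | y where "Y t = ennreal y" "0 \<le> y" by (cases "Y t") auto
    then have "(F_inner (\<lambda>z. exp (L z)) 0 1 a t \<le> ennreal (\<alpha> powr a) * enn_powr (Y t) (\<alpha> * a / 2) \<or> a < 2) \<and>
      F_inner_inf (\<lambda>z. exp (L z)) 0 1 t \<le> ennreal \<alpha> * enn_powr (Y t) (\<alpha> / 2)"
    proof cases
      case 1
      then show ?thesis using \<alpha> by (simp add: ennreal_mult_top)
    next
      case 2
      have b1: "(cmod (F (of_real r * circ t)))\<^sup>2 \<le> y" if "0 \<le> r" "r < 1" for r
      proof -
        have "ennreal ((cmod (F (of_real r * circ t)))\<^sup>2) \<le> 8 * boundary_max F t"
          using that by (intro norm_square_le_boundary_max F)
        also have "\<dots> \<le> 32 * boundary_max F t" by (intro mult_right_mono) auto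
        also have "\<dots> \<le> Y t" by (simp add: Y_def)
        finally show ?thesis using 2 by (simp add: ennreal_le_iff)
      qed
      have b2: "((1 - r) * cmod (deriv F (of_real r * circ t)))\<^sup>2 \<le> y" if "0 \<le> r" "r < 1" for r
      proof -
        have "ennreal (((1 - r) * cmod (deriv F (of_real r * circ t)))\<^sup>2) \<le> 32 * boundary_max F t"
          using that by (intro norm_square_le_boundary_max F)
        also have "\<dots> \<le> Y t" by (simp add: Y_def)
        finally show ?thesis using 2 by (simp add: ennreal_le_iff)
      qed
      have b3: "lp_square (deriv F) t \<le> ennreal y" using 2 by (metis Y_def add_increasing order_refl zero_le)
      have y: "0 < y" using less_le_trans[OF zero_less_power[OF Fpos] b1[of 0]] by simp
      have p1: "cmod (F (of_real r * circ t)) powr e \<le> y powr (e / 2)" if "0 \<le> r" "r < 1" "0 \<le> e" for r e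
      proof -
        have "cmod (F (of_real r * circ t)) powr e = ((cmod (F (of_real r * circ t)))\<^sup>2) powr (e / 2)"
          using Fpos[of "of_real r * circ t"] by (simp add: powr_powr flip: powr_numeral)
        also have "\<dots> \<le> y powr (e / 2)" using that by (intro powr_mono2 b1) auto
        finally show ?thesis .
      qed
      have p2: "((1 - r) * cmod (deriv F (of_real r * circ t))) powr e \<le> y powr (e / 2)" if "0 \<le> r" "r < 1" "0 \<le> e" for r e
      proof -
        have "((1 - r) * cmod (deriv F (of_real r * circ t))) powr e = (((1 - r) * cmod (deriv F (of_real r * circ t)))\<^sup>2) powr (e / 2)"
        proof -
          have "x powr e = x\<^sup>2 powr (e / 2)" if "0 \<le> x" for x :: real
            using that powr_powr[of x 2 "e / 2"] by (simp add: powr_numeral)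
          then show ?thesis using that by simp
        qed
        also have "\<dots> \<le> y powr (e / 2)" using that by (intro powr_mono2 b2) auto
        finally show ?thesis .
      qed
      have "F_inner (\<lambda>z. exp (L z)) 0 1 a t \<le> ennreal (\<alpha> powr a) * enn_powr (Y t) (\<alpha> * a / 2)" if a: "2 \<le> a"
      proof -
        \<comment> \<open>The exponent collects \<open>(\<alpha> - 1) a / 2\<close> from
          \<open>F\<close> and \<open>(a - 2) / 2\<close> from the pointwise bound on
          \<open>F'\<close>; the last factor \<open>y\<close> comes from the square
          function.\<close>
        define e where "e = \<alpha> * a / 2 - 1"
        have "F_inner (\<lambda>z. exp (L z)) 0 1 a t \<le> (\<integral>\<^sup>+ r. ennreal (\<alpha> powr a * y powr e) *
            (ennreal ((cmod (deriv F (of_real r * circ t)))\<^sup>2 * (1 - r)) * indicator {0..1} r) \<partial>lborel)"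
          unfolding F_inner_order1
        proof (rule nn_integral_mono)
          fix r :: real
          let ?z = "of_real r * circ t"
          show "ennreal (cmod (deriv (\<lambda>z. exp (L z)) ?z) powr a * (1 - r) powr (a - 1)) * indicator {0..<1} r \<le>
            ennreal (\<alpha> powr a * y powr e) * (ennreal ((cmod (deriv F ?z))\<^sup>2 * (1 - r)) * indicator {0..1} r)"
          proof (cases "0 \<le> r \<and> r < 1")
            case True
            then have r: "0 \<le> r" "r < 1" by auto
            define d where "d = cmod (deriv F ?z)"
            have d0: "0 \<le> d" by (simp add: d_def)
            have "d powr a * (1 - r) powr (a - 1) = ((1 - r) * d) powr (a - 2) * (d\<^sup>2 * (1 - r))"
            proof (cases "d = 0")
              case False
              then have "0 < d" using d0 by simp
              moreover have "(1 - r) powr (a - 1) = (1 - r) powr (a - 2) * (1 - r)"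
                using r powr_add[of "1 - r" "a - 2" 1] by simp
              moreover have "d powr a = d powr (a - 2) * d\<^sup>2"
                using \<open>0 < d\<close> powr_add[of d "a - 2" 2] by (simp add: powr_numeral)
              ultimately show ?thesis using r by (simp add: powr_mult mult_ac)
            qed (use a in simp)
            also have "\<dots> \<le> y powr ((a - 2) / 2) * (d\<^sup>2 * (1 - r))"
              using r a unfolding d_def by (intro mult_right_mono p2) auto
            finally have 3: "d powr a * (1 - r) powr (a - 1) \<le> y powr ((a - 2) / 2) * (d\<^sup>2 * (1 - r))" .
            have 4: "(cmod (F ?z) powr (\<alpha> - 1)) powr a \<le> y powr ((\<alpha> - 1) * a / 2)"
              using p1[OF r, of "(\<alpha> - 1) * a"] \<alpha> a by (simp add: powr_powr)
            have "cmod (deriv (\<lambda>z. exp (L z)) ?z) powr a * (1 - r) powr (a - 1) =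
              \<alpha> powr a * (cmod (F ?z) powr (\<alpha> - 1)) powr a * (d powr a * (1 - r) powr (a - 1))"
              unfolding key d_def using \<alpha> by (simp add: powr_mult)
            also have "\<dots> \<le> \<alpha> powr a * y powr ((\<alpha> - 1) * a / 2) * (y powr ((a - 2) / 2) * (d\<^sup>2 * (1 - r)))"
              by (rule mult_mono[OF mult_left_mono[OF 4] 3]) (use r in auto)
            also have "\<dots> = \<alpha> powr a * (y powr ((\<alpha> - 1) * a / 2) * y powr ((a - 2) / 2)) * (d\<^sup>2 * (1 - r))"
              by (simp only: mult_ac)
            also have "y powr ((\<alpha> - 1) * a / 2) * y powr ((a - 2) / 2) = y powr e"
            proof -
              have "(\<alpha> - 1) * a / 2 + (a - 2) / 2 = e" unfolding e_def by (simp add: field_simps)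
              then show ?thesis unfolding powr_add[symmetric] by simp
            qed
            finally have "ennreal (cmod (deriv (\<lambda>z. exp (L z)) ?z) powr a * (1 - r) powr (a - 1)) \<le>
               ennreal (\<alpha> powr a * y powr e * (d\<^sup>2 * (1 - r)))"
              by (rule ennreal_leI)
            also have "\<dots> = ennreal (\<alpha> powr a * y powr e) * ennreal (d\<^sup>2 * (1 - r))"
              by (rule ennreal_mult') simp
            finally show ?thesis using r by (simp add: d_def)
          qed (auto simp: indicator_def)
        qed
        also have "\<dots> = ennreal (\<alpha> powr a * y powr e) * lp_square (deriv F) t"
          unfolding lp_square_def by (subst nn_integral_unit_lborel) (auto simp: nn_integral_cmult)
        also have "\<dots> \<le> ennreal (\<alpha> powr a * y powr e) * ennreal y"
          by (intro mult_left_mono b3) auto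
        also have "\<dots> = ennreal (\<alpha> powr a) * (ennreal (y powr e * y))"
          using y by (simp add: ennreal_mult mult.assoc)
        also have "y powr e * y = y powr (\<alpha> * a / 2)"
          using powr_add[of y e 1] y by (simp add: e_def)
        finally show ?thesis using 2 by (simp add: enn_powr_ennreal)
      qed
      moreover have "F_inner_inf (\<lambda>z. exp (L z)) 0 1 t \<le> ennreal \<alpha> * enn_powr (Y t) (\<alpha> / 2)"
        unfolding F_inner_inf_order1
      proof (rule SUP_least)
        fix r :: real assume r': "r \<in> {0..<1}"
        then have r: "0 \<le> r" "r < 1" by auto
        let ?z = "of_real r * circ t"
        have "cmod (deriv (\<lambda>z. exp (L z)) ?z) * (1 - r) = \<alpha> * (cmod (F ?z) powr (\<alpha> - 1) * ((1 - r) * cmod (deriv F ?z)))"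
          unfolding key by simp
        also have "\<dots> \<le> \<alpha> * (y powr ((\<alpha> - 1) / 2) * y powr (1 / 2))"
          using p1[OF r, of "\<alpha> - 1"] p2[OF r, of 1] \<alpha> r by (intro mult_left_mono mult_mono) auto
        also have "y powr ((\<alpha> - 1) / 2) * y powr (1 / 2) = y powr (\<alpha> / 2)"
          unfolding powr_add[symmetric] by (simp add: field_simps)
        finally have "ennreal (cmod (deriv (\<lambda>z. exp (L z)) ?z) * (1 - r)) \<le> ennreal (\<alpha> * y powr (\<alpha> / 2))"
          by (rule ennreal_leI)
        also have "\<dots> = ennreal \<alpha> * enn_powr (Y t) (\<alpha> / 2)"
          using 2 \<alpha> by (simp add: enn_powr_ennreal ennreal_mult)
        finally show "ennreal (cmod (deriv (\<lambda>z. exp (L z)) ?z) * (1 - r)) \<le> \<dots>" .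
      qed
      ultimately show ?thesis by fastforce
    qed
    then show "F_inner (\<lambda>z. exp (L z)) 0 1 a t \<le> ennreal (\<alpha> powr a) * enn_powr (Y t) (\<alpha> * a / 2) \<or> a < 2"
      and "F_inner_inf (\<lambda>z. exp (L z)) 0 1 t \<le> ennreal \<alpha> * enn_powr (Y t) (\<alpha> / 2)" by auto
  qed
  then show "2 \<le> a \<Longrightarrow> F_inner (\<lambda>z. exp (L z)) 0 1 a t \<le> ennreal (\<alpha> powr a) * enn_powr (Y t) (\<alpha> * a / 2)"
    and "F_inner_inf (\<lambda>z. exp (L z)) 0 1 t \<le> ennreal \<alpha> * enn_powr (Y t) (\<alpha> / 2)" by auto
qed

text \<open>Both parts of the quasinorm are kept separate and as \<open>p\<close>-th powers, a form
  stable under lower limits and, up to constants, under sums.\<close>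

definition HF0_bound :: "real \<Rightarrow> ennreal \<Rightarrow> real \<Rightarrow> (complex \<Rightarrow> complex) \<Rightarrow> bool" where
  "HF0_bound p q C f \<longleftrightarrow> F_pow f 0 p q 1 \<le> ennreal C * circ_pow_int p f \<and>
     ennreal (cmod (f 0) powr p) \<le> ennreal C * circ_pow_int p f"

text \<open>The \<open>p\<close>-th power of the modulus is the modulus of the holomorphic function
  \<open>exp (p L)\<close>, so subharmonicity holds for every \<open>p\<close>; at radius 0 the
  kernel is 1.\<close>

lemma norm_exp_at_0_powr_le:
  assumes L: "L holomorphic_on UNIV"
  shows "ennreal (cmod (exp (L 0)) powr p) \<le> circ_pow_int p (\<lambda>z. exp (L z))"
proof -
  define h where "h z = exp (of_real p * L z)" for z
  have hh: "h holomorphic_on UNIV" unfolding h_def by (intro holomorphic_intros L)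
  note [measurable] = entire_measurable[OF hh]
  have e: "cmod (h z) = cmod (exp (L z)) powr p" for z
    by (simp add: h_def norm_exp_eq_Re powr_def)
  have "ennreal (cmod (h (of_real 0 * circ 0))) \<le> poisson_int 0 (\<lambda>y. ennreal (cmod (h (circ y)))) 0"
    by (rule norm_le_poisson_int)
       (use hh in \<open>auto intro: holomorphic_on_imp_continuous_on holomorphic_on_subset\<close>)
  then show ?thesis by (simp add: e circ_pow_int_def poisson_int_def poisson_def)
qed

theorem HF0_bound_exp:
  assumes p: "0 < p" and q: "2 \<le> q"
  obtains C where "0 < C" "\<And>L. L holomorphic_on UNIV \<Longrightarrow> HF0_bound p q C (\<lambda>z. exp (L z))"
proof -
  \<comment> \<open>A dyadic \<open>n\<close> with \<open>p \<le> 2 n\<close> makes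
    \<open>\<alpha> = 2 n / p\<close> at least 1, and \<open>|F|^(2 n) = |f|^p\<close> on the
    circle: the estimate for a large exponent of \<open>F\<close> is the wanted one for
    \<open>f = exp L\<close>.\<close>
  obtain j where j: "p < 2 ^ j" using real_arch_pow[of 2 p] by auto
  define n :: nat where "n = 2 ^ Suc j"
  define \<alpha> where "\<alpha> = 2 * real n / p"
  have "(2::real) ^ j \<le> 4 * 2 ^ j" by simp
  with j have "p \<le> 4 * 2 ^ j" by linarith
  then have "p \<le> 2 * real n" by (simp add: n_def)
  then have \<alpha>: "1 \<le> \<alpha>" using p by (simp add: \<alpha>_def)
  have n0: "0 < n" by (simp add: n_def)
  have \<alpha>p: "\<alpha> * p / 2 = real n" using p by (simp add: \<alpha>_def)
  obtain C1 where C1: "0 < C1" "\<And>F. F holomorphic_on UNIV \<Longrightarrow> (\<integral>\<^sup>+ t. lp_square (deriv F) t ^ n \<partial>unit_lborel) \<le>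
      ennreal C1 * (\<integral>\<^sup>+ t. ennreal ((cmod (F (circ t)))\<^sup>2) ^ n \<partial>unit_lborel)"
    using lp_square_power_bound[of j] unfolding n_def by blast
  define C where "C = 1 + \<alpha> powr p * (2 ^ n * (32 ^ n * 257 + C1))"
  have C: "0 < C" "1 \<le> C" using C1 by (auto simp: C_def add_pos_nonneg)
  have "HF0_bound p q C (\<lambda>z. exp (L z))" if L: "L holomorphic_on UNIV" for L
  proof -
    define F where "F = (\<lambda>z. exp (L z / of_real \<alpha>))"
    define Y where "Y t = 32 * boundary_max F t + lp_square (deriv F) t" for t
    have F: "F holomorphic_on UNIV" unfolding F_def using \<alpha> by (intro holomorphic_intros L) auto
    note [measurable] = entire_measurable[OF F] entire_measurable[OF entire_deriv[OF F]]
    have [measurable]: "Y \<in> borel_measurable borel" unfolding Y_def by measurable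
    note B = exp_pow_derivative_bounds[OF L \<alpha>, folded F_def, folded Y_def]
    define I where "I = circ_pow_int p (\<lambda>z. exp (L z))"
    have I: "(\<integral>\<^sup>+ t. ennreal ((cmod (F (circ t)))\<^sup>2) ^ n \<partial>unit_lborel) = I"
      unfolding I_def circ_pow_int_def
    proof (rule nn_integral_cong)
      fix t
      have "((cmod (F (circ t)))\<^sup>2) ^ n = exp (Re (L (circ t) / of_real \<alpha>)) ^ (2 * n)"
        by (simp add: F_def norm_exp_eq_Re power_mult)
      also have "\<dots> = exp (real (2 * n) * Re (L (circ t) / of_real \<alpha>))"
        by (rule exp_of_nat_mult[symmetric])
      also have "real (2 * n) * Re (L (circ t) / of_real \<alpha>) = p * Re (L (circ t))"
        using p n0 by (simp add: \<alpha>_def)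
      also have "exp (p * Re (L (circ t))) = cmod (exp (L (circ t))) powr p"
        by (simp add: norm_exp_eq_Re powr_def)
      finally show "ennreal ((cmod (F (circ t)))\<^sup>2) ^ n = ennreal (cmod (exp (L (circ t))) powr p)"
        by (simp add: ennreal_power)
    qed
    have "F_pow (\<lambda>z. exp (L z)) 0 p q 1 \<le> (\<integral>\<^sup>+ t. (ennreal (\<alpha> powr p) * Y t ^ n) * indicator {0..1} t \<partial>lborel)"
    proof (cases "q = top")
      case True
      have "enn_powr (F_inner_inf (\<lambda>z. exp (L z)) 0 1 t) p \<le> ennreal (\<alpha> powr p) * Y t ^ n" for t
      proof -
        have "enn_powr (F_inner_inf (\<lambda>z. exp (L z)) 0 1 t) p \<le> enn_powr (ennreal \<alpha> * enn_powr (Y t) (\<alpha> / 2)) p"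
          using p by (intro enn_powr_mono B) auto
        also have "\<dots> = ennreal (\<alpha> powr p) * enn_powr (Y t) (\<alpha> * p / 2)"
          using \<alpha> by (subst enn_powr_cmult) (auto simp: enn_powr_powr)
        finally show ?thesis unfolding \<alpha>p enn_powr_nat[OF n0] .
      qed
      then show ?thesis unfolding F_pow_def using True by (simp add: nn_integral_mono mult_right_mono)
    next
      case False
      define a where "a = enn2real q"
      have qa: "q = ennreal a" "0 \<le> a" using False unfolding a_def by (auto simp: top.not_eq_extremum)
      have "ennreal 2 \<le> ennreal a" using q qa by simp
      then have a: "2 \<le> a" using qa by (simp only: ennreal_le_iff)
      have "enn_powr (F_inner (\<lambda>z. exp (L z)) 0 1 a t) (p / a) \<le> ennreal (\<alpha> powr p) * Y t ^ n" for t
      proof -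
        have "enn_powr (F_inner (\<lambda>z. exp (L z)) 0 1 a t) (p / a) \<le>
            enn_powr (ennreal (\<alpha> powr a) * enn_powr (Y t) (\<alpha> * a / 2)) (p / a)"
          using p a by (intro enn_powr_mono B) auto
        also have "\<dots> = ennreal (\<alpha> powr p) * enn_powr (Y t) (\<alpha> * p / 2)"
          using \<alpha> a by (subst enn_powr_cmult) (auto simp: enn_powr_powr powr_powr)
        finally show ?thesis unfolding \<alpha>p enn_powr_nat[OF n0] .
      qed
      then show ?thesis unfolding F_pow_def using False by (simp add: nn_integral_mono mult_right_mono a_def)
    qed
    also have "\<dots> = ennreal (\<alpha> powr p) * (\<integral>\<^sup>+ t. Y t ^ n \<partial>unit_lborel)"
      by (subst nn_integral_unit_lborel[symmetric]) (auto simp: nn_integral_cmult)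
    also have "(\<integral>\<^sup>+ t. Y t ^ n \<partial>unit_lborel) \<le>
       (\<integral>\<^sup>+ t. 2 ^ n * ((32 * boundary_max F t) ^ n + lp_square (deriv F) t ^ n) \<partial>unit_lborel)"
    proof (rule nn_integral_mono)
      fix t
      have "Y t \<le> 2 * max (32 * boundary_max F t) (lp_square (deriv F) t)"
        unfolding Y_def by (auto simp: mult_2 max_def intro: add_mono)
      then have "Y t ^ n \<le> (2 * max (32 * boundary_max F t) (lp_square (deriv F) t)) ^ n"
        by (rule power_mono_ennreal)
      also have "\<dots> \<le> 2 ^ n * ((32 * boundary_max F t) ^ n + lp_square (deriv F) t ^ n)"
        unfolding power_mult_distrib[of 2] by (intro mult_left_mono) (auto simp: max_def)
      finally show "Y t ^ n \<le> 2 ^ n * ((32 * boundary_max F t) ^ n + lp_square (deriv F) t ^ n)" .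
    qed
    also have "\<dots> = 2 ^ n * (32 ^ n * (\<integral>\<^sup>+ t. boundary_max F t ^ n \<partial>unit_lborel) + (\<integral>\<^sup>+ t. lp_square (deriv F) t ^ n \<partial>unit_lborel))"
      by (simp add: nn_integral_cmult nn_integral_add power_mult_distrib)
    also have "\<dots> \<le> 2 ^ n * (32 ^ n * (257 * I) + ennreal C1 * I)"
      using boundary_max_power[OF F, of j] C1(2)[OF F] unfolding I[symmetric] n_def[symmetric]
      by (intro mult_left_mono add_mono) auto
    also have "\<dots> = ennreal (2 ^ n * (32 ^ n * 257 + C1)) * I"
    proof -
      have e: "ennreal (2 ^ n) = 2 ^ n" "ennreal (32 ^ n) = 32 ^ n" "ennreal 257 = 257"
        by (simp_all flip: ennreal_power)
      have "ennreal (2 ^ n * (32 ^ n * 257 + C1)) = ennreal (2 ^ n) * (ennreal (32 ^ n) * ennreal 257 + ennreal C1)"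
        using C1(1) by (simp only: ennreal_mult ennreal_plus zero_le_power zero_le_numeral mult_nonneg_nonneg add_nonneg_nonneg less_imp_le)
      then show ?thesis unfolding e by (simp add: distrib_right distrib_left mult.assoc)
    qed
    finally have "F_pow (\<lambda>z. exp (L z)) 0 p q 1 \<le> ennreal (\<alpha> powr p) * (ennreal (2 ^ n * (32 ^ n * 257 + C1)) * I)"
      by (simp add: mult_left_mono)
    also have "\<dots> = ennreal (\<alpha> powr p * (2 ^ n * (32 ^ n * 257 + C1))) * I"
      using C1(1) by (subst ennreal_mult) (auto simp: mult.assoc)
    also have "\<dots> \<le> ennreal C * I" unfolding C_def by (intro mult_right_mono ennreal_leI) auto
    finally have 1: "F_pow (\<lambda>z. exp (L z)) 0 p q 1 \<le> ennreal C * I" .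
    have "ennreal (cmod (exp (L 0)) powr p) \<le> 1 * I"
      unfolding I_def using norm_exp_at_0_powr_le[OF L] by simp
    also have "\<dots> \<le> ennreal C * I" using C by (intro mult_right_mono) auto
    finally show ?thesis using 1 unfolding HF0_bound_def I_def by simp
  qed
  with C(1) show ?thesis by (rule that)
qed

section \<open>Boundary norm estimates in the disc algebra\<close>

lemma HF0_bound_limit:
  assumes f: "\<And>i. f i holomorphic_on UNIV" and g: "continuous_on (cball 0 1) g"
    and lim: "uniform_limit (cball 0 1) f g sequentially"
    and p: "0 < p" and q: "0 < q" and bd: "\<And>i. HF0_bound p q C (f i)"
  shows "HF0_bound p q C g"
proof -
  have "continuous_on (cball 0 1) (f i)" for i
    by (intro holomorphic_on_imp_continuous_on holomorphic_on_subset[OF f]) auto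
  then have "(\<lambda>i. circ_pow_int p (f i)) \<longlonglongrightarrow> circ_pow_int p g"
    by (intro circ_pow_int_tendsto g lim p)
  then have I: "(\<lambda>i. ennreal C * circ_pow_int p (f i)) \<longlonglongrightarrow> ennreal C * circ_pow_int p g"
    by (intro ennreal_tendsto_cmult ennreal_less_top)
  have "F_pow g 0 p q 1 \<le> liminf (\<lambda>i. F_pow (f i) 0 p q 1)"
    by (rule F_pow_liminf[OF f _ p q]) (auto intro: uniform_limit_on_subset[OF lim])
  also have "\<dots> \<le> liminf (\<lambda>i. ennreal C * circ_pow_int p (f i))"
    using bd by (intro Liminf_mono always_eventually) (auto simp: HF0_bound_def)
  also have "\<dots> = ennreal C * circ_pow_int p g"
    using I by (intro lim_imp_Liminf) auto
  finally have 1: "F_pow g 0 p q 1 \<le> ennreal C * circ_pow_int p g" .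
  have "(\<lambda>i. f i 0) \<longlonglongrightarrow> g 0" by (rule tendsto_uniform_limitI[OF lim]) simp
  then have "(\<lambda>i. ennreal (cmod (f i 0) powr p)) \<longlonglongrightarrow> ennreal (cmod (g 0) powr p)"
    using p by (intro tendsto_ennrealI tendsto_powr' tendsto_norm) auto
  then have "ennreal (cmod (g 0) powr p) \<le> ennreal C * circ_pow_int p g"
    by (rule LIMSEQ_le[OF _ I]) (use bd in \<open>auto simp: HF0_bound_def\<close>)
  with 1 show ?thesis by (simp add: HF0_bound_def)
qed

text \<open>A logarithm exists in the open disc but may be unbounded near the circle, where zeros
  are allowed. It is therefore dilated before a polynomial approximates it; boundedness of
  \<open>f\<close> turns closeness of logarithms into closeness of functions.\<close>

lemma exp_poly_dense_zero_free:
  assumes cont: "continuous_on (cball 0 1) f" and hol: "f holomorphic_on ball 0 1"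
    and nz: "\<And>z. z \<in> ball 0 1 \<Longrightarrow> f z \<noteq> 0" and e: "0 < e"
  obtains P :: "complex poly" where "\<And>z. cmod z \<le> 1 \<Longrightarrow> cmod (exp (poly P z) - f z) < e"
proof -
  obtain K where K: "0 < K" "\<And>z. cmod z \<le> 1 \<Longrightarrow> cmod (f z) \<le> K"
    using bounded_on_cball[OF cont] by blast
  have "contractible (ball 0 1 :: complex set)" by (intro convex_imp_contractible) auto
  then obtain g where g: "g holomorphic_on ball 0 1" and fg: "\<And>z. z \<in> ball 0 1 \<Longrightarrow> f z = exp (g z)"
    using contractible_imp_holomorphic_log[OF hol _ nz] by blast
  have "uniformly_continuous_on (cball 0 1) f"
    by (rule compact_uniformly_continuous[OF cont]) simp
  then obtain d where d: "d > 0" and "\<forall>z\<in>cball 0 1. \<forall>w\<in>cball 0 1. dist w z < d \<longrightarrow> dist (f w) (f z) < e / 2"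
    unfolding uniformly_continuous_on_def using e half_gt_zero by blast
  then have fd: "\<And>z w. cmod z \<le> 1 \<Longrightarrow> cmod w \<le> 1 \<Longrightarrow> cmod (w - z) < d \<Longrightarrow> cmod (f w - f z) < e / 2"
    by (auto simp: dist_norm)
  define r where "r = max (1 / 2) (1 - d / 2)"
  have r: "0 < r" "r < 1" "1 - r < d" using d by (auto simp: r_def)
  have rz: "cmod (of_real r * z) < 1" if "cmod z \<le> 1" for z
  proof -
    have "cmod (of_real r * z) = r * cmod z" using r by (simp add: norm_mult)
    also have "\<dots> \<le> r" using that r by (simp add: mult_left_le)
    finally show ?thesis using r by simp
  qed
  define G where "G z = g (of_real r * z)" for z
  have "(\<lambda>z. of_real r * z) ` ball 0 1 \<subseteq> (ball 0 1 :: complex set)"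
    using rz by (auto simp: less_imp_le)
  from holomorphic_on_compose_gen[OF _ g this] have GH: "G holomorphic_on ball 0 1"
    unfolding G_def by (simp add: o_def holomorphic_intros)
  have GC: "continuous_on (cball 0 1) G" unfolding G_def
    using rz by (intro continuous_on_compose2[OF holomorphic_on_imp_continuous_on[OF g]] continuous_intros) auto
  have "isCont exp (0::complex)" by simp
  moreover have "0 < e / (2 * K)" using e K(1) by simp
  ultimately obtain \<delta> where \<delta>0: "0 < \<delta>" and "\<forall>w::complex. dist w 0 < \<delta> \<longrightarrow> dist (exp w) (exp 0) < e / (2 * K)"
    unfolding continuous_at_eps_delta by blast
  then have \<delta>: "\<And>w::complex. cmod w < \<delta> \<Longrightarrow> cmod (exp w - 1) < e / (2 * K)"
    by (auto simp: dist_norm)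
  obtain P :: "complex poly" where P: "\<And>z. cmod z \<le> 1 \<Longrightarrow> cmod (poly P z - G z) < \<delta>"
    using poly_dense_disc_algebra[OF GC GH \<delta>0] by blast
  have "cmod (exp (poly P z) - f z) < e" if z: "cmod z \<le> 1" for z
  proof -
    have eG: "exp (G z) = f (of_real r * z)" using rz[OF z] fg unfolding G_def by simp
    have "exp (poly P z) - f (of_real r * z) = f (of_real r * z) * (exp (poly P z - G z) - 1)"
      unfolding eG[symmetric] by (simp add: exp_diff field_simps)
    then have "cmod (exp (poly P z) - f (of_real r * z)) = cmod (f (of_real r * z)) * cmod (exp (poly P z - G z) - 1)"
      by (simp only: norm_mult)
    also have "\<dots> \<le> K * cmod (exp (poly P z - G z) - 1)"
      using rz[OF z] by (intro mult_right_mono K) auto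
    also have "\<dots> < K * (e / (2 * K))" using K(1) P[OF z] by (intro mult_strict_left_mono \<delta>) auto
    also have "\<dots> = e / 2" using K(1) by simp
    finally have 1: "cmod (exp (poly P z) - f (of_real r * z)) < e / 2" .
    have "of_real r * z - z = of_real (r - 1) * z" by (simp add: algebra_simps)
    then have "cmod (of_real r * z - z) = \<bar>r - 1\<bar> * cmod z" by (simp only: norm_mult norm_of_real)
    also have "\<dots> \<le> \<bar>r - 1\<bar> * 1" using z by (intro mult_left_mono) auto
    finally have "cmod (of_real r * z - z) < d" using r by simp
    then have "cmod (f (of_real r * z) - f z) < e / 2"
      using z rz[OF z] by (intro fd) auto
    then show ?thesis
      using 1 norm_triangle_ineq[of "exp (poly P z) - f (of_real r * z)" "f (of_real r * z) - f z"] by simp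
  qed
  then show ?thesis by (rule that)
qed

lemma HF0_bound_zero_free:
  assumes p: "0 < p" and q: "2 \<le> q"
  obtains C where "0 < C"
    "\<And>f. continuous_on (cball 0 1) f \<Longrightarrow> f holomorphic_on ball 0 1 \<Longrightarrow> (\<And>z. z \<in> ball 0 1 \<Longrightarrow> f z \<noteq> 0) \<Longrightarrow> HF0_bound p q C f"
proof -
  obtain C where C: "0 < C" "\<And>L. L holomorphic_on UNIV \<Longrightarrow> HF0_bound p q C (\<lambda>z. exp (L z))"
    using HF0_bound_exp[OF p q] by blast
  have q0: "0 < q" using q by (auto intro: less_le_trans[of 0 2])
  have "HF0_bound p q C f"
    if f: "continuous_on (cball 0 1) f" "f holomorphic_on ball 0 1" "\<And>z. z \<in> ball 0 1 \<Longrightarrow> f z \<noteq> 0" for f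
  proof -
    have "\<exists>P :: complex poly. \<forall>z. cmod z \<le> 1 \<longrightarrow> cmod (exp (poly P z) - f z) < inverse (real (Suc n))" for n
      using exp_poly_dense_zero_free[OF f, of "inverse (real (Suc n))"]
      by (metis inverse_positive_iff_positive of_nat_0_less_iff zero_less_Suc)
    then obtain P :: "nat \<Rightarrow> complex poly" where P: "\<And>n z. cmod z \<le> 1 \<Longrightarrow> cmod (exp (poly (P n) z) - f z) < inverse (real (Suc n))"
      by metis
    have "uniform_limit (cball 0 1) (\<lambda>n z. exp (poly (P n) z)) f sequentially"
      unfolding uniform_limit_iff
    proof (intro allI impI)
      fix e :: real assume "0 < e"
      then have "\<forall>\<^sub>F n in sequentially. inverse (real (Suc n)) < e"
        using LIMSEQ_inverse_real_of_nat order_tendstoD(2) by blast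
      then show "\<forall>\<^sub>F n in sequentially. \<forall>z\<in>cball 0 1. dist (exp (poly (P n) z)) (f z) < e"
        by eventually_elim (auto simp: dist_norm intro!: less_trans[OF P])
    qed
    then show ?thesis
      by (intro HF0_bound_limit[OF _ f(1) _ p q0 C(2)]) (auto intro!: holomorphic_intros)
  qed
  with C(1) show ?thesis by (rule that)
qed

text \<open>The first two claims rest on the identity
  \<open>|1 - cnj a z|^2 - |z - a|^2 = (1 - |a|^2) (1 - |z|^2)\<close>.\<close>

lemma norm_diff_le_reflected:
  assumes "cmod a < 1" "cmod z \<le> 1"
  shows "cmod (z - a) \<le> cmod (1 - cnj a * z)"
    and "cmod z = 1 \<Longrightarrow> cmod (z - a) = cmod (1 - cnj a * z)"
    and "cmod z < 1 \<Longrightarrow> 1 - cnj a * z \<noteq> 0"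
proof -
  have e: "(cmod (1 - cnj a * z))\<^sup>2 - (cmod (z - a))\<^sup>2 = (1 - (cmod a)\<^sup>2) * (1 - (cmod z)\<^sup>2)"
    by (simp only: cmod_power2) (simp add: power2_eq_square algebra_simps)
  have "0 \<le> (1 - (cmod a)\<^sup>2) * (1 - (cmod z)\<^sup>2)"
    using assms by (intro mult_nonneg_nonneg) (auto simp: power_le_one)
  then have "(cmod (z - a))\<^sup>2 \<le> (cmod (1 - cnj a * z))\<^sup>2" using e by linarith
  then show "cmod (z - a) \<le> cmod (1 - cnj a * z)" by (rule power2_le_imp_le) simp
  show "cmod (z - a) = cmod (1 - cnj a * z)" if "cmod z = 1"
  proof (rule power2_eq_imp_eq)
    show "(cmod (z - a))\<^sup>2 = (cmod (1 - cnj a * z))\<^sup>2" using e that by simp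
  qed auto
  show "1 - cnj a * z \<noteq> 0" if "cmod z < 1"
  proof
    assume "1 - cnj a * z = 0"
    then have "cmod (cnj a * z) = 1" by (metis eq_iff_diff_eq_0 norm_one)
    moreover have "cmod a * cmod z \<le> cmod a * 1" using that by (intro mult_left_mono) auto
    ultimately show False using assms by (simp add: norm_mult)
  qed
qed

text \<open>Reflecting the zeros inside the disc, which amounts to dividing by a Blaschke product.\<close>

lemma poly_zero_free_majorant:
  fixes P :: "complex poly"
  assumes "P \<noteq> 0"
  shows "\<exists>Q :: complex poly. (\<forall>z. cmod z < 1 \<longrightarrow> poly Q z \<noteq> 0) \<and> (\<forall>z. cmod z \<le> 1 \<longrightarrow> cmod (poly P z) \<le> cmod (poly Q z)) \<and>
     (\<forall>z. cmod z = 1 \<longrightarrow> cmod (poly P z) = cmod (poly Q z))"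
  using assms
proof (induction "degree P" arbitrary: P rule: less_induct)
  case less
  show ?case
  proof (cases "\<exists>c. P = [:c:]")
    case True
    then obtain c where "P = [:c:]" by blast
    then show ?thesis using less.prems by (intro exI[of _ P]) auto
  next
    case False
    then obtain a where "poly P a = 0" using fundamental_theorem_of_algebra_alt[of P] by auto
    then obtain R where R: "P = [:-a, 1:] * R" by (auto simp: poly_eq_0_iff_dvd)
    have R0: "R \<noteq> 0" using less.prems R by auto
    have "degree P = degree [:-a, 1:] + degree R" unfolding R by (rule degree_mult_eq) (use R0 in auto)
    then have "degree R < degree P" by simp
    from less.hyps[OF this R0] obtain Q where Q: "\<And>z. cmod z < 1 \<Longrightarrow> poly Q z \<noteq> 0"
      "\<And>z. cmod z \<le> 1 \<Longrightarrow> cmod (poly R z) \<le> cmod (poly Q z)" "\<And>z. cmod z = 1 \<Longrightarrow> cmod (poly R z) = cmod (poly Q z)"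
      by blast
    \<comment> \<open>A zero on or outside the circle does no harm in the open disc, so its factor
      is kept; a zero inside is exchanged for the reflected factor, of equal modulus on the
      circle.\<close>
    define B where "B = (if cmod a < 1 then [:1, - cnj a:] else [:-a, 1:])"
    have B: "poly B z = (if cmod a < 1 then 1 - cnj a * z else z - a)" for z
      by (simp add: B_def mult.commute)
    have B1: "poly B z \<noteq> 0" if "cmod z < 1" for z
      using norm_diff_le_reflected(3)[of a z] that unfolding B by auto
    have B2: "cmod (z - a) \<le> cmod (poly B z)" if "cmod z \<le> 1" for z
      using norm_diff_le_reflected(1)[of a z] that unfolding B by auto
    have B3: "cmod (z - a) = cmod (poly B z)" if "cmod z = 1" for z
      using norm_diff_le_reflected(2)[of a z] that unfolding B by auto
    have P: "poly P z = (z - a) * poly R z" for z unfolding R by (simp add: algebra_simps)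
    show ?thesis
    proof (intro exI[of _ "B * Q"] conjI allI impI)
      fix z show "cmod z < 1 \<Longrightarrow> poly (B * Q) z \<noteq> 0" using B1 Q(1) by auto
      show "cmod z \<le> 1 \<Longrightarrow> cmod (poly P z) \<le> cmod (poly (B * Q) z)"
        unfolding P poly_mult norm_mult by (intro mult_mono B2 Q) auto
      show "cmod z = 1 \<Longrightarrow> cmod (poly P z) = cmod (poly (B * Q) z)"
        unfolding P poly_mult norm_mult using B3 Q(3) by simp
    qed
  qed
qed

text \<open>Exponents below one allow no triangle inequality, so powers of sums are bounded through
  twice the larger term; the price is the constant, and all \<open>p\<close> and \<open>q\<close>
  are treated alike.\<close>

lemma F_pow_diff_le:
  assumes p: "0 < p" and q: "0 < q"
  obtains K where "0 < K" "\<And>f g. f holomorphic_on UNIV \<Longrightarrow> g holomorphic_on UNIV \<Longrightarrow>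
    F_pow (\<lambda>z. f z - g z) 0 p q 1 \<le> ennreal K * (F_pow f 0 p q 1 + F_pow g 0 p q 1)"
proof (cases "q = top")
  case True
  have "F_pow (\<lambda>z. f z - g z) 0 p q 1 \<le> ennreal (2 powr p) * (F_pow f 0 p q 1 + F_pow g 0 p q 1)"
    if f: "f holomorphic_on UNIV" and g: "g holomorphic_on UNIV" for f g
  proof -
    note [measurable] = measurable_F_inner_inf[OF f, unfolded One_nat_def] measurable_F_inner_inf[OF g, unfolded One_nat_def]
    have dd: "deriv (\<lambda>z. f z - g z) z = deriv f z - deriv g z" for z
      using f g by (intro deriv_diff) (auto simp: holomorphic_on_open field_differentiable_def holomorphic_on_imp_differentiable_at)
    have le: "F_inner_inf (\<lambda>z. f z - g z) 0 1 t \<le> F_inner_inf f 0 1 t + F_inner_inf g 0 1 t" for t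
      unfolding F_inner_inf_order1
    proof (rule SUP_least)
      fix r :: real assume r: "r \<in> {0..<1}"
      let ?z = "of_real r * circ t"
      have "cmod (deriv (\<lambda>z. f z - g z) ?z) * (1 - r) \<le> cmod (deriv f ?z) * (1 - r) + cmod (deriv g ?z) * (1 - r)"
        unfolding dd distrib_right[symmetric] using r by (intro mult_right_mono norm_triangle_ineq4) auto
      then have "ennreal (cmod (deriv (\<lambda>z. f z - g z) ?z) * (1 - r)) \<le>
         ennreal (cmod (deriv f ?z) * (1 - r)) + ennreal (cmod (deriv g ?z) * (1 - r))"
        using r by (simp add: ennreal_plus[symmetric] ennreal_leI del: ennreal_plus)
      also have "\<dots> \<le> (SUP r\<in>{0..<1}. ennreal (cmod (deriv f (of_real r * circ t)) * (1 - r))) +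
          (SUP r\<in>{0..<1}. ennreal (cmod (deriv g (of_real r * circ t)) * (1 - r)))"
        by (intro add_mono SUP_upper r)
      finally show "ennreal (cmod (deriv (\<lambda>z. f z - g z) ?z) * (1 - r)) \<le> \<dots>" .
    qed
    have "F_pow (\<lambda>z. f z - g z) 0 p q 1 \<le> (\<integral>\<^sup>+ t. ennreal (2 powr p) *
       (enn_powr (F_inner_inf f 0 1 t) p * indicator {0..1} t + enn_powr (F_inner_inf g 0 1 t) p * indicator {0..1} t) \<partial>lborel)"
      unfolding F_pow_def if_P[OF True]
    proof (rule nn_integral_mono)
      fix t
      have "enn_powr (F_inner_inf (\<lambda>z. f z - g z) 0 1 t) p \<le> enn_powr (F_inner_inf f 0 1 t + F_inner_inf g 0 1 t) p"
        using p by (intro enn_powr_mono le) auto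
      also have "\<dots> \<le> ennreal (2 powr p) * (enn_powr (F_inner_inf f 0 1 t) p + enn_powr (F_inner_inf g 0 1 t) p)"
        using p by (intro enn_powr_add_le) auto
      finally show "enn_powr (F_inner_inf (\<lambda>z. f z - g z) 0 1 t) p * indicator {0..1} t \<le> ennreal (2 powr p) *
       (enn_powr (F_inner_inf f 0 1 t) p * indicator {0..1} t + enn_powr (F_inner_inf g 0 1 t) p * indicator {0..1} t)"
        by (auto simp: indicator_def)
    qed
    also have "\<dots> = ennreal (2 powr p) * (F_pow f 0 p q 1 + F_pow g 0 p q 1)"
      unfolding F_pow_def if_P[OF True] by (simp add: nn_integral_cmult nn_integral_add)
    finally show ?thesis .
  qed
  then show ?thesis by (intro that[of "2 powr p"]) auto
next
  case False
  define a where "a = enn2real q"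
  have a: "0 < a" using q False unfolding a_def by (simp add: enn2real_positive_iff top.not_eq_extremum)
  define K where "K = (2 powr a) powr (p / a) * 2 powr (p / a)"
  have "F_pow (\<lambda>z. f z - g z) 0 p q 1 \<le> ennreal K * (F_pow f 0 p q 1 + F_pow g 0 p q 1)"
    if f: "f holomorphic_on UNIV" and g: "g holomorphic_on UNIV" for f g
  proof -
    note [measurable] = measurable_F_inner[OF f, unfolded One_nat_def] measurable_F_inner[OF g, unfolded One_nat_def] entire_measurable[OF entire_deriv[OF f]] entire_measurable[OF entire_deriv[OF g]]
    have dd: "deriv (\<lambda>z. f z - g z) z = deriv f z - deriv g z" for z
      using f g by (intro deriv_diff) (auto simp: holomorphic_on_open field_differentiable_def holomorphic_on_imp_differentiable_at)
    have le: "F_inner (\<lambda>z. f z - g z) 0 1 a t \<le> ennreal (2 powr a) * (F_inner f 0 1 a t + F_inner g 0 1 a t)" for t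
    proof -
      define J where "J h r = ennreal (cmod (deriv h (of_real r * circ t)) powr a * (1 - r) powr (a - 1)) * indicator {0..<1} r" for h r
      have "F_inner (\<lambda>z. f z - g z) 0 1 a t \<le> (\<integral>\<^sup>+ r. ennreal (2 powr a) * (J f r + J g r) \<partial>lborel)"
        unfolding F_inner_order1
      proof (rule nn_integral_mono)
        fix r :: real
        let ?z = "of_real r * circ t"
        let ?u = "cmod (deriv f ?z)" and ?v = "cmod (deriv g ?z)"
        have "cmod (deriv (\<lambda>z. f z - g z) ?z) powr a \<le> (2 * max ?u ?v) powr a"
          unfolding dd using a norm_triangle_ineq4[of "deriv f ?z" "deriv g ?z"] by (intro powr_mono2) auto
        also have "\<dots> = 2 powr a * (max ?u ?v) powr a" by (simp add: powr_mult)
        also have "\<dots> \<le> 2 powr a * (?u powr a + ?v powr a)"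
          by (intro mult_left_mono) (auto simp: max_def)
        finally have "cmod (deriv (\<lambda>z. f z - g z) ?z) powr a * (1 - r) powr (a - 1) \<le>
           2 powr a * (?u powr a + ?v powr a) * (1 - r) powr (a - 1)" by (rule mult_right_mono) simp
        also have "\<dots> = 2 powr a * (?u powr a * (1 - r) powr (a - 1) + ?v powr a * (1 - r) powr (a - 1))"
          by (simp add: algebra_simps)
        finally have "ennreal (cmod (deriv (\<lambda>z. f z - g z) ?z) powr a * (1 - r) powr (a - 1)) \<le>
           ennreal (2 powr a * (?u powr a * (1 - r) powr (a - 1) + ?v powr a * (1 - r) powr (a - 1)))"
          by (rule ennreal_leI)
        also have "\<dots> = ennreal (2 powr a) * (ennreal (?u powr a * (1 - r) powr (a - 1)) + ennreal (?v powr a * (1 - r) powr (a - 1)))"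
          by (simp add: ennreal_mult)
        finally show "ennreal (cmod (deriv (\<lambda>z. f z - g z) ?z) powr a * (1 - r) powr (a - 1)) * indicator {0..<1} r \<le>
           ennreal (2 powr a) * (J f r + J g r)"
          unfolding J_def by (auto simp: indicator_def)
      qed
      also have "\<dots> = ennreal (2 powr a) * (F_inner f 0 1 a t + F_inner g 0 1 a t)"
        unfolding F_inner_order1 J_def by (subst nn_integral_cmult, measurable, subst nn_integral_add) auto
      finally show ?thesis .
    qed
    have "F_pow (\<lambda>z. f z - g z) 0 p q 1 \<le> (\<integral>\<^sup>+ t. ennreal K *
       (enn_powr (F_inner f 0 1 a t) (p / a) * indicator {0..1} t + enn_powr (F_inner g 0 1 a t) (p / a) * indicator {0..1} t) \<partial>lborel)"
      unfolding F_pow_def if_not_P[OF False] a_def[symmetric]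
    proof (rule nn_integral_mono)
      fix t
      have "enn_powr (F_inner (\<lambda>z. f z - g z) 0 1 a t) (p / a) \<le>
          enn_powr (ennreal (2 powr a) * (F_inner f 0 1 a t + F_inner g 0 1 a t)) (p / a)"
        using p a by (intro enn_powr_mono le) auto
      also have "\<dots> = ennreal ((2 powr a) powr (p / a)) * enn_powr (F_inner f 0 1 a t + F_inner g 0 1 a t) (p / a)"
        by (rule enn_powr_cmult) simp
      also have "\<dots> \<le> ennreal ((2 powr a) powr (p / a)) * (ennreal (2 powr (p / a)) *
          (enn_powr (F_inner f 0 1 a t) (p / a) + enn_powr (F_inner g 0 1 a t) (p / a)))"
        using p a by (intro mult_left_mono enn_powr_add_le) auto
      also have "\<dots> = ennreal K * (enn_powr (F_inner f 0 1 a t) (p / a) + enn_powr (F_inner g 0 1 a t) (p / a))"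
        unfolding K_def by (subst ennreal_mult) (auto simp: mult.assoc)
      finally show "enn_powr (F_inner (\<lambda>z. f z - g z) 0 1 a t) (p / a) * indicator {0..1} t \<le> ennreal K *
       (enn_powr (F_inner f 0 1 a t) (p / a) * indicator {0..1} t + enn_powr (F_inner g 0 1 a t) (p / a) * indicator {0..1} t)"
        by (auto simp: indicator_def)
    qed
    also have "\<dots> = ennreal K * (F_pow f 0 p q 1 + F_pow g 0 p q 1)"
      unfolding F_pow_def if_not_P[OF False] a_def[symmetric]
      by (simp add: nn_integral_cmult nn_integral_add)
    finally show ?thesis .
  qed
  moreover have "0 < K" unfolding K_def by simp
  ultimately show ?thesis using that by blast
qed

lemma circ_pow_int_mono:
  assumes "0 < p" "0 < c" "\<And>z. cmod z = 1 \<Longrightarrow> cmod (f z) \<le> c * cmod (g z)" and g: "continuous_on (cball 0 1) g"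
  shows "circ_pow_int p f \<le> ennreal (c powr p) * circ_pow_int p g"
proof -
  note [measurable] = measurable_circ_comp[OF g]
  have "circ_pow_int p f \<le> (\<integral>\<^sup>+ t. ennreal (c powr p) * ennreal (cmod (g (circ t)) powr p) \<partial>unit_lborel)"
    unfolding circ_pow_int_def
  proof (rule nn_integral_mono)
    fix t
    have "cmod (f (circ t)) powr p \<le> (c * cmod (g (circ t))) powr p"
      using assms by (intro powr_mono2) auto
    also have "\<dots> = c powr p * cmod (g (circ t)) powr p" using assms(2) by (simp add: powr_mult)
    finally show "ennreal (cmod (f (circ t)) powr p) \<le> ennreal (c powr p) * ennreal (cmod (g (circ t)) powr p)"
      by (simp add: ennreal_mult[symmetric] ennreal_leI)
  qed
  also have "\<dots> = ennreal (c powr p) * circ_pow_int p g"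
    unfolding circ_pow_int_def by (rule nn_integral_cmult) measurable
  finally show ?thesis .
qed

theorem HF0_bound_disc_algebra:
  assumes p: "0 < p" and q: "2 \<le> q"
  obtains C where "0 < C"
    "\<And>f. continuous_on (cball 0 1) f \<Longrightarrow> f holomorphic_on ball 0 1 \<Longrightarrow> HF0_bound p q C f"
proof -
  have q0: "0 < q" using q by (auto intro: less_le_trans[of 0 2])
  obtain C1 where C1: "0 < C1" "\<And>f. continuous_on (cball 0 1) f \<Longrightarrow> f holomorphic_on ball 0 1 \<Longrightarrow>
     (\<And>z. z \<in> ball 0 1 \<Longrightarrow> f z \<noteq> 0) \<Longrightarrow> HF0_bound p q C1 f"
    using HF0_bound_zero_free[OF p q] by blast
  obtain K where K: "0 < K" "\<And>f g. f holomorphic_on UNIV \<Longrightarrow> g holomorphic_on UNIV \<Longrightarrow>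
    F_pow (\<lambda>z. f z - g z) 0 p q 1 \<le> ennreal K * (F_pow f 0 p q 1 + F_pow g 0 p q 1)"
    using F_pow_diff_le[OF p q0] by blast
  define A where "A = C1 * 3 powr p"
  have A: "0 < A" using C1 by (simp add: A_def)
  define C where "C = K * (A + A) + A"
  have C: "0 < C" "A \<le> C" "K * (A + A) \<le> C" using A K by (auto simp: C_def intro: add_nonneg_pos)
  have poly: "HF0_bound p q C (poly P)" for P :: "complex poly"
  proof (cases "P = 0")
    case True
    have "F_pow (\<lambda>z. 0 - 0) 0 p q 1 = 0"
      by (simp add: F_pow_def F_inner_order1[unfolded One_nat_def] F_inner_inf_order1[unfolded One_nat_def])
    moreover have "poly P = (\<lambda>z. 0)" using True by auto
    ultimately show ?thesis by (simp add: HF0_bound_def)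
  next
    case False
    then obtain Q :: "complex poly" where Q: "\<And>z. cmod z < 1 \<Longrightarrow> poly Q z \<noteq> 0"
      "\<And>z. cmod z \<le> 1 \<Longrightarrow> cmod (poly P z) \<le> cmod (poly Q z)" "\<And>z. cmod z = 1 \<Longrightarrow> cmod (poly P z) = cmod (poly Q z)"
      using poly_zero_free_majorant by blast
    \<comment> \<open>\<open>|P| \<le> |Q|\<close> in the disc, where \<open>Q\<close> has no zeros,
      so the factor 2 keeps \<open>P + 2 Q\<close> away from 0. On the circle
      \<open>|P| = |Q|\<close> bounds both \<open>f\<close> and \<open>g\<close> by
      \<open>3 |P|\<close>.\<close>
    define f where "f z = poly P z + 2 * poly Q z" for z
    define g where "g z = 2 * poly Q z" for z
    have fg: "f holomorphic_on UNIV" "g holomorphic_on UNIV" unfolding f_def g_def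
      by (intro holomorphic_intros)+
    have fnz: "f z \<noteq> 0" if "cmod z < 1" for z
    proof
      assume "f z = 0"
      then have "poly P z = - (2 * poly Q z)" by (simp add: f_def add_eq_0_iff2)
      then have "cmod (poly P z) = 2 * cmod (poly Q z)" by (simp add: norm_mult)
      then show False using Q(1)[OF that] Q(2)[of z] that by simp
    qed
    have bf: "HF0_bound p q C1 f" and bg: "HF0_bound p q C1 g"
      using fg fnz Q(1) by (auto intro!: C1(2) holomorphic_on_imp_continuous_on intro: holomorphic_on_subset simp: g_def)
    have "cmod (f z) \<le> 3 * cmod (poly P z)" if "cmod z = 1" for z
      using norm_triangle_ineq[of "poly P z" "2 * poly Q z"] Q(3)[OF that] by (simp add: f_def norm_mult)
    then have If: "circ_pow_int p f \<le> ennreal (3 powr p) * circ_pow_int p (poly P)"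
      by (intro circ_pow_int_mono p) (auto intro!: continuous_intros)
    have "cmod (g z) \<le> 3 * cmod (poly P z)" if "cmod z = 1" for z
      using Q(3)[OF that] by (simp add: g_def norm_mult)
    then have Ig: "circ_pow_int p g \<le> ennreal (3 powr p) * circ_pow_int p (poly P)"
      by (intro circ_pow_int_mono p) (auto intro!: continuous_intros)
    have le: "ennreal C1 * circ_pow_int p h \<le> ennreal A * circ_pow_int p (poly P)"
      if "circ_pow_int p h \<le> ennreal (3 powr p) * circ_pow_int p (poly P)" for h
    proof -
      have "ennreal C1 * circ_pow_int p h \<le> ennreal C1 * (ennreal (3 powr p) * circ_pow_int p (poly P))"
        using that by (rule mult_left_mono) simp
      then show ?thesis using C1(1) by (simp add: A_def ennreal_mult mult.assoc)
    qed
    have "F_pow (poly P) 0 p q 1 = F_pow (\<lambda>z. f z - g z) 0 p q 1"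
      by (simp add: f_def g_def)
    also have "\<dots> \<le> ennreal K * (F_pow f 0 p q 1 + F_pow g 0 p q 1)" by (rule K(2)[OF fg])
    also have "\<dots> \<le> ennreal K * (ennreal A * circ_pow_int p (poly P) + ennreal A * circ_pow_int p (poly P))"
      using bf bg le[OF If] le[OF Ig] unfolding HF0_bound_def
      by (intro mult_left_mono add_mono) (auto intro: order_trans)
    also have "\<dots> = ennreal (K * (A + A)) * circ_pow_int p (poly P)"
    proof -
      have e1: "ennreal (K * (A + A)) = ennreal K * ennreal (A + A)" using K(1) A by (intro ennreal_mult) auto
      have e2: "ennreal (A + A) = ennreal A + ennreal A" using A by (intro ennreal_plus) auto
      show ?thesis unfolding e1 e2 by (simp only: distrib_right mult.assoc)
    qed
    also have "\<dots> \<le> ennreal C * circ_pow_int p (poly P)" by (intro mult_right_mono ennreal_leI C) auto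
    finally have 1: "F_pow (poly P) 0 p q 1 \<le> ennreal C * circ_pow_int p (poly P)" .
    \<comment> \<open>For the value at 0 no difference is formed: the zero-free majorant bounds it
      directly.\<close>
    have "cmod (poly P 0) \<le> cmod (g 0)"
      using order_trans[OF Q(2)[of 0], of "2 * cmod (poly Q 0)"] by (simp add: g_def norm_mult)
    then have "ennreal (cmod (poly P 0) powr p) \<le> ennreal (cmod (g 0) powr p)"
      using p by (intro ennreal_leI powr_mono2) auto
    also have "\<dots> \<le> ennreal A * circ_pow_int p (poly P)"
      using bg le[OF Ig] unfolding HF0_bound_def by (auto intro: order_trans)
    also have "\<dots> \<le> ennreal C * circ_pow_int p (poly P)" by (intro mult_right_mono ennreal_leI C) auto
    finally show ?thesis using 1 by (simp add: HF0_bound_def)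
  qed
  have "HF0_bound p q C f" if cont: "continuous_on (cball 0 1) f" and hol: "f holomorphic_on ball 0 1" for f
  proof -
    obtain P :: "nat \<Rightarrow> complex poly" where lim: "uniform_limit (cball 0 1) (\<lambda>n. poly (P n)) f sequentially"
      using poly_seq_disc_algebra[OF cont hol] .
    show ?thesis
      by (rule HF0_bound_limit[OF _ cont lim p q0 poly]) (intro holomorphic_intros)
  qed
  with C(1) show ?thesis by (rule that)
qed

section \<open>Sufficiency of the arc condition\<close>

lemma HF_norm_order0: "HF_norm f 0 p q = enn_powr (F_pow f 0 p q 1) (1 / p) + ennreal (cmod (f 0))"
  by (simp add: HF_norm_def ord_m_def)

section \<open>Arcs and the parametrised circle\<close>

lemma circ_period: "circ (t + of_int k) = circ t"
proof -
  have "circ (t + of_int k) = circ t * cis (2 * pi * of_int k)"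
    by (simp only: circ_def cis_mult distrib_left)
  also have "cis (2 * pi * of_int k) = 1" by (rule cis_multiple_2pi) auto
  finally show ?thesis by simp
qed

lemma inj_on_circ: "inj_on circ {0..<1}"
proof (rule inj_onI)
  fix x y assume xy: "x \<in> {0..<1}" "y \<in> {0..<1}" "circ x = circ y"
  then have "cos (2 * pi * x) = cos (2 * pi * y)" "sin (2 * pi * x) = sin (2 * pi * y)"
    by (auto simp: circ_def complex_eq_iff)
  then obtain n :: int where "2 * pi * x = 2 * pi * y + 2 * pi * of_int n"
    using sin_cos_eq_iff[of "2 * pi * x" "2 * pi * y"] by (auto simp: mult_ac)
  then have "2 * pi * x = 2 * pi * (y + of_int n)" by (simp add: distrib_left)
  then have "x = y + of_int n" by simp
  then show "x = y" using xy by auto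
qed

lemma closed_arc: "closed (arc a l)"
proof -
  have "compact (circ ` {a..a + l})" by (intro compact_continuous_image continuous_intros) auto
  then show ?thesis by (simp add: arc_def circ_def[abs_def] compact_imp_closed)
qed

lemma arc_eq_circ: "arc a l = circ ` {a..a + l}"
  by (simp add: arc_def circ_def[abs_def])

text \<open>Riemann sums: on slightly shrunken arcs of a partition, which are disjoint, the measure is
  at least a multiple of the length.\<close>

lemma circ_pow_int_le_measure_integral:
  assumes \<mu>: "sets \<mu> = sets borel" and c: "0 < c"
    and arc: "\<And>a l. 0 \<le> l \<Longrightarrow> l \<le> 1 \<Longrightarrow> ennreal (c * l) \<le> emeasure \<mu> (arc a l)"
    and f: "continuous_on (cball 0 1) f" and p: "0 < p"
  shows "ennreal c * circ_pow_int p f \<le> (\<integral>\<^sup>+ z. ennreal (cmod (f z) powr p) \<partial>\<mu>)"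
proof -
  define \<phi> where "\<phi> t = cmod (f (circ t)) powr p" for t
  note [measurable] = measurable_circ_comp[OF f]
  have [measurable]: "\<phi> \<in> borel_measurable borel" unfolding \<phi>_def by measurable
  have \<phi>c: "continuous_on {0..1} \<phi>" unfolding \<phi>_def
    using p by (intro continuous_on_powr' continuous_intros continuous_on_compose2[OF f]) auto
  have \<phi>0: "0 \<le> \<phi> t" for t by (simp add: \<phi>_def)
  define \<Phi> where "\<Phi> = integral {0..1} \<phi>"
  have I\<Phi>: "circ_pow_int p f = ennreal \<Phi>"
    unfolding circ_pow_int_def \<Phi>_def \<phi>_def[symmetric] by (rule nn_integral_unit_lborel_integral) (use \<phi>c \<phi>0 in auto)
  have \<Phi>0: "0 \<le> \<Phi>" unfolding \<Phi>_def using \<phi>0 by (intro integral_nonneg integrable_continuous_interval \<phi>c) auto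
  show ?thesis
  proof (cases "(\<integral>\<^sup>+ z. ennreal (cmod (f z) powr p) \<partial>\<mu>)")
    case (real J)
    \<comment> \<open>\<open>e\<close> bounds the oscillation of \<open>\<phi>\<close> at scale
      \<open>1 / N\<close>. It is lost once in the upper sum for arc length and once in the lower
      sum for \<open>\<mu>\<close>; shrinking the arcs costs the factor
      \<open>1 - 1 / N\<close>.\<close>
    have main: "c * (1 - 1 / real N) * (\<Phi> - 2 * e) \<le> J"
      if e: "0 < e" and N: "2 \<le> N" and unif: "\<And>x y. x \<in> {0..1} \<Longrightarrow> y \<in> {0..1} \<Longrightarrow> \<bar>x - y\<bar> \<le> 1 / real N \<Longrightarrow> \<bar>\<phi> x - \<phi> y\<bar> < e"
      for e N
    proof -
      define x where "x j = real j / real N" for j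
      define S where "S = (\<Sum>j<N. \<phi> (x j))"
      have x01: "0 \<le> x j" "x j < 1" "x j + 1 / real N \<le> 1" if "j < N" for j
        using that N by (auto simp: x_def field_simps)
      have "\<Phi> \<le> (S + real N * e) / real N"
      proof -
        have "circ_pow_int p f \<le> (\<integral>\<^sup>+ t. (\<Sum>j<N. ennreal (\<phi> (x j) + e) * indicator {x j..<x j + 1 / real N} t) \<partial>unit_lborel)"
          unfolding circ_pow_int_def \<phi>_def[symmetric]
        proof (rule nn_integral_unit_lborel_mono_less_1)
          fix t :: real assume t: "0 \<le> t" "t < 1"
          define j where "j = nat \<lfloor>t * real N\<rfloor>"
          have "0 \<le> t * real N" using t by simp
          then have j: "real j \<le> t * real N" "t * real N < real j + 1" unfolding j_def by linarith+
          have "t * real N < 1 * real N" using t N by (intro mult_strict_right_mono) auto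
          then have jN: "j < N" using j by linarith
          have tj: "x j \<le> t" "t < x j + 1 / real N" using j N by (auto simp: x_def field_simps)
          have "\<bar>\<phi> t - \<phi> (x j)\<bar> < e" using t x01[OF jN] tj by (intro unif) auto
          then have "ennreal (\<phi> t) \<le> ennreal (\<phi> (x j) + e) * indicator {x j..<x j + 1 / real N} t"
            using tj by (simp add: ennreal_leI)
          also have "\<dots> \<le> (\<Sum>j<N. ennreal (\<phi> (x j) + e) * indicator {x j..<x j + 1 / real N} t)"
            using jN by (intro member_le_sum) auto
          finally show "ennreal (\<phi> t) \<le> \<dots>" .
        qed
        also have "\<dots> = (\<Sum>j<N. ennreal (\<phi> (x j) + e) * (\<integral>\<^sup>+ t. indicator {x j..<x j + 1 / real N} t \<partial>unit_lborel))"
        proof (subst nn_integral_sum)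
          show "(\<Sum>j<N. \<integral>\<^sup>+ t. ennreal (\<phi> (x j) + e) * indicator {x j..<x j + 1 / real N} t \<partial>unit_lborel) =
            (\<Sum>j<N. ennreal (\<phi> (x j) + e) * (\<integral>\<^sup>+ t. indicator {x j..<x j + 1 / real N} t \<partial>unit_lborel))"
            by (intro sum.cong refl nn_integral_cmult) measurable
        qed measurable
        also have "\<dots> \<le> (\<Sum>j<N. ennreal ((\<phi> (x j) + e) / real N))"
        proof (intro sum_mono)
          fix j assume "j \<in> {..<N}"
          have "(\<integral>\<^sup>+ t. indicator {x j..<x j + 1 / real N} t \<partial>unit_lborel) \<le> (\<integral>\<^sup>+ t. indicator {x j..<x j + 1 / real N} t \<partial>lborel)"
          proof (subst nn_integral_unit_lborel)
            show "(\<integral>\<^sup>+ t. indicator {x j..<x j + 1 / real N} t * indicator {0..1} t \<partial>lborel) \<le>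
               (\<integral>\<^sup>+ t. indicator {x j..<x j + 1 / real N} t \<partial>lborel)"
              by (rule nn_integral_mono) (auto split: split_indicator)
          qed measurable
          also have "\<dots> = ennreal (1 / real N)" by simp
          finally have "ennreal (\<phi> (x j) + e) * (\<integral>\<^sup>+ t. indicator {x j..<x j + 1 / real N} t \<partial>unit_lborel) \<le>
              ennreal (\<phi> (x j) + e) * ennreal (1 / real N)" by (rule mult_left_mono) simp
          also have "\<dots> = ennreal ((\<phi> (x j) + e) / real N)" using \<phi>0[of "x j"] e by (subst ennreal_mult[symmetric]) auto
          finally show "ennreal (\<phi> (x j) + e) * (\<integral>\<^sup>+ t. indicator {x j..<x j + 1 / real N} t \<partial>unit_lborel) \<le> \<dots>" .
        qed
        also have "\<dots> = ennreal (\<Sum>j<N. (\<phi> (x j) + e) / real N)" using \<phi>0 e by (intro sum_ennreal) (simp add: add_nonneg_nonneg)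
        also have "(\<Sum>j<N. (\<phi> (x j) + e) / real N) = (S + real N * e) / real N"
          by (simp add: S_def sum_divide_distrib[symmetric] sum.distrib)
        finally show ?thesis unfolding I\<Phi> using \<phi>0 e by (subst (asm) ennreal_le_iff) (auto simp: S_def sum_nonneg)
      qed
      then have 1: "\<Phi> - e \<le> S / real N" using N by (simp add: field_simps)
      \<comment> \<open>Closed arcs of full length would share end points; with
        \<open>d < 1 / N\<close> they are disjoint, and \<open>2 \<le> N\<close> keeps
        \<open>d\<close> positive.\<close>
      define d where "d = 1 / real N * (1 - 1 / real N)"
      have d': "0 < d" "d < 1 / real N" using N by (auto simp: d_def field_simps)
      moreover have "1 / real N \<le> 1" using N by simp
      ultimately have d: "0 < d" "d < 1 / real N" "d \<le> 1" by linarith+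
      define B where "B j = arc (x j) d" for j
      have [measurable]: "B j \<in> sets \<mu>" for j unfolding B_def \<mu> by (intro borel_closed closed_arc)
      have disj: "B i \<inter> B j = {}" if ij: "i < N" "j < N" "i < j" for i j
      proof -
        have "(real i + 1) / real N \<le> real j / real N" using ij by (intro divide_right_mono) auto
        then have "x i + 1 / real N \<le> x j" by (simp add: x_def add_divide_distrib)
        then have "{x i..x i + d} \<inter> {x j..x j + d} = {}" using d by auto
        moreover have "{x i..x i + d} \<subseteq> {0..<1}" "{x j..x j + d} \<subseteq> {0..<1}"
          using x01[OF ij(1)] x01[OF ij(2)] d by auto
        ultimately show ?thesis unfolding B_def arc_eq_circ
          using inj_on_image_Int[OF inj_on_circ, of "{x i..x i + d}" "{x j..x j + d}"] by simp
      qed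
      have "ennreal (c * d * (S - real N * e)) \<le> (\<Sum>j<N. ennreal (\<phi> (x j) - e) * ennreal (c * d))"
      proof -
        have "S - real N * e = (\<Sum>j<N. \<phi> (x j) - e)" by (simp add: S_def sum_subtractf)
        \<comment> \<open>\<open>ennreal\<close> cuts negative numbers to 0, so terms with
          \<open>\<phi> (x j) < e\<close> are first raised to 0.\<close>
        also have "\<dots> \<le> (\<Sum>j<N. max 0 (\<phi> (x j) - e))" by (intro sum_mono) auto
        finally have "c * d * (S - real N * e) \<le> c * d * (\<Sum>j<N. max 0 (\<phi> (x j) - e))"
          using c d by (intro mult_left_mono) auto
        then have "ennreal (c * d * (S - real N * e)) \<le> ennreal (\<Sum>j<N. max 0 (\<phi> (x j) - e) * (c * d))"
          by (intro ennreal_leI) (simp add: sum_distrib_left mult_ac)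
        also have "\<dots> = (\<Sum>j<N. ennreal (max 0 (\<phi> (x j) - e) * (c * d)))"
          using c d by (intro sum_ennreal[symmetric]) auto
        also have "\<dots> = (\<Sum>j<N. ennreal (max 0 (\<phi> (x j) - e)) * ennreal (c * d))"
          using c d by (intro sum.cong refl ennreal_mult) auto
        also have "\<dots> = (\<Sum>j<N. ennreal (\<phi> (x j) - e) * ennreal (c * d))"
          by (intro sum.cong refl) (auto simp: max_def ennreal_neg)
        finally show ?thesis .
      qed
      also have "\<dots> \<le> (\<Sum>j<N. ennreal (\<phi> (x j) - e) * emeasure \<mu> (B j))"
        unfolding B_def using d by (intro sum_mono mult_left_mono arc) auto
      also have "\<dots> = (\<Sum>j<N. \<integral>\<^sup>+ z. ennreal (\<phi> (x j) - e) * indicator (B j) z \<partial>\<mu>)"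
        by (intro sum.cong refl nn_integral_cmult_indicator[symmetric]) measurable
      also have "\<dots> = (\<integral>\<^sup>+ z. (\<Sum>j<N. ennreal (\<phi> (x j) - e) * indicator (B j) z) \<partial>\<mu>)"
        by (intro nn_integral_sum[symmetric]) measurable
      also have "\<dots> \<le> (\<integral>\<^sup>+ z. ennreal (cmod (f z) powr p) \<partial>\<mu>)"
      proof (rule nn_integral_mono)
        fix z
        show "(\<Sum>j<N. ennreal (\<phi> (x j) - e) * indicator (B j) z) \<le> ennreal (cmod (f z) powr p)"
        proof (cases "\<exists>i<N. z \<in> B i")
          case True
          then obtain i where i: "i < N" "z \<in> B i" by blast
          have "z \<notin> B j" if "j < N" "j \<noteq> i" for j
            using disj[OF i(1) that(1)] disj[OF that(1) i(1)] that(2) i(2) by (cases "i < j") auto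
          then have "(\<Sum>j<N. ennreal (\<phi> (x j) - e) * indicator (B j) z) = (\<Sum>j<N. if j = i then ennreal (\<phi> (x i) - e) else 0)"
            using i by (intro sum.cong refl) (auto simp: indicator_def)
          also have "\<dots> = ennreal (\<phi> (x i) - e)" using i by simp
          also have "\<dots> \<le> ennreal (cmod (f z) powr p)"
          proof -
            obtain t where t: "z = circ t" "x i \<le> t" "t \<le> x i + d" using i(2) by (auto simp: B_def arc_eq_circ)
            have "\<bar>\<phi> (x i) - \<phi> t\<bar> < e" using x01[OF i(1)] t d by (intro unif) auto
            then show ?thesis unfolding t(1) \<phi>_def[symmetric] by (intro ennreal_leI) auto
          qed
          finally show ?thesis .
        next
          case False
          then have "(\<Sum>j<N. ennreal (\<phi> (x j) - e) * indicator (B j) z) = 0" by (intro sum.neutral) auto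
          then show ?thesis by simp
        qed
      qed
      also have "\<dots> = ennreal J" by (rule real)
      finally have "c * d * (S - real N * e) \<le> J" using real(1) by (auto simp: ennreal_le_iff2)
      moreover have "c * d * (S - real N * e) = c * (1 - 1 / real N) * (S / real N - e)"
        using N by (simp add: d_def field_simps)
      moreover have "c * (1 - 1 / real N) * (\<Phi> - 2 * e) \<le> c * (1 - 1 / real N) * (S / real N - e)"
        using 1 c N by (intro mult_left_mono mult_nonneg_nonneg) auto
      ultimately show ?thesis by linarith
    qed
    have "c * (\<Phi> - 2 * e) \<le> J" if e: "0 < e" for e
    proof -
      have "uniformly_continuous_on {0..1} \<phi>" by (rule compact_uniformly_continuous[OF \<phi>c]) simp
      then obtain \<delta> where \<delta>: "0 < \<delta>" and u: "\<forall>x\<in>{0..1}. \<forall>y\<in>{0..1}. dist y x < \<delta> \<longrightarrow> dist (\<phi> y) (\<phi> x) < e"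
        unfolding uniformly_continuous_on_def using e by blast
      have "(\<lambda>N. c * (1 - 1 / real N) * (\<Phi> - 2 * e)) \<longlonglongrightarrow> c * (1 - 0) * (\<Phi> - 2 * e)"
        by (intro tendsto_intros lim_1_over_n)
      moreover have "\<forall>\<^sub>F N in sequentially. 1 / real N < \<delta>"
        using lim_1_over_n[where 'a = real] \<delta> by (rule order_tendstoD(2))
      then have "\<forall>\<^sub>F N in sequentially. c * (1 - 1 / real N) * (\<Phi> - 2 * e) \<le> J"
        using eventually_ge_at_top[of 2]
      proof eventually_elim
        case (elim N)
        show ?case using elim u by (intro main e) (auto simp: dist_real_def)
      qed
      ultimately show ?thesis using tendsto_upperbound by fastforce
    qed
    then have lim: "c * (\<Phi> - 2 * e) \<le> J" if "0 < e" for e using that by blast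
    have "c * \<Phi> \<le> J"
    proof (rule field_le_epsilon)
      fix e :: real assume "0 < e"
      then have "c * (\<Phi> - 2 * (e / (2 * c))) \<le> J" using c by (intro lim) simp
      moreover have "c * (\<Phi> - 2 * (e / (2 * c))) = c * \<Phi> - e" using c by (simp add: right_diff_distrib)
      ultimately show "c * \<Phi> \<le> J + e" by linarith
    qed
    then show ?thesis unfolding I\<Phi> real using c \<Phi>0 by (simp add: ennreal_mult[symmetric] ennreal_leI)
  qed simp
qed

theorem reverse_carleson_sufficient:
  assumes p: "0 < p" and q: "2 \<le> q" and \<mu>: "disc_measure \<mu>" and c: "0 < c"
    and arc: "\<And>a l. 0 \<le> l \<Longrightarrow> l \<le> 1 \<Longrightarrow> ennreal (c * l) \<le> emeasure \<mu> (arc a l)"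
  shows "reverse_carleson \<mu> 0 p q"
proof -
  obtain C where C: "0 < C" "\<And>f. continuous_on (cball 0 1) f \<Longrightarrow> f holomorphic_on ball 0 1 \<Longrightarrow> HF0_bound p q C f"
    using HF0_bound_disc_algebra[OF p q] by blast
  have sets: "sets \<mu> = sets borel" using \<mu> by (simp add: disc_measure_def)
  define A where "A = (C / c) powr (1 / p)"
  have A: "0 < A" using C c by (simp add: A_def)
  show ?thesis unfolding reverse_carleson_def
  \<comment> \<open>The integral part and the value at 0 contribute one copy of \<open>A\<close>
    each.\<close>
  proof (intro exI[of _ "2 * A"] conjI allI impI)
    show "0 < 2 * A" using A by simp
    fix f assume hol: "f holomorphic_on ball 0 1" and cont: "continuous_on (cball 0 1) f"
    define I where "I = (\<integral>\<^sup>+ z. ennreal (cmod (f z) powr p) \<partial>\<mu>)"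
    have "ennreal c * circ_pow_int p f \<le> I"
      unfolding I_def by (rule circ_pow_int_le_measure_integral[OF sets c arc cont p])
    then have "ennreal (C / c) * (ennreal c * circ_pow_int p f) \<le> ennreal (C / c) * I" by (rule mult_left_mono) simp
    moreover have "ennreal (C / c) * (ennreal c * circ_pow_int p f) = ennreal C * circ_pow_int p f"
      using C c by (simp add: mult.assoc[symmetric] ennreal_mult[symmetric])
    ultimately have le: "ennreal C * circ_pow_int p f \<le> ennreal (C / c) * I" by simp
    have e: "enn_powr (ennreal (C / c) * I) (1 / p) = ennreal A * enn_powr I (1 / p)"
      unfolding A_def using C c by (intro enn_powr_cmult) auto
    have "enn_powr (F_pow f 0 p q 1) (1 / p) \<le> enn_powr (ennreal (C / c) * I) (1 / p)"
      using C(2)[OF cont hol] le p by (intro enn_powr_mono) (auto simp: HF0_bound_def)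
    moreover have "enn_powr (ennreal (cmod (f 0) powr p)) (1 / p) \<le> enn_powr (ennreal (C / c) * I) (1 / p)"
      using C(2)[OF cont hol] le p by (intro enn_powr_mono) (auto simp: HF0_bound_def)
    moreover have "enn_powr (ennreal (cmod (f 0) powr p)) (1 / p) = ennreal (cmod (f 0))"
      using p by (simp add: enn_powr_ennreal powr_powr)
    ultimately have "HF_norm f 0 p q \<le> ennreal A * enn_powr I (1 / p) + ennreal A * enn_powr I (1 / p)"
      unfolding HF_norm_order0 e by (intro add_mono) auto
    also have "\<dots> = (ennreal A + ennreal A) * enn_powr I (1 / p)" by (simp only: distrib_right)
    also have "ennreal A + ennreal A = ennreal (2 * A)" using A by (simp add: ennreal_plus[symmetric] del: ennreal_plus)
    finally show "HF_norm f 0 p q \<le> ennreal (2 * A) * Lp_norm \<mu> p f" by (simp add: Lp_norm_def I_def)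
  qed
qed

section \<open>Lower bounds for the quasinorm and positive smoothness\<close>

text \<open>The radial quantity is normalised to homogeneity one, so that finite \<open>q\<close>
  and \<open>q = top\<close> share the outer integral and the test function arguments.\<close>

definition F_slice :: "(complex \<Rightarrow> complex) \<Rightarrow> real \<Rightarrow> ennreal \<Rightarrow> nat \<Rightarrow> real \<Rightarrow> ennreal" where
  "F_slice f s q m t = (if q = top then F_inner_inf f s m t
     else enn_powr (F_inner f s m (enn2real q) t) (1 / enn2real q))"

lemma F_pow_slice:
  "F_pow f s p q m = (\<integral>\<^sup>+ t. enn_powr (F_slice f s q m t) p * indicator {0..1} t \<partial>lborel)"
  by (simp add: F_pow_def F_slice_def enn_powr_powr)

text \<open>Here \<open>1 - r\<close> is comparable to \<open>1 / N\<close>, which is also the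
  length; for \<open>N\<close> at least 4 the powers of \<open>r\<close> up to order
  \<open>N\<close> stay bounded below.\<close>

definition annulus_interval :: "real \<Rightarrow> real set" where
  "annulus_interval N = {1 - 2 / N..1 - 1 / N}"

text \<open>\<open>(1 - r) N\<close> lies in [1, 2]; the minimum covers both signs of the
  exponent.\<close>

lemma weight_lower_bound:
  assumes N: "2 \<le> N" and r: "r \<in> annulus_interval N"
  shows "min 1 (2 powr e) * N powr (- e) \<le> (1 - r) powr e"
proof -
  define x where "x = (1 - r) * N"
  have "1 / N \<le> 1 - r" "1 - r \<le> 2 / N" using r by (auto simp: annulus_interval_def)
  then have x: "1 \<le> x" "x \<le> 2" using N by (auto simp: x_def field_simps)
  have "min 1 (2 powr e) \<le> x powr e"
  proof (cases "0 \<le> e")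
    case True
    then show ?thesis using x by (intro min.coboundedI1 ge_one_powr_ge_zero)
  next
    case False
    then show ?thesis using x by (intro min.coboundedI2 powr_mono2') auto
  qed
  then have "min 1 (2 powr e) * N powr (- e) \<le> x powr e * N powr (- e)" by (rule mult_right_mono) simp
  also have "\<dots> = (1 - r) powr e"
    using N x by (simp add: x_def powr_mult powr_minus zero_less_mult_iff)
  finally show ?thesis .
qed

text \<open>An annulus of length \<open>1 / N k\<close> with weight about
  \<open>N k powr (1 - \<gamma>)\<close> contributes
  \<open>B k powr a * N k powr (- \<gamma>)\<close>. Disjointness lets the contributions of many
  frequencies add up, which drives the case of small \<open>q\<close>.\<close>

lemma F_inner_lower_bound:
  fixes s a :: real
  assumes K: "finite K" and N: "\<And>k. k \<in> K \<Longrightarrow> 2 \<le> N k"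
    and disj: "\<And>i j. i \<in> K \<Longrightarrow> j \<in> K \<Longrightarrow> i \<noteq> j \<Longrightarrow> annulus_interval (N i) \<inter> annulus_interval (N j) = {}"
    and B: "\<And>k. k \<in> K \<Longrightarrow> 0 \<le> B k"
    and f: "\<And>k r. k \<in> K \<Longrightarrow> r \<in> annulus_interval (N k) \<Longrightarrow> B k \<le> cmod ((deriv ^^ m) f (of_real r * circ t))"
    and a: "0 < a"
  defines "\<gamma> \<equiv> (real m - s) * a"
  shows "ennreal (min 1 (2 powr (\<gamma> - 1)) * (\<Sum>k\<in>K. B k powr a * N k powr (- \<gamma>))) \<le> F_inner f s m a t"
proof -
  define \<kappa> where "\<kappa> = min 1 (2 powr (\<gamma> - 1))"
  have \<kappa>: "0 < \<kappa>" by (simp add: \<kappa>_def)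
  define c where "c k = B k powr a * (\<kappa> * N k powr (- (\<gamma> - 1)))" for k
  have c0: "0 \<le> c k" for k using \<kappa> by (simp add: c_def)
  have [measurable]: "annulus_interval x \<in> sets lborel" for x by (simp add: annulus_interval_def)
  have em: "emeasure lborel (annulus_interval x) = ennreal (1 / x)" if "2 \<le> x" for x
    using that by (simp add: annulus_interval_def field_simps diff_divide_distrib[symmetric])
  have "ennreal (\<kappa> * (\<Sum>k\<in>K. B k powr a * N k powr (- \<gamma>))) = ennreal (\<Sum>k\<in>K. c k * (1 / N k))"
  proof -
    have "\<kappa> * (B k powr a * N k powr (- \<gamma>)) = c k * (1 / N k)" if "k \<in> K" for k
    proof -
      have "N k powr (- (\<gamma> - 1)) = N k powr (- \<gamma>) * N k"
        using N[OF that] powr_add[of "N k" "- \<gamma>" 1] by simp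
      then show ?thesis using N[OF that] by (simp add: c_def)
    qed
    then show ?thesis by (simp add: sum_distrib_left)
  qed
  also have "\<dots> = (\<Sum>k\<in>K. ennreal (c k * (1 / N k)))"
    using c0 N by (intro sum_ennreal[symmetric]) (force intro: divide_nonneg_nonneg)
  also have "\<dots> = (\<Sum>k\<in>K. ennreal (c k) * ennreal (1 / N k))"
    using c0 by (intro sum.cong refl ennreal_mult') auto
  also have "\<dots> = (\<Sum>k\<in>K. ennreal (c k) * emeasure lborel (annulus_interval (N k)))"
    using N by (intro sum.cong refl) (simp add: em)
  also have "\<dots> = (\<Sum>k\<in>K. \<integral>\<^sup>+ r. ennreal (c k) * indicator (annulus_interval (N k)) r \<partial>lborel)"
    by (intro sum.cong refl nn_integral_cmult_indicator[symmetric]) measurable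
  also have "\<dots> = (\<integral>\<^sup>+ r. (\<Sum>k\<in>K. ennreal (c k) * indicator (annulus_interval (N k)) r) \<partial>lborel)"
    by (intro nn_integral_sum[symmetric]) measurable
  also have "\<dots> \<le> F_inner f s m a t" unfolding F_inner_def
  proof (rule nn_integral_mono)
    fix r :: real
    let ?R = "ennreal (cmod ((deriv ^^ m) f (complex_of_real r * cis (2 * pi * t))) powr a * (1 - r) powr ((real m - s) * a - 1)) * indicator {0..<1} r"
    show "(\<Sum>k\<in>K. ennreal (c k) * indicator (annulus_interval (N k)) r) \<le> ?R"
    proof (cases "\<exists>i\<in>K. r \<in> annulus_interval (N i)")
      case True
      then obtain i where i: "i \<in> K" "r \<in> annulus_interval (N i)" by blast
      have "(\<Sum>k\<in>K. ennreal (c k) * indicator (annulus_interval (N k)) r) = (\<Sum>k\<in>K. if k = i then ennreal (c i) else 0)"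
        using i disj[OF _ i(1)] by (intro sum.cong refl) (auto simp: indicator_def)
      also have "\<dots> = ennreal (c i)" using i K by simp
      also have "\<dots> \<le> ennreal (cmod ((deriv ^^ m) f (complex_of_real r * cis (2 * pi * t))) powr a * (1 - r) powr (\<gamma> - 1))"
        unfolding c_def \<kappa>_def using f[OF i] B[OF i(1)] a
        by (intro ennreal_leI mult_mono powr_mono2 weight_lower_bound N i mult_nonneg_nonneg) (auto simp: circ_def)
      also have "r \<in> {0..<1}"
      proof -
        have "2 / N i \<le> 1" "0 < 1 / N i" using N[OF i(1)] by auto
        moreover have "1 - 2 / N i \<le> r" "r \<le> 1 - 1 / N i" using i(2) by (auto simp: annulus_interval_def)
        ultimately have "0 \<le> r" "r < 1" by linarith+
        then show ?thesis by simp
      qed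
      then have "ennreal (cmod ((deriv ^^ m) f (complex_of_real r * cis (2 * pi * t))) powr a * (1 - r) powr (\<gamma> - 1)) = ?R"
        by (simp add: \<gamma>_def)
      finally show ?thesis .
    next
      case False
      then have "(\<Sum>k\<in>K. ennreal (c k) * indicator (annulus_interval (N k)) r) = 0" by (intro sum.neutral) auto
      then show ?thesis by simp
    qed
  qed
  finally show ?thesis unfolding \<kappa>_def .
qed

lemma F_slice_lower_bound:
  assumes q: "0 < q"
  obtains \<kappa> where "0 < \<kappa>" "\<And>f t N B. 2 \<le> N \<Longrightarrow> 0 \<le> B \<Longrightarrow>
    (\<And>r. r \<in> annulus_interval N \<Longrightarrow> B \<le> cmod ((deriv ^^ m) f (of_real r * circ t))) \<Longrightarrow>
    ennreal (\<kappa> * (B * N powr (- (real m - s)))) \<le> F_slice f s q m t"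
proof (cases "q = top")
  case True
  show ?thesis
  proof (rule that[of 1])
    fix f t N B assume N: "2 \<le> (N::real)" and B: "0 \<le> (B::real)"
      and f: "\<And>r. r \<in> annulus_interval N \<Longrightarrow> B \<le> cmod ((deriv ^^ m) f (of_real r * circ t))"
    \<comment> \<open>For \<open>q = top\<close> a single radius suffices, the right end point of
      the interval.\<close>
    have r: "1 - 1 / N \<in> annulus_interval N" "1 - 1 / N \<in> {0..<1}" using N by (auto simp: annulus_interval_def field_simps)
    have "B * N powr (- (real m - s)) = B * (1 - (1 - 1 / N)) powr (real m - s)"
    proof -
      have "1 - (1 - 1 / N) = N powr (- 1)" using N by (simp add: powr_minus divide_inverse)
      then show ?thesis by (simp only: powr_powr) simp
    qed
    also have "\<dots> \<le> cmod ((deriv ^^ m) f (of_real (1 - 1 / N) * cis (2 * pi * t))) * (1 - (1 - 1 / N)) powr (real m - s)"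
      using f[OF r(1)] by (intro mult_right_mono) (auto simp: circ_def)
    finally have "ennreal (B * N powr (- (real m - s))) \<le> ennreal \<dots>" by (rule ennreal_leI)
    also have "\<dots> \<le> F_inner_inf f s m t" unfolding F_inner_inf_def by (rule SUP_upper[OF r(2)])
    finally show "ennreal (1 * (B * N powr (- (real m - s)))) \<le> F_slice f s q m t"
      by (simp add: F_slice_def True)
  qed simp
next
  case False
  define a where "a = enn2real q"
  have a: "0 < a" using q False unfolding a_def by (simp add: enn2real_positive_iff top.not_eq_extremum)
  define \<gamma> where "\<gamma> = (real m - s) * a"
  define \<kappa> where "\<kappa> = min 1 (2 powr (\<gamma> - 1))"
  have \<kappa>: "0 < \<kappa>" by (simp add: \<kappa>_def)
  show ?thesis
  proof (rule that[of "\<kappa> powr (1 / a)"])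
    fix f t N B assume N: "2 \<le> (N::real)" and B: "0 \<le> (B::real)"
      and f: "\<And>r. r \<in> annulus_interval N \<Longrightarrow> B \<le> cmod ((deriv ^^ m) f (of_real r * circ t))"
    have "ennreal (\<kappa> * (B powr a * N powr (- \<gamma>))) \<le> F_inner f s m a t"
      using F_inner_lower_bound[of "{()}" "\<lambda>_. N" "\<lambda>_. B" m f t a s] N B f a
      by (simp add: \<kappa>_def \<gamma>_def)
    then have "enn_powr (ennreal (\<kappa> * (B powr a * N powr (- \<gamma>)))) (1 / a) \<le> enn_powr (F_inner f s m a t) (1 / a)"
      using a by (intro enn_powr_mono) auto
    also have "enn_powr (ennreal (\<kappa> * (B powr a * N powr (- \<gamma>)))) (1 / a) = ennreal ((\<kappa> * (B powr a * N powr (- \<gamma>))) powr (1 / a))"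
      using \<kappa> by (intro enn_powr_ennreal) simp
    also have "(\<kappa> * (B powr a * N powr (- \<gamma>))) powr (1 / a) = \<kappa> powr (1 / a) * (B * N powr (- (real m - s)))"
    proof -
      have "(\<kappa> * (B powr a * N powr (- \<gamma>))) powr (1 / a) = \<kappa> powr (1 / a) * (B powr (a * (1 / a)) * N powr (- \<gamma> * (1 / a)))"
        using \<kappa> N B by (simp only: powr_mult powr_powr powr_ge_zero mult_nonneg_nonneg less_imp_le)
      then show ?thesis using a B by (simp add: \<gamma>_def)
    qed
    finally show "ennreal (\<kappa> powr (1 / a) * (B * N powr (- (real m - s)))) \<le> F_slice f s q m t"
      by (simp add: F_slice_def False a_def)
  qed (use \<kappa> in simp)
qed

lemma HF_norm_ge_const:
  assumes "\<And>t. ennreal b \<le> F_slice f s q (ord_m s) t" "0 \<le> b" "0 < p"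
  shows "ennreal b \<le> HF_norm f s p q"
proof -
  have "ennreal (b powr p) = (\<integral>\<^sup>+ t. ennreal (b powr p) * indicator {0..1::real} t \<partial>lborel)"
    by (subst nn_integral_cmult_indicator) auto
  also have "\<dots> \<le> F_pow f s p q (ord_m s)"
    unfolding F_pow_slice
  proof (intro nn_integral_mono mult_right_mono)
    fix t
    have "ennreal (b powr p) = enn_powr (ennreal b) p" using assms by (simp add: enn_powr_ennreal)
    also have "\<dots> \<le> enn_powr (F_slice f s q (ord_m s) t) p" using assms by (intro enn_powr_mono) auto
    finally show "ennreal (b powr p) \<le> enn_powr (F_slice f s q (ord_m s) t) p" .
  qed simp
  finally have "enn_powr (ennreal (b powr p)) (1 / p) \<le> enn_powr (F_pow f s p q (ord_m s)) (1 / p)"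
    using assms by (intro enn_powr_mono) auto
  moreover have "enn_powr (ennreal (b powr p)) (1 / p) = ennreal b"
    using assms by (simp add: enn_powr_ennreal powr_powr)
  ultimately show ?thesis unfolding HF_norm_def by (simp add: add_increasing2)
qed

section \<open>Finiteness of the quasinorm for entire test functions, and monomials as test
  functions\<close>

lemma ord_m_greater: "0 \<le> s \<Longrightarrow> s < real (ord_m s)"
  unfolding ord_m_def by linarith

lemma nn_integral_weight_finite:
  assumes "0 < (e::real)"
  shows "(\<integral>\<^sup>+ r. ennreal ((1 - r) powr (e - 1)) * indicator {0..<1} r \<partial>lborel) \<le> ennreal (1 / e)"
proof -
  have I: "((\<lambda>x. x powr (e - 1)) has_integral 1 powr (e - 1 + 1) / (e - 1 + 1)) {0..1}"
    by (rule has_integral_powr_from_0) (use assms in auto)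
  have "(\<integral>\<^sup>+ r. ennreal ((1 - r) powr (e - 1)) * indicator {0..<1} r \<partial>lborel) =
     (\<integral>\<^sup>+ r. ennreal (r powr (e - 1)) * indicator {0<..1} r \<partial>lborel)"
    by (subst nn_integral_real_affine[where c = "-1" and t = 1])
       (auto intro!: nn_integral_cong simp: indicator_def)
  also have "\<dots> \<le> (\<integral>\<^sup>+ r. ennreal (r powr (e - 1)) * indicator {0..1} r \<partial>lborel)"
    by (intro nn_integral_mono) (auto simp: indicator_def)
  also have "\<dots> = ennreal (1 powr (e - 1 + 1) / (e - 1 + 1))"
    by (rule nn_integral_has_integral_lebesgue'[OF _ I]) auto
  finally show ?thesis using assms by simp
qed

text \<open>The derivative is bounded on the closed disc and the weight is integrable since
  \<open>s < m\<close>. The reverse inequality is only assumed for functions of finite quasinorm, so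
  each test function must pass this check.\<close>

lemma HF_norm_entire_finite:
  assumes f: "f holomorphic_on UNIV" and s: "0 \<le> s" and p: "0 < p" and q: "0 < q"
  shows "HF_norm f s p q < top"
proof -
  define m where "m = ord_m s"
  define \<beta> where "\<beta> = real m - s"
  have \<beta>: "0 < \<beta>" using ord_m_greater[OF s] by (simp add: \<beta>_def m_def)
  have "(deriv ^^ m) f holomorphic_on UNIV" by (intro holomorphic_higher_deriv f) auto
  then have "continuous_on (cball 0 1) ((deriv ^^ m) f)"
    by (intro holomorphic_on_imp_continuous_on) (auto intro: holomorphic_on_subset)
  then obtain K where K: "0 < K" "\<And>z. cmod z \<le> 1 \<Longrightarrow> cmod ((deriv ^^ m) f z) \<le> K"
    using bounded_on_cball by blast
  have Kc: "cmod ((deriv ^^ m) f (of_real r * cis (2 * pi * t))) \<le> K" if "0 \<le> r" "r < 1" for r t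
    using that by (intro K) (auto simp: norm_mult)
  have "\<exists>A. \<forall>t. F_slice f s q m t \<le> ennreal A"
  proof (cases "q = top")
    case True
    have "F_inner_inf f s m t \<le> ennreal K" for t
      unfolding F_inner_inf_def
    proof (rule SUP_least)
      fix r :: real assume r: "r \<in> {0..<1}"
      have "cmod ((deriv ^^ m) f (of_real r * cis (2 * pi * t))) * (1 - r) powr (real m - s) \<le> K * 1"
        using r \<beta> K(1) Kc by (intro mult_mono powr_le1) (auto simp: \<beta>_def)
      then show "ennreal (cmod ((deriv ^^ m) f (of_real r * cis (2 * pi * t))) * (1 - r) powr (real m - s)) \<le> ennreal K"
        by (intro ennreal_leI) simp
    qed
    then show ?thesis using True by (auto simp: F_slice_def)
  next
    case False
    define a where "a = enn2real q"
    have a: "0 < a" using q False unfolding a_def by (simp add: enn2real_positive_iff top.not_eq_extremum)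
    have "F_inner f s m a t \<le> ennreal (K powr a / (\<beta> * a))" for t
    proof -
      have "F_inner f s m a t \<le> (\<integral>\<^sup>+ r. ennreal (K powr a) * (ennreal ((1 - r) powr (\<beta> * a - 1)) * indicator {0..<1} r) \<partial>lborel)"
        unfolding F_inner_def
      proof (rule nn_integral_mono)
        fix r :: real
        show "ennreal (cmod ((deriv ^^ m) f (complex_of_real r * cis (2 * pi * t))) powr a * (1 - r) powr ((real m - s) * a - 1)) * indicator {0..<1} r
           \<le> ennreal (K powr a) * (ennreal ((1 - r) powr (\<beta> * a - 1)) * indicator {0..<1} r)"
        proof (cases "r \<in> {0..<1}")
          case True
          have "cmod ((deriv ^^ m) f (complex_of_real r * cis (2 * pi * t))) powr a * (1 - r) powr (\<beta> * a - 1) \<le> K powr a * (1 - r) powr (\<beta> * a - 1)"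
            using True a Kc by (intro mult_right_mono powr_mono2) auto
          then show ?thesis using True by (simp add: \<beta>_def ennreal_mult[symmetric] ennreal_leI)
        qed simp
      qed
      also have "\<dots> = ennreal (K powr a) * (\<integral>\<^sup>+ r. ennreal ((1 - r) powr (\<beta> * a - 1)) * indicator {0..<1} r \<partial>lborel)"
        by (rule nn_integral_cmult) measurable
      also have "\<dots> \<le> ennreal (K powr a) * ennreal (1 / (\<beta> * a))"
        using \<beta> a by (intro mult_left_mono nn_integral_weight_finite) auto
      also have "\<dots> = ennreal (K powr a / (\<beta> * a))" using \<beta> a by (simp add: ennreal_mult[symmetric])
      finally show ?thesis .
    qed
    then have "enn_powr (F_inner f s m a t) (1 / a) \<le> enn_powr (ennreal (K powr a / (\<beta> * a))) (1 / a)" for t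
      using a by (intro enn_powr_mono) auto
    also have "enn_powr (ennreal (K powr a / (\<beta> * a))) (1 / a) = ennreal ((K powr a / (\<beta> * a)) powr (1 / a))"
      using \<beta> a by (intro enn_powr_ennreal) auto
    finally show ?thesis using False by (auto simp: F_slice_def a_def)
  qed
  then obtain A where A: "\<And>t. F_slice f s q m t \<le> ennreal A" by blast
  have "F_pow f s p q m \<le> (\<integral>\<^sup>+ t. enn_powr (ennreal A) p * indicator {0..1::real} t \<partial>lborel)"
    unfolding F_pow_slice using p by (intro nn_integral_mono mult_right_mono enn_powr_mono A) auto
  also have "\<dots> = enn_powr (ennreal A) p" by (subst nn_integral_cmult_indicator) auto
  also have "\<dots> < top" by (simp add: enn_powr_def)
  finally have "F_pow f s p q m \<noteq> top" by simp
  then have "enn_powr (F_pow f s p q m) (1 / p) \<noteq> top" by (simp add: enn_powr_def)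
  then show ?thesis unfolding HF_norm_def m_def by (simp add: less_top)
qed

lemma one_minus_power_ge:
  assumes N: "4 \<le> N"
  shows "exp (- 4) \<le> (1 - 2 / real N) ^ N"
proof -
  \<comment> \<open>\<open>1 + x\<close> is the reciprocal of \<open>1 - 2 / N\<close>, and
    \<open>4 \<le> N\<close> is exactly what makes \<open>N x \<le> 4\<close>.\<close>
  define x where "x = 2 / (real N - 2)"
  have x: "0 < x" "real N * x \<le> 4" using N by (auto simp: x_def field_simps)
  have "1 + x \<le> exp x" by (rule exp_ge_add_one_self)
  moreover have "(1 - 2 / real N) * (1 + x) = 1" using N by (simp add: x_def field_simps)
  moreover have "0 \<le> 1 - 2 / real N" using N by simp
  ultimately have "1 \<le> (1 - 2 / real N) * exp x" by (metis mult_left_mono)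
  then have "exp (- x) * 1 \<le> exp (- x) * ((1 - 2 / real N) * exp x)" by (intro mult_left_mono) auto
  also have "\<dots> = (1 - 2 / real N) * (exp (- x) * exp x)" by (simp only: mult_ac)
  finally have "exp (- x) \<le> 1 - 2 / real N" by (simp add: exp_minus_inverse exp_minus)
  then have "exp (- x) ^ N \<le> (1 - 2 / real N) ^ N" by (intro power_mono) auto
  moreover have "exp (- x) ^ N = exp (- (real N * x))" by (simp add: exp_of_nat_mult[symmetric])
  moreover have "exp (- 4) \<le> exp (- (real N * x))" using x by simp
  ultimately show ?thesis by linarith
qed

lemma radius_power_ge:
  assumes N: "4 \<le> N" and r: "r \<in> annulus_interval (real N)" and k: "k \<le> N"
  shows "exp (- 4) \<le> r ^ k" and "0 \<le> r" and "r < 1"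
proof -
  have "2 / real N \<le> 1" "0 < 1 / real N" using N by auto
  moreover have "1 - 2 / real N \<le> r" "r \<le> 1 - 1 / real N" using r by (auto simp: annulus_interval_def)
  ultimately have r': "0 \<le> 1 - 2 / real N" "1 - 2 / real N \<le> r" "r < 1" by linarith+
  then show "0 \<le> r" "r < 1" by auto
  have "exp (- 4) \<le> (1 - 2 / real N) ^ N" by (rule one_minus_power_ge[OF N])
  also have "\<dots> \<le> r ^ N" using r' by (intro power_mono) auto
  also have "\<dots> \<le> r ^ k" using r' k by (intro power_decreasing) auto
  finally show "exp (- 4) \<le> r ^ k" .
qed

theorem no_reverse_carleson_positive_smoothness:
  assumes s: "0 < s" and p: "0 < p" and q: "0 < q" and \<mu>: "disc_measure \<mu>"
  shows "\<not> reverse_carleson \<mu> s p q"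
proof
  assume "reverse_carleson \<mu> s p q"
  then obtain C where C: "0 < C" "\<And>f. f holomorphic_on ball 0 1 \<Longrightarrow> continuous_on (cball 0 1) f \<Longrightarrow>
      HF_norm f s p q < top \<Longrightarrow> HF_norm f s p q \<le> ennreal C * Lp_norm \<mu> p f"
    unfolding reverse_carleson_def by blast
  have fin: "emeasure \<mu> (space \<mu>) \<noteq> top" and sets: "sets \<mu> = sets borel" and null: "emeasure \<mu> (- cball 0 1) = 0"
    using \<mu> by (auto simp: disc_measure_def finite_measure_def finite_measure_axioms_def top_unique)
  have AE: "AE z in \<mu>. cmod z \<le> 1"
    by (rule AE_I[of _ _ "- cball 0 1"]) (use null sets in auto)
  obtain T where T: "emeasure \<mu> (space \<mu>) = ennreal T" "0 \<le> T" using fin by (cases "emeasure \<mu> (space \<mu>)") auto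
  define m where "m = ord_m s"
  obtain \<kappa> where \<kappa>: "0 < \<kappa>" "\<And>f t N B. 2 \<le> N \<Longrightarrow> 0 \<le> B \<Longrightarrow>
    (\<And>r. r \<in> annulus_interval N \<Longrightarrow> B \<le> cmod ((deriv ^^ m) f (of_real r * circ t))) \<Longrightarrow>
    ennreal (\<kappa> * (B * N powr (- (real m - s)))) \<le> F_slice f s q m t"
    using F_slice_lower_bound[OF q, of m s] by blast
  define c where "c = \<kappa> * ((1 / 2) ^ m * exp (- 4))"
  have c: "0 < c" using \<kappa> by (simp add: c_def)
  have bound: "c * real N powr s \<le> C * T powr (1 / p)" if N: "4 \<le> N" "2 * m \<le> N" for N
  proof -
    define f where "f z = z ^ N" for z :: complex
    have fh: "f holomorphic_on UNIV" unfolding f_def by (intro holomorphic_intros)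
    define B where "B = (real N / 2) ^ m * exp (- 4)"
    have B0: "0 \<le> B" by (simp add: B_def)
    have df: "B \<le> cmod ((deriv ^^ m) f (of_real r * circ t))" if r: "r \<in> annulus_interval (real N)" for r t
    proof -
      have "(deriv ^^ m) f z = of_nat (pochhammer (Suc N - m) m) * z ^ (N - m)" for z
        using higher_deriv_power[of m 0 N z] by (simp only: f_def[abs_def] pochhammer_of_nat diff_0_right)
      then have "cmod ((deriv ^^ m) f (of_real r * circ t)) = real (pochhammer (Suc N - m) m) * \<bar>r\<bar> ^ (N - m)"
        by (simp only: norm_mult norm_power norm_of_nat norm_of_real norm_circ mult_1_right)
      also have "\<bar>r\<bar> = r" using radius_power_ge(2)[OF N(1) r order_refl] by simp
      also have "(real N / 2) ^ m * exp (- 4) \<le> real (pochhammer (Suc N - m) m) * r ^ (N - m)"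
      proof (intro mult_mono radius_power_ge[OF N(1) r])
        \<comment> \<open>The falling factorial from the derivative has \<open>m\<close> factors,
          each at least \<open>N / 2\<close> because \<open>2 m \<le> N\<close>.\<close>
        have "(real N / 2) ^ m = (\<Prod>i<m. real N / 2)" by simp
        also have "\<dots> \<le> (\<Prod>i<m. real (Suc N - m + i))"
          using N(2) by (intro prod_mono) auto
        also have "\<dots> = real (pochhammer (Suc N - m) m)"
          by (simp add: pochhammer_prod atLeast0LessThan)
        finally show "(real N / 2) ^ m \<le> real (pochhammer (Suc N - m) m)" .
      qed auto
      finally show ?thesis unfolding B_def .
    qed
    have "ennreal (\<kappa> * (B * real N powr (- (real m - s)))) \<le> HF_norm f s p q"
    proof (rule HF_norm_ge_const)
      show "ennreal (\<kappa> * (B * real N powr (- (real m - s)))) \<le> F_slice f s q (ord_m s) t" for t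
        unfolding m_def[symmetric] by (rule \<kappa>(2)[OF _ B0 df]) (use N in auto)
      show "0 \<le> \<kappa> * (B * real N powr (- (real m - s)))" using \<kappa> B0 by simp
    qed (rule p)
    also have "\<kappa> * (B * real N powr (- (real m - s))) = c * real N powr s"
    proof -
      have "real N powr (- (real m - s)) = real N powr s / real N ^ m"
        using N by (simp add: powr_diff powr_realpow)
      then show ?thesis using N by (simp add: B_def c_def power_divide field_simps)
    qed
    also have "HF_norm f s p q \<le> ennreal C * Lp_norm \<mu> p f"
      using fh s p q by (intro C HF_norm_entire_finite) (auto intro: holomorphic_on_subset holomorphic_on_imp_continuous_on)
    also have "Lp_norm \<mu> p f \<le> ennreal (T powr (1 / p))"
    proof -
      have "(\<integral>\<^sup>+ z. ennreal (cmod (f z) powr p) \<partial>\<mu>) \<le> (\<integral>\<^sup>+ z. 1 \<partial>\<mu>)"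
      proof (rule nn_integral_mono_AE)
        show "AE z in \<mu>. ennreal (cmod (f z) powr p) \<le> 1"
          using AE
        proof eventually_elim
          case (elim z)
          then have "cmod (f z) \<le> 1" by (simp add: f_def norm_power power_le_one)
          then show ?case using p by (simp add: powr_le1)
        qed
      qed
      then have "(\<integral>\<^sup>+ z. ennreal (cmod (f z) powr p) \<partial>\<mu>) \<le> ennreal T" using T by simp
      then have "enn_powr (\<integral>\<^sup>+ z. ennreal (cmod (f z) powr p) \<partial>\<mu>) (1 / p) \<le> enn_powr (ennreal T) (1 / p)"
        using p by (intro enn_powr_mono) auto
      then show ?thesis unfolding Lp_norm_def using T by (simp add: enn_powr_ennreal)
    qed
    finally have "ennreal (c * real N powr s) \<le> ennreal C * ennreal (T powr (1 / p))"
      by (simp add: mult_left_mono)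
    then have "ennreal (c * real N powr s) \<le> ennreal (C * T powr (1 / p))"
      using C(1) by (simp add: ennreal_mult)
    then show ?thesis using C(1) by (subst (asm) ennreal_le_iff) auto
  qed
  \<comment> \<open>By \<open>bound\<close>, \<open>N powr s\<close> never exceeds \<open>X\<close>
    for large \<open>N\<close>, which fails since \<open>0 < s\<close>.\<close>
  define X where "X = C * T powr (1 / p) / c"
  have X: "0 \<le> X" using C(1) c by (simp add: X_def)
  obtain N0 :: nat where N0: "X powr (1 / s) < real N0" using reals_Archimedean2 by blast
  define N where "N = max N0 (max 4 (2 * m))"
  have "(X powr (1 / s)) powr s < real N powr s"
    using N0 s by (intro powr_less_mono2) (auto simp: N_def)
  then have "X < real N powr s" using X s by (simp add: powr_powr)
  then have "C * T powr (1 / p) < c * real N powr s" using c by (simp add: X_def field_simps)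
  moreover have "c * real N powr s \<le> C * T powr (1 / p)" by (rule bound) (auto simp: N_def)
  ultimately show False by simp
qed

section \<open>Necessity of the arc condition\<close>

lemma disc_measureD:
  assumes "disc_measure \<mu>"
  obtains T where "sets \<mu> = sets borel" "space \<mu> = UNIV" "0 \<le> T" "emeasure \<mu> UNIV = ennreal T" "AE z in \<mu>. cmod z \<le> 1"
proof -
  have sets: "sets \<mu> = sets borel" and null: "emeasure \<mu> (- cball 0 1) = 0"
    and fin: "finite_measure \<mu>" using assms by (auto simp: disc_measure_def)
  have space: "space \<mu> = UNIV" using sets_eq_imp_space_eq[OF sets] by simp
  have "AE z in \<mu>. cmod z \<le> 1"
    by (rule AE_I[of _ _ "- cball 0 1"]) (use null sets in auto)
  moreover have "emeasure \<mu> UNIV \<noteq> top" using finite_measure.emeasure_finite[OF fin, of UNIV] by simp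
  then obtain T where "emeasure \<mu> UNIV = ennreal T" "0 \<le> T" by (cases "emeasure \<mu> UNIV") auto
  ultimately show ?thesis using that sets space by blast
qed

lemma F_pow_le_HF_norm:
  assumes "0 < p"
  shows "F_pow f 0 p q 1 \<le> enn_powr (HF_norm f 0 p q) p"
proof -
  have "enn_powr (enn_powr (F_pow f 0 p q 1) (1 / p)) p \<le> enn_powr (HF_norm f 0 p q) p"
    unfolding HF_norm_order0 using assms by (intro enn_powr_mono) (auto intro: add_increasing2)
  then show ?thesis using assms by (simp add: enn_powr_powr)
qed

text \<open>The derivative is \<open>N z^(N-1) P + z^N P'\<close>. On the annulus the first term has
  order \<open>N\<close>; the second term, and the passage from \<open>z\<close> to the circle by a
  Lipschitz bound over a distance at most \<open>2 / N\<close>, cost a bounded amount. Relative to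
  \<open>N\<close> the loss is of order \<open>1 / N\<close>.\<close>

lemma deriv_power_mult_lower_bound:
  assumes P: "P holomorphic_on UNIV" and K: "\<And>z. cmod z \<le> 1 \<Longrightarrow> cmod (P z) \<le> K" "\<And>z. cmod z \<le> 1 \<Longrightarrow> cmod (deriv P z) \<le> K"
    and N: "4 \<le> N" and r: "r \<in> annulus_interval (real N)"
  shows "real N * exp (- 4) * max 0 (cmod (P (circ t)) - (2 * K + K / exp (- 4)) / real N) \<le>
    cmod (deriv (\<lambda>z. z ^ N * P z) (of_real r * circ t))"
proof -
  define e0 :: real where "e0 = exp (- 4)"
  have e0: "0 < e0" by (simp add: e0_def)
  define z where "z = of_real r * circ t"
  have "cmod (P 0) \<le> K" by (rule K(1)) simp
  then have K0: "0 \<le> K" using norm_ge_zero[of "P 0"] by linarith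
  note rr = radius_power_ge(2,3)[OF N r order_refl]
  have nz: "cmod z = r" using rr by (simp add: z_def norm_mult)
  have dP: "(P has_field_derivative deriv P w) (at w)" for w
    using P by (intro holomorphic_derivI) auto
  have d: "deriv (\<lambda>z. z ^ N * P z) z = of_nat N * z ^ (N - 1) * P z + z ^ N * deriv P z"
    by (rule DERIV_imp_deriv) (auto intro!: derivative_eq_intros dP)
  have Nr: "real N * (1 - r) \<le> 2"
  proof -
    have "1 - r \<le> 2 / real N" using r by (auto simp: annulus_interval_def)
    then show ?thesis using N by (simp add: field_simps)
  qed
  have "cmod (P z - P (circ t)) \<le> K * cmod (z - circ t)"
    by (rule field_differentiable_bound[of "cball 0 1" P "deriv P"])
       (use K(2) rr nz in \<open>auto intro: has_field_derivative_at_within dP\<close>)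
  also have "z - circ t = of_real (r - 1) * circ t" by (simp add: z_def algebra_simps)
  also have "cmod \<dots> = 1 - r" using rr by (simp only: norm_mult norm_of_real norm_circ) simp
  finally have lip: "cmod (P (circ t)) - K * (1 - r) \<le> cmod (P z)"
    using norm_triangle_ineq2[of "P (circ t)" "P z"] by (simp add: norm_minus_commute)
  have low: "real N * r ^ (N - 1) * cmod (P z) - K \<le> cmod (deriv (\<lambda>z. z ^ N * P z) z)"
  proof -
    have "cmod (of_nat N * z ^ (N - 1) * P z) - cmod (z ^ N * deriv P z) \<le> cmod (deriv (\<lambda>z. z ^ N * P z) z)"
      unfolding d using norm_diff_ineq[of "of_nat N * z ^ (N - 1) * P z" "z ^ N * deriv P z"] by simp
    moreover have "cmod (z ^ N * deriv P z) \<le> 1 * K"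
      unfolding norm_mult norm_power nz using rr K(2)[of z] nz by (intro mult_mono power_le_one) auto
    ultimately show ?thesis by (simp add: norm_mult norm_power nz)
  qed
  show ?thesis
  proof (cases "cmod (P (circ t)) - (2 * K + K / e0) / real N \<le> 0")
    case True
    then show ?thesis unfolding e0_def by (simp add: max_absorb1)
  next
    case False
    have "real N * e0 * (cmod (P (circ t)) - (2 * K + K / e0) / real N) = e0 * (real N * cmod (P (circ t)) - K * 2) - K"
      using N e0 by (simp add: field_simps)
    also have "\<dots> \<le> e0 * (real N * cmod (P (circ t)) - K * (real N * (1 - r))) - K"
      using e0 K0 Nr by (intro diff_right_mono mult_left_mono diff_left_mono) auto
    also have "\<dots> = real N * e0 * (cmod (P (circ t)) - K * (1 - r)) - K" by (simp add: algebra_simps)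
    also have "\<dots> \<le> real N * e0 * cmod (P z) - K" using e0 by (intro diff_right_mono mult_left_mono lip) auto
    also have "\<dots> \<le> real N * r ^ (N - 1) * cmod (P z) - K"
      unfolding e0_def by (intro diff_right_mono mult_right_mono mult_left_mono radius_power_ge[OF N r]) auto
    also note low
    finally show ?thesis using False unfolding e0_def z_def by (simp add: max_absorb2)
  qed
qed

text \<open>Testing with \<open>z\<^sup>N P\<close> and letting \<open>N\<close> tend to infinity removes the part of the measure
  inside the disc.\<close>

lemma reverse_carleson_circle:
  assumes \<mu>: "disc_measure \<mu>" and p: "0 < p" and q: "0 < q" and rc: "reverse_carleson \<mu> 0 p q"
  obtains C where "0 < C" "\<And>P. P holomorphic_on UNIV \<Longrightarrow>
    circ_pow_int p P \<le> ennreal C * (\<integral>\<^sup>+ z. ennreal (cmod (P z) powr p) * indicator (sphere 0 1) z \<partial>\<mu>)"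
proof -
  obtain C where C: "0 < C" "\<And>f. f holomorphic_on ball 0 1 \<Longrightarrow> continuous_on (cball 0 1) f \<Longrightarrow>
      HF_norm f 0 p q < top \<Longrightarrow> HF_norm f 0 p q \<le> ennreal C * Lp_norm \<mu> p f"
    using rc unfolding reverse_carleson_def by blast
  obtain T where sets: "sets \<mu> = sets borel" and T: "space \<mu> = UNIV" "0 \<le> T" "emeasure \<mu> UNIV = ennreal T"
    and AE: "AE z in \<mu>. cmod z \<le> 1" using disc_measureD[OF \<mu>] .
  note [measurable_cong] = sets
  have [measurable]: "sphere 0 1 \<in> sets (borel :: complex measure)" by (intro borel_closed) simp
  obtain \<kappa> where \<kappa>: "0 < \<kappa>" "\<And>f t N B. 2 \<le> N \<Longrightarrow> 0 \<le> B \<Longrightarrow>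
    (\<And>r. r \<in> annulus_interval N \<Longrightarrow> B \<le> cmod ((deriv ^^ 1) f (of_real r * circ t))) \<Longrightarrow>
    ennreal (\<kappa> * (B * N powr (- (real 1 - 0)))) \<le> F_slice f 0 q 1 t"
    using F_slice_lower_bound[OF q, of 1 0] by blast
  define c where "c = \<kappa> * exp (- 4)"
  have c: "0 < c" using \<kappa> by (simp add: c_def)
  define C' where "C' = C powr p / c powr p"
  have C': "0 < C'" using C c by (simp add: C'_def)
  have "circ_pow_int p P \<le> ennreal C' * (\<integral>\<^sup>+ z. ennreal (cmod (P z) powr p) * indicator (sphere 0 1) z \<partial>\<mu>)"
    if P: "P holomorphic_on UNIV" for P
  proof -
    note [measurable] = entire_measurable[OF P]
    have cont: "continuous_on (cball 0 1) P" "continuous_on (cball 0 1) (deriv P)"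
      using P entire_deriv[OF P] by (auto intro: holomorphic_on_imp_continuous_on holomorphic_on_subset)
    obtain K1 where K1: "0 < K1" "\<And>z. cmod z \<le> 1 \<Longrightarrow> cmod (P z) \<le> K1" using bounded_on_cball[OF cont(1)] by blast
    obtain K2 where K2: "0 < K2" "\<And>z. cmod z \<le> 1 \<Longrightarrow> cmod (deriv P z) \<le> K2" using bounded_on_cball[OF cont(2)] by blast
    define K where "K = max K1 K2"
    have K: "0 < K" "\<And>z. cmod z \<le> 1 \<Longrightarrow> cmod (P z) \<le> K" "\<And>z. cmod z \<le> 1 \<Longrightarrow> cmod (deriv P z) \<le> K"
      using K1 K2 by (auto simp: K_def intro: max.coboundedI1 max.coboundedI2)
    define K' where "K' = 2 * K + K / exp (- 4)"
    have K': "0 \<le> K'" using K by (simp add: K'_def)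
    \<comment> \<open>\<open>A N\<close> tends to \<open>|P|\<close> on the circle; the maximum
      keeps it nonnegative where \<open>|P|\<close> is small.\<close>
    define A where "A N t = max 0 (cmod (P (circ t)) - K' / real N)" for N t
    define L where "L N = (\<integral>\<^sup>+ t. ennreal ((c * A N t) powr p) \<partial>unit_lborel)" for N
    define R where "R N = (\<integral>\<^sup>+ z. ennreal (cmod (z ^ N * P z) powr p) \<partial>\<mu>)" for N
    have le: "L N \<le> ennreal (C powr p) * R N" if N: "4 \<le> N" for N
    proof -
      define f where "f z = z ^ N * P z" for z
      have fh: "f holomorphic_on UNIV" unfolding f_def by (intro holomorphic_intros P)
      have slice: "ennreal (c * A N t) \<le> F_slice f 0 q 1 t" for t
      proof -
        have "ennreal (\<kappa> * (real N * exp (- 4) * A N t * real N powr (- (real 1 - 0)))) \<le> F_slice f 0 q 1 t"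
        proof (rule \<kappa>(2))
          fix r assume "r \<in> annulus_interval (real N)"
          then show "real N * exp (- 4) * A N t \<le> cmod ((deriv ^^ 1) f (of_real r * circ t))"
            using deriv_power_mult_lower_bound[OF P K(2,3) N, of r t] by (simp add: A_def K'_def f_def[abs_def])
        qed (use N in \<open>auto simp: A_def\<close>)
        moreover have "\<kappa> * (real N * exp (- 4) * A N t * real N powr (- (real 1 - 0))) = c * A N t"
          using N by (simp add: c_def powr_minus field_simps)
        ultimately show ?thesis by simp
      qed
      have "L N = (\<integral>\<^sup>+ t. ennreal ((c * A N t) powr p) * indicator {0..1} t \<partial>lborel)"
        unfolding L_def A_def by (rule nn_integral_unit_lborel) measurable
      also have "\<dots> \<le> F_pow f 0 p q 1" unfolding F_pow_slice
      proof (intro nn_integral_mono mult_right_mono)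
        fix t
        have "ennreal ((c * A N t) powr p) = enn_powr (ennreal (c * A N t)) p"
          using c by (simp add: enn_powr_ennreal A_def)
        also have "\<dots> \<le> enn_powr (F_slice f 0 q 1 t) p" using p slice by (intro enn_powr_mono) auto
        finally show "ennreal ((c * A N t) powr p) \<le> enn_powr (F_slice f 0 q 1 t) p" .
      qed simp
      also have "\<dots> \<le> enn_powr (HF_norm f 0 p q) p" by (rule F_pow_le_HF_norm[OF p])
      also have "\<dots> \<le> enn_powr (ennreal C * Lp_norm \<mu> p f) p"
        using fh p q by (intro enn_powr_mono C HF_norm_entire_finite) (auto intro: holomorphic_on_subset holomorphic_on_imp_continuous_on)
      also have "\<dots> = ennreal (C powr p) * R N"
        using C(1) p by (simp add: enn_powr_cmult Lp_norm_def enn_powr_powr R_def f_def)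
      finally show ?thesis .
    qed
    have limL: "L \<longlonglongrightarrow> ennreal (c powr p) * circ_pow_int p P"
    proof -
      have "L \<longlonglongrightarrow> (\<integral>\<^sup>+ t. ennreal ((c * cmod (P (circ t))) powr p) \<partial>unit_lborel)"
        unfolding L_def
      proof (rule nn_integral_dominated_convergence[where w = "\<lambda>_. ennreal ((c * K) powr p)"])
        show "AE t in unit_lborel. ennreal ((c * A N t) powr p) \<le> ennreal ((c * K) powr p)" for N
        proof (intro always_eventually allI ennreal_leI powr_mono2 mult_left_mono)
          fix t
          have "cmod (P (circ t)) \<le> K" by (rule K) simp
          moreover have "0 \<le> K' / real N" using K' by simp
          ultimately show "A N t \<le> K" using K(1) by (auto simp: A_def)
        qed (use c p in \<open>auto simp: A_def\<close>)
        show "AE t in unit_lborel. (\<lambda>N. ennreal ((c * A N t) powr p)) \<longlonglongrightarrow> ennreal ((c * cmod (P (circ t))) powr p)"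
        proof (intro always_eventually allI)
          fix t
          have "(\<lambda>N. K' / real N) \<longlonglongrightarrow> 0" by (rule lim_const_over_n)
          then have "(\<lambda>N. A N t) \<longlonglongrightarrow> max 0 (cmod (P (circ t)) - 0)"
            unfolding A_def by (intro tendsto_intros)
          then show "(\<lambda>N. ennreal ((c * A N t) powr p)) \<longlonglongrightarrow> ennreal ((c * cmod (P (circ t))) powr p)"
            using p c by (intro tendsto_ennrealI tendsto_powr' tendsto_mult_left) (auto simp: A_def)
        qed
        show "(\<lambda>t. ennreal ((c * A N t) powr p)) \<in> borel_measurable unit_lborel" for N unfolding A_def by measurable
      qed (auto simp: less_top)
      also have "(\<integral>\<^sup>+ t. ennreal ((c * cmod (P (circ t))) powr p) \<partial>unit_lborel) = ennreal (c powr p) * circ_pow_int p P"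
        unfolding circ_pow_int_def using c
        by (subst nn_integral_cmult[symmetric]) (auto simp: powr_mult ennreal_mult)
      finally show ?thesis .
    qed
    define J where "J = (\<integral>\<^sup>+ z. ennreal (cmod (P z) powr p) * indicator (sphere 0 1) z \<partial>\<mu>)"
    have limR: "R \<longlonglongrightarrow> J" unfolding R_def J_def
    proof (rule nn_integral_dominated_convergence[where w = "\<lambda>_. ennreal (K powr p)"])
      show "AE z in \<mu>. ennreal (cmod (z ^ N * P z) powr p) \<le> ennreal (K powr p)" for N
        using AE
      proof eventually_elim
        case (elim z)
        have "cmod (z ^ N * P z) \<le> 1 * K"
          unfolding norm_mult norm_power using elim K by (intro mult_mono power_le_one) auto
        then show ?case using p by (intro ennreal_leI powr_mono2) auto
      qed
      show "AE z in \<mu>. (\<lambda>N. ennreal (cmod (z ^ N * P z) powr p)) \<longlonglongrightarrow> ennreal (cmod (P z) powr p) * indicator (sphere 0 1) z"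
        using AE
      proof eventually_elim
        case (elim z)
        show ?case
        proof (cases "cmod z = 1")
          case True
          then show ?thesis by (simp add: norm_mult norm_power)
        next
          case False
          then have "(\<lambda>N. cmod z ^ N * cmod (P z)) \<longlonglongrightarrow> 0 * cmod (P z)"
            using elim by (intro tendsto_mult tendsto_const LIMSEQ_power_zero) auto
          then have "(\<lambda>N. ennreal (cmod (z ^ N * P z) powr p)) \<longlonglongrightarrow> ennreal ((0 * cmod (P z)) powr p)"
            unfolding norm_mult norm_power using p by (intro tendsto_ennrealI tendsto_powr') auto
          then show ?thesis using False by simp
        qed
      qed
      show "(\<integral>\<^sup>+ z. ennreal (K powr p) \<partial>\<mu>) < \<infinity>" using T by (simp add: ennreal_mult_less_top)
      show "(\<lambda>z. ennreal (cmod (z ^ N * P z) powr p)) \<in> borel_measurable \<mu>" for N by measurable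
      show "(\<lambda>z. ennreal (cmod (P z) powr p) * indicator (sphere 0 1) z) \<in> borel_measurable \<mu>" by measurable
    qed simp
    have "(\<lambda>N. ennreal (C powr p) * R N) \<longlonglongrightarrow> ennreal (C powr p) * J"
      using limR by (intro ennreal_tendsto_cmult ennreal_less_top)
    then have "ennreal (c powr p) * circ_pow_int p P \<le> ennreal (C powr p) * J"
      by (rule LIMSEQ_le[OF limL]) (use le in blast)
    then have "ennreal (1 / c powr p) * (ennreal (c powr p) * circ_pow_int p P) \<le> ennreal (1 / c powr p) * (ennreal (C powr p) * J)"
      by (rule mult_left_mono) simp
    moreover have "ennreal (1 / c powr p) * ennreal (c powr p) = 1" using c by (simp add: ennreal_mult[symmetric])
    moreover have "ennreal (1 / c powr p) * ennreal (C powr p) = ennreal C'"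
      using c by (simp add: ennreal_mult[symmetric] C'_def)
    ultimately show ?thesis unfolding J_def by (simp add: mult.assoc[symmetric])
  qed
  with C' show ?thesis by (rule that)
qed

text \<open>\<open>z ^ N\<close> clears the negative frequencies of a real trigonometric polynomial
  \<open>u\<close> without changing its modulus on the circle. The functions with such a numerator
  contain the constants, \<open>Re\<close> and \<open>Im\<close> and are closed under sums and
  products, so the Stone-Weierstrass theorem applies.\<close>

lemma trig_polynomial_dense:
  fixes v :: "complex \<Rightarrow> real"
  assumes v: "continuous_on (sphere 0 1) v" and e: "0 < e"
  obtains N P u where "P holomorphic_on UNIV" "\<And>z. cmod z = 1 \<Longrightarrow> P z = z ^ N * of_real (u z)"
    "\<And>z. cmod z = 1 \<Longrightarrow> \<bar>v z - u z\<bar> < e"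
proof -
  define R :: "(complex \<Rightarrow> real) \<Rightarrow> bool" where "R u \<longleftrightarrow> continuous_on (sphere 0 1) u \<and>
     (\<exists>N P. P holomorphic_on UNIV \<and> (\<forall>z. cmod z = 1 \<longrightarrow> P z = z ^ N * of_real (u z)))" for u
  have cz: "z * of_real (Re z) = (z\<^sup>2 + 1) / 2" "z * of_real (Im z) = (z\<^sup>2 - 1) / (2 * \<i>)" if "cmod z = 1" for z
  proof -
    have zz: "z * cnj z = 1" using complex_norm_square[of z] that by simp
    have "z * of_real (2 * Re z) = z * (z + cnj z)" by (simp only: complex_add_cnj)
    then have "2 * (z * of_real (Re z)) = z\<^sup>2 + 1" using zz by (simp add: distrib_left power2_eq_square mult.left_commute)
    then show "z * of_real (Re z) = (z\<^sup>2 + 1) / 2" by (intro eq_divide_imp) (simp_all add: mult.commute)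
    have "(2 * \<i>) * (z * of_real (Im z)) = z * (of_real (2 * Im z) * \<i>)"
      unfolding of_real_mult of_real_numeral by (simp only: mult.assoc mult.left_commute mult.commute)
    also have "\<dots> = z * (z - cnj z)" by (simp only: complex_diff_cnj)
    also have "\<dots> = z\<^sup>2 - 1" unfolding right_diff_distrib zz by (simp only: power2_eq_square)
    finally have "(z * of_real (Im z)) * (2 * \<i>) = z\<^sup>2 - 1" by (simp only: mult.commute)
    then show "z * of_real (Im z) = (z\<^sup>2 - 1) / (2 * \<i>)" by (rule eq_divide_imp[rotated]) simp
  qed
  have "\<exists>u. R u \<and> (\<forall>z\<in>sphere 0 1. \<bar>v z - u z\<bar> < e)"
  proof (rule Stone_Weierstrass_HOL)
    show "compact (sphere 0 1 :: complex set)" by simp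
    show "R (\<lambda>z. c)" for c
      unfolding R_def by (intro conjI continuous_intros exI[of _ 0] exI[of _ "\<lambda>z. of_real c"]) auto
    show "continuous_on (sphere 0 1) u" if "R u" for u using that by (simp add: R_def)
    show "R (\<lambda>z. f z + g z)" if fg: "R f \<and> R g" for f g
    proof -
      obtain N P M Q where *: "P holomorphic_on UNIV" "\<And>z. cmod z = 1 \<Longrightarrow> P z = z ^ N * of_real (f z)"
        "Q holomorphic_on UNIV" "\<And>z. cmod z = 1 \<Longrightarrow> Q z = z ^ M * of_real (g z)"
        using fg unfolding R_def by blast
      have "(\<lambda>z. z ^ M * P z + z ^ N * Q z) holomorphic_on UNIV" using * by (intro holomorphic_intros) auto
      moreover have "z ^ M * P z + z ^ N * Q z = z ^ (N + M) * of_real (f z + g z)" if "cmod z = 1" for z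
        using *(2)[OF that] *(4)[OF that] by (simp add: power_add algebra_simps)
      ultimately show ?thesis using fg unfolding R_def by (auto intro!: continuous_intros)
    qed
    show "R (\<lambda>z. f z * g z)" if fg: "R f \<and> R g" for f g
    proof -
      obtain N P M Q where *: "P holomorphic_on UNIV" "\<And>z. cmod z = 1 \<Longrightarrow> P z = z ^ N * of_real (f z)"
        "Q holomorphic_on UNIV" "\<And>z. cmod z = 1 \<Longrightarrow> Q z = z ^ M * of_real (g z)"
        using fg unfolding R_def by blast
      have "(\<lambda>z. P z * Q z) holomorphic_on UNIV" using * by (intro holomorphic_intros) auto
      moreover have "P z * Q z = z ^ (N + M) * of_real (f z * g z)" if "cmod z = 1" for z
        using *(2)[OF that] *(4)[OF that] by (simp add: power_add algebra_simps)
      ultimately show ?thesis using fg unfolding R_def by (auto intro!: continuous_intros)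
    qed
    have "R Re" unfolding R_def
      using cz(1) by (intro conjI continuous_intros exI[of _ 1] exI[of _ "\<lambda>z. (z\<^sup>2 + 1) / 2"]) (auto intro!: holomorphic_intros)
    moreover have "R Im" unfolding R_def
      using cz(2) by (intro conjI continuous_intros exI[of _ 1] exI[of _ "\<lambda>z. (z\<^sup>2 - 1) / (2 * \<i>)"]) (auto intro!: holomorphic_intros)
    ultimately show "\<exists>f. R f \<and> f x \<noteq> f y" if "x \<in> sphere 0 1 \<and> y \<in> sphere 0 1 \<and> x \<noteq> y" for x y
      using that complex_eq_iff by blast
  qed (use v e in auto)
  then show ?thesis using that unfolding R_def by (metis mem_sphere_0)
qed

lemma arc_length_le:
  assumes l: "0 \<le> l" "l \<le> 1"
  shows "ennreal l \<le> (\<integral>\<^sup>+ t. indicator (arc a l) (circ t) \<partial>unit_lborel)"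
proof -
  define n where "n = \<lfloor>a\<rfloor>"
  define b where "b = a - of_int n"
  have b: "0 \<le> b" "b < 1" unfolding b_def n_def by linarith+
  \<comment> \<open>With the start point shifted into [0, 1), an arc that passes 1 becomes two
    parameter intervals; the left one is half open so that they stay disjoint when
    \<open>l = 1\<close>.\<close>
  define E where "E = (if b + l \<le> 1 then {b..b + l} else {0..<b + l - 1} \<union> {b..1})"
  have [measurable]: "E \<in> sets borel" by (simp add: E_def)
  have [measurable]: "arc a l \<in> sets borel" by (intro borel_closed closed_arc)
  have E01: "E \<subseteq> {0..1}" using b l by (auto simp: E_def)
  have mem: "circ t \<in> arc a l" if "t \<in> E" for t
  proof -
    have "t + of_int n \<in> {a..a + l} \<or> t + of_int (n + 1) \<in> {a..a + l}"
      using that b l by (auto simp: E_def b_def split: if_splits)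
    then have "circ (t + of_int n) \<in> arc a l \<or> circ (t + of_int (n + 1)) \<in> arc a l"
      unfolding arc_eq_circ by blast
    then show ?thesis unfolding circ_period by simp
  qed
  have "ennreal l = emeasure lborel E"
  proof (cases "b + l \<le> 1")
    case True
    then show ?thesis using l by (simp add: E_def)
  next
    case False
    have "emeasure lborel E = emeasure lborel {0..<b + l - 1} + emeasure lborel {b..1}"
    proof -
      have "E = {0..<b + l - 1} \<union> {b..1}" using False by (simp add: E_def)
      moreover have "emeasure lborel {0..<b + l - 1} + emeasure lborel {b..1} = emeasure lborel ({0..<b + l - 1} \<union> {b..1})"
        by (rule plus_emeasure) (use l in auto)
      ultimately show ?thesis by simp
    qed
    also have "\<dots> = ennreal l" using False b l by (simp add: ennreal_plus[symmetric] del: ennreal_plus)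
    finally show ?thesis by simp
  qed
  also have "\<dots> = (\<integral>\<^sup>+ t. indicator E t \<partial>lborel)" by simp
  also have "\<dots> \<le> (\<integral>\<^sup>+ t. indicator (arc a l) (circ t) * indicator {0..1} t \<partial>lborel)"
    using mem E01 by (intro nn_integral_mono) (auto split: split_indicator)
  also have "\<dots> = (\<integral>\<^sup>+ t. indicator (arc a l) (circ t) \<partial>unit_lborel)"
    by (rule nn_integral_unit_lborel[symmetric]) measurable
  finally show ?thesis .
qed

text \<open>\<open>v k\<close> is a tent over the arc, decreasing to its indicator, and the modulus
  of an entire function follows it on the circle with error below \<open>1 / (k + 1)\<close>. These
  moduli are bounded by 2 there, so dominated convergence on both sides turns the norm inequality
  into one between arc length and \<open>\<mu>\<close>.\<close>

theorem reverse_carleson_necessary: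
  assumes \<mu>: "disc_measure \<mu>" and p: "0 < p" and q: "0 < q" and rc: "reverse_carleson \<mu> 0 p q"
  shows "\<exists>c>0. \<forall>a l. 0 \<le> l \<and> l \<le> 1 \<longrightarrow> ennreal (c * l) \<le> emeasure \<mu> (arc a l)"
proof -
  obtain C where C: "0 < C" "\<And>P. P holomorphic_on UNIV \<Longrightarrow>
    circ_pow_int p P \<le> ennreal C * (\<integral>\<^sup>+ z. ennreal (cmod (P z) powr p) * indicator (sphere 0 1) z \<partial>\<mu>)"
    using reverse_carleson_circle[OF assms] by blast
  obtain T where sets: "sets \<mu> = sets borel" and T: "space \<mu> = UNIV" "0 \<le> T" "emeasure \<mu> UNIV = ennreal T"
    using disc_measureD[OF \<mu>] .
  note [measurable_cong] = sets
  have [measurable]: "sphere 0 1 \<in> sets (borel :: complex measure)" by (intro borel_closed) simp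
  have "ennreal (1 / C * l) \<le> emeasure \<mu> (arc a l)" if l: "0 \<le> l" "l \<le> 1" for a l
  proof -
    define A where "A = arc a l"
    have clA: "closed A" unfolding A_def by (rule closed_arc)
    have [measurable]: "A \<in> sets borel" by (intro borel_closed clA)
    have A1: "cmod z = 1" if "z \<in> A" for z using that by (auto simp: A_def arc_eq_circ)
    have Ane: "A \<noteq> {}" using l by (auto simp: A_def arc_eq_circ)
    define v where "v k z = max 0 (1 - real k * infdist z A)" for k z
    have "\<exists>P. P holomorphic_on UNIV \<and> (\<forall>z. cmod z = 1 \<longrightarrow> \<bar>v k z - cmod (P z)\<bar> < inverse (real (Suc k)))" for k
    proof -
      have cont: "continuous_on (sphere 0 1) (v k)" unfolding v_def by (intro continuous_intros)
      have pos: "0 < inverse (real (Suc k))" by simp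
      obtain N P u where P: "P holomorphic_on UNIV" "\<And>z. cmod z = 1 \<Longrightarrow> P z = z ^ N * of_real (u z)"
        and u: "\<And>z. cmod z = 1 \<Longrightarrow> \<bar>v k z - u z\<bar> < inverse (real (Suc k))"
        by (rule trig_polynomial_dense[OF cont pos], rule that)
      \<comment> \<open>Since \<open>v k\<close> is nonnegative, passing from \<open>u\<close> to
        its absolute value, the modulus of \<open>P\<close>, does not increase the error.\<close>
      have abs: "\<bar>v k z - \<bar>x\<bar>\<bar> \<le> \<bar>v k z - x\<bar>" for x z by (simp add: v_def)
      show ?thesis
      proof (intro exI[of _ P] conjI allI impI P(1))
        fix z :: complex assume z: "cmod z = 1"
        have "cmod (P z) = \<bar>u z\<bar>" using P(2)[OF z] z by (simp add: norm_mult norm_power)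
        then show "\<bar>v k z - cmod (P z)\<bar> < inverse (real (Suc k))"
          using le_less_trans[OF abs u[OF z]] by simp
      qed
    qed
    then obtain P where P: "\<And>k. P k holomorphic_on UNIV"
      and vP: "\<And>k z. cmod z = 1 \<Longrightarrow> \<bar>v k z - cmod (P k z)\<bar> < inverse (real (Suc k))" by metis
    have [measurable]: "P k \<in> borel_measurable borel" for k by (rule entire_measurable[OF P])
    have bd: "cmod (P k z) \<le> 2" if "cmod z = 1" for k z
    proof -
      have "v k z \<le> 1" by (simp add: v_def infdist_nonneg)
      moreover have "inverse (real (Suc k)) \<le> 1" by (simp add: field_simps)
      ultimately show ?thesis using vP[OF that, of k] by linarith
    qed
    have lim: "(\<lambda>k. cmod (P k z)) \<longlonglongrightarrow> indicator A z" if z: "cmod z = 1" for z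
    proof -
      have "(\<lambda>k. v k z) \<longlonglongrightarrow> indicator A z"
      proof (cases "z \<in> A")
        case True
        then show ?thesis by (simp add: v_def)
      next
        case False
        then have d: "0 < infdist z A" using clA Ane by (simp add: infdist_pos_not_in_closed)
        obtain k0 where "1 / infdist z A < real k0" using reals_Archimedean2 by blast
        then have "v k z = 0" if "k0 \<le> k" for k
        proof -
          have "1 / infdist z A < real k" using \<open>1 / infdist z A < real k0\<close> that by linarith
          then show ?thesis using d by (simp add: v_def field_simps)
        qed
        then have "\<forall>\<^sub>F k in sequentially. v k z = 0" unfolding eventually_sequentially by blast
        then show ?thesis using False by (simp add: tendsto_eventually)
      qed
      moreover have "(\<lambda>k. v k z - cmod (P k z)) \<longlonglongrightarrow> 0"
        by (rule Lim_null_comparison[OF _ LIMSEQ_inverse_real_of_nat])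
           (use vP[OF z] in \<open>auto intro!: always_eventually less_imp_le\<close>)
      ultimately have "(\<lambda>k. v k z - (v k z - cmod (P k z))) \<longlonglongrightarrow> indicator A z - 0"
        by (intro tendsto_diff)
      then show ?thesis by simp
    qed
    have limp: "(\<lambda>k. ennreal (cmod (P k z) powr p)) \<longlonglongrightarrow> indicator A z" if "cmod z = 1" for z
    proof -
      have "(\<lambda>k. ennreal (cmod (P k z) powr p)) \<longlonglongrightarrow> ennreal (indicator A z powr p)"
        using p lim[OF that] by (intro tendsto_ennrealI tendsto_powr') auto
      then show ?thesis by (cases "z \<in> A") auto
    qed
    have bdp: "ennreal (cmod (P k z) powr p) \<le> ennreal (2 powr p)" if "cmod z = 1" for k z
      using p bd[OF that] by (intro ennreal_leI powr_mono2) auto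
    have L: "(\<lambda>k. circ_pow_int p (P k)) \<longlonglongrightarrow> (\<integral>\<^sup>+ t. indicator A (circ t) \<partial>unit_lborel)"
      unfolding circ_pow_int_def
    proof (rule nn_integral_dominated_convergence[where w = "\<lambda>_. ennreal (2 powr p)"])
      show "AE t in unit_lborel. ennreal (cmod (P k (circ t)) powr p) \<le> ennreal (2 powr p)" for k
        by (intro always_eventually allI bdp norm_circ)
      show "AE t in unit_lborel. (\<lambda>k. ennreal (cmod (P k (circ t)) powr p)) \<longlonglongrightarrow> indicator A (circ t)"
        by (intro always_eventually allI limp norm_circ)
    qed (simp_all add: less_top)
    have R: "(\<lambda>k. \<integral>\<^sup>+ z. ennreal (cmod (P k z) powr p) * indicator (sphere 0 1) z \<partial>\<mu>) \<longlonglongrightarrow> (\<integral>\<^sup>+ z. indicator A z \<partial>\<mu>)"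
    proof (rule nn_integral_dominated_convergence[where w = "\<lambda>_. ennreal (2 powr p)"])
      show "AE z in \<mu>. ennreal (cmod (P k z) powr p) * indicator (sphere 0 1) z \<le> ennreal (2 powr p)" for k
      proof (intro always_eventually allI)
        fix z
        show "ennreal (cmod (P k z) powr p) * indicator (sphere 0 1) z \<le> ennreal (2 powr p)"
          using bdp[of z k] by (cases "cmod z = 1") (auto simp: indicator_def)
      qed
      show "AE z in \<mu>. (\<lambda>k. ennreal (cmod (P k z) powr p) * indicator (sphere 0 1) z) \<longlonglongrightarrow> indicator A z"
      proof (intro always_eventually allI)
        fix z
        show "(\<lambda>k. ennreal (cmod (P k z) powr p) * indicator (sphere 0 1) z) \<longlonglongrightarrow> indicator A z"
          using limp[of z] A1[of z] by (cases "cmod z = 1") (auto simp: indicator_def)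
      qed
      show "(\<integral>\<^sup>+ z. ennreal (2 powr p) \<partial>\<mu>) < \<infinity>" using T by (simp add: ennreal_mult_less_top)
      show "(\<lambda>z. ennreal (cmod (P k z) powr p) * indicator (sphere 0 1) z) \<in> borel_measurable \<mu>" for k by measurable
      show "indicator A \<in> borel_measurable \<mu>" by measurable
    qed simp
    have "(\<lambda>k. ennreal C * (\<integral>\<^sup>+ z. ennreal (cmod (P k z) powr p) * indicator (sphere 0 1) z \<partial>\<mu>)) \<longlonglongrightarrow> ennreal C * (\<integral>\<^sup>+ z. indicator A z \<partial>\<mu>)"
      using R by (intro ennreal_tendsto_cmult ennreal_less_top)
    then have "(\<integral>\<^sup>+ t. indicator A (circ t) \<partial>unit_lborel) \<le> ennreal C * (\<integral>\<^sup>+ z. indicator A z \<partial>\<mu>)"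
      by (rule LIMSEQ_le[OF L]) (use C(2)[OF P] in blast)
    then have "ennreal l \<le> ennreal C * emeasure \<mu> A"
      using order_trans[OF arc_length_le[OF l, of a]] unfolding A_def[symmetric] by simp
    then have "ennreal (1 / C) * ennreal l \<le> ennreal (1 / C) * (ennreal C * emeasure \<mu> A)" by (rule mult_left_mono) simp
    moreover have "ennreal (1 / C) * ennreal C = 1" using C(1) by (simp add: ennreal_mult[symmetric])
    moreover have "ennreal (1 / C) * ennreal l = ennreal (1 / C * l)" using C(1) l by (intro ennreal_mult[symmetric]) auto
    ultimately show ?thesis unfolding A_def by (simp add: mult.assoc[symmetric])
  qed
  moreover have "0 < 1 / C" using C(1) by simp
  ultimately show ?thesis by blast
qed

section \<open>Lacunary polynomials with well-chosen signs\<close>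

text \<open>The bounds \<open>exp x \<le> 1 + x + x^2\<close> and, from
  \<open>(1 + x) (1 - x + x^2) = 1 + x^3\<close>, \<open>exp (- x) \<le> 1 - x + x^2\<close> average
  to \<open>1 + x^2\<close>. At \<open>x = 1 / sqrt n\<close> the \<open>n\<close>-th power of
  \<open>cosh\<close> is at most \<open>exp 1\<close>.\<close>

lemma cosh_le_exp_square:
  assumes "0 \<le> x" "x \<le> (1::real)"
  shows "cosh x \<le> exp (x\<^sup>2)"
proof -
  have 1: "exp x \<le> 1 + x + x\<^sup>2" using assms by (rule exp_bound)
  have "1 * 1 \<le> exp x * (1 - x + x\<^sup>2)"
  proof -
    have "0 \<le> 1 - x + x\<^sup>2" using assms by simp
    then have "(1 + x) * (1 - x + x\<^sup>2) \<le> exp x * (1 - x + x\<^sup>2)"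
      by (intro mult_right_mono exp_ge_add_one_self)
    moreover have "(1 + x) * (1 - x + x\<^sup>2) = 1 + x ^ 3" by (simp add: algebra_simps power2_eq_square power3_eq_cube)
    ultimately show ?thesis using assms zero_le_power[of x 3] by linarith
  qed
  then have 2: "exp (- x) \<le> 1 - x + x\<^sup>2" by (simp add: exp_minus field_simps)
  have "cosh x = (exp x + exp (- x)) / 2" by (simp add: cosh_def)
  also have "\<dots> \<le> 1 + x\<^sup>2" using 1 2 by simp
  also have "\<dots> \<le> exp (x\<^sup>2)" by (rule exp_ge_add_one_self)
  finally show ?thesis .
qed

text \<open>\<open>y \<le> exp y\<close> at \<open>y = x / p\<close>, raised to the power
  \<open>p\<close>, bounds every moment by an exponential one, whatever the size of
  \<open>p\<close>.\<close>

lemma powr_le_cosh: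
  assumes p: "0 < p" and x: "0 \<le> (x::real)"
  shows "x powr p \<le> 2 * p powr p * cosh x"
proof -
  have "x / p \<le> exp (x / p)" using exp_ge_add_one_self[of "x / p"] by linarith
  then have "x \<le> p * exp (x / p)" using p by (simp add: field_simps)
  then have "x powr p \<le> (p * exp (x / p)) powr p" using x p by (intro powr_mono2) auto
  also have "\<dots> = p powr p * exp x" using p by (simp add: powr_mult exp_powr_real)
  also have "exp x \<le> 2 * cosh x" by (simp add: cosh_def)
  finally show ?thesis by (simp add: mult_left_mono)
qed

lemma powr_add_le:
  assumes "0 \<le> x" "0 \<le> (y::real)" "0 < p"
  shows "(x + y) powr p \<le> 2 powr p * (x powr p + y powr p)"
proof -
  have "(x + y) powr p \<le> (2 * max x y) powr p" using assms by (intro powr_mono2) auto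
  also have "\<dots> = 2 powr p * (max x y) powr p" using assms by (simp add: powr_mult)
  also have "\<dots> \<le> 2 powr p * (x powr p + y powr p)" by (intro mult_left_mono) (auto simp: max_def)
  finally show ?thesis .
qed

text \<open>A substitute for Khinchin's inequality: one even exponential moment of the real and
  imaginary parts dominates the integrals of all powers, and the addition theorem of
  \<open>cosh\<close> controls it while signs are chosen one by one.\<close>

definition exp_moment :: "complex measure \<Rightarrow> real \<Rightarrow> (complex \<Rightarrow> complex) \<Rightarrow> ennreal" where
  "exp_moment \<mu> b S = (\<integral>\<^sup>+ z. ennreal (cosh (b * Re (S z)) + cosh (b * Im (S z))) \<partial>\<mu>)"

lemma measurable_cosh_real [measurable]: "(cosh :: real \<Rightarrow> real) \<in> borel_measurable borel"
  by (intro borel_measurable_continuous_onI continuous_intros)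

lemma cosh_add_cosh_diff: "cosh (x + y) + cosh (x - y) = 2 * cosh x * cosh (y :: real)"
  by (simp add: cosh_add cosh_diff)

text \<open>Signs are chosen greedily: by \<open>cosh (x + y) + cosh (x - y) = 2 cosh x cosh y\<close>, one of the two
  choices increases the exponential moment at most by the factor \<open>cosh b\<close>.\<close>

lemma exists_signs:
  assumes sets: "sets \<mu> = sets borel" and g: "\<And>k. g k \<in> borel_measurable borel"
    and bd: "\<And>k. AE z in \<mu>. cmod (g k z) \<le> 1" and T: "emeasure \<mu> UNIV = ennreal T" "0 \<le> T"
    and b: "0 \<le> (b::real)"
  shows "\<exists>\<epsilon> :: nat \<Rightarrow> real. (\<forall>k. \<bar>\<epsilon> k\<bar> = 1) \<and>
    exp_moment \<mu> b (\<lambda>z. \<Sum>k<n. of_real (\<epsilon> k) * g k z) \<le> ennreal (2 * T * cosh b ^ n)"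
proof (induction n)
  case 0
  have "space \<mu> = UNIV" using sets_eq_imp_space_eq[OF sets] by simp
  then have "exp_moment \<mu> b (\<lambda>z. 0) = ennreal (2 * T)"
    unfolding exp_moment_def using T by (simp add: ennreal_mult)
  then show ?case by (intro exI[of _ "\<lambda>_. 1"]) simp
next
  case (Suc n)
  note [measurable] = g
  note [measurable_cong] = sets
  obtain \<epsilon> :: "nat \<Rightarrow> real" where \<epsilon>: "\<And>k. \<bar>\<epsilon> k\<bar> = 1"
    and le: "exp_moment \<mu> b (\<lambda>z. \<Sum>k<n. of_real (\<epsilon> k) * g k z) \<le> ennreal (2 * T * cosh b ^ n)"
    using Suc by blast
  define S where "S z = (\<Sum>k<n. of_real (\<epsilon> k) * g k z)" for z
  have [measurable]: "S \<in> borel_measurable borel" unfolding S_def by measurable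
  define c where "c = ennreal (2 * T * cosh b ^ Suc n)"
  have sum: "exp_moment \<mu> b (\<lambda>z. S z + g n z) + exp_moment \<mu> b (\<lambda>z. S z - g n z) \<le> c + c"
  proof -
    have "exp_moment \<mu> b (\<lambda>z. S z + g n z) + exp_moment \<mu> b (\<lambda>z. S z - g n z) =
      (\<integral>\<^sup>+ z. ennreal (cosh (b * Re (S z + g n z)) + cosh (b * Im (S z + g n z))) +
         ennreal (cosh (b * Re (S z - g n z)) + cosh (b * Im (S z - g n z))) \<partial>\<mu>)"
      unfolding exp_moment_def by (intro nn_integral_add[symmetric]) measurable
    also have "\<dots> \<le> (\<integral>\<^sup>+ z. ennreal (2 * cosh b) * ennreal (cosh (b * Re (S z)) + cosh (b * Im (S z))) \<partial>\<mu>)"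
    proof (rule nn_integral_mono_AE)
      have step: "cosh (b * x) \<le> cosh b" if "\<bar>x\<bar> \<le> 1" for x
      proof -
        have "\<bar>b * x\<bar> \<le> b" using that b by (simp add: abs_mult mult_left_le)
        then have "cosh \<bar>b * x\<bar> \<le> cosh b" using b by (subst cosh_real_nonneg_le_iff) auto
        then show ?thesis by (simp add: cosh_real_abs)
      qed
      show "AE z in \<mu>. ennreal (cosh (b * Re (S z + g n z)) + cosh (b * Im (S z + g n z))) +
         ennreal (cosh (b * Re (S z - g n z)) + cosh (b * Im (S z - g n z))) \<le>
         ennreal (2 * cosh b) * ennreal (cosh (b * Re (S z)) + cosh (b * Im (S z)))"
        using bd[of n]
      proof eventually_elim
        case (elim z)
        have x: "\<bar>Re (g n z)\<bar> \<le> 1" "\<bar>Im (g n z)\<bar> \<le> 1"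
          using abs_Re_le_cmod[of "g n z"] abs_Im_le_cmod[of "g n z"] elim by linarith+
        have "(cosh (b * Re (S z + g n z)) + cosh (b * Im (S z + g n z))) + (cosh (b * Re (S z - g n z)) + cosh (b * Im (S z - g n z)))
          = 2 * cosh (b * Re (S z)) * cosh (b * Re (g n z)) + 2 * cosh (b * Im (S z)) * cosh (b * Im (g n z))"
          unfolding cosh_add_cosh_diff[symmetric] by (simp add: distrib_left right_diff_distrib)
        also have "\<dots> \<le> 2 * cosh (b * Re (S z)) * cosh b + 2 * cosh (b * Im (S z)) * cosh b"
          by (intro add_mono mult_left_mono step x) auto
        also have "\<dots> = 2 * cosh b * (cosh (b * Re (S z)) + cosh (b * Im (S z)))" by (simp add: algebra_simps)
        finally have "ennreal ((cosh (b * Re (S z + g n z)) + cosh (b * Im (S z + g n z))) + (cosh (b * Re (S z - g n z)) + cosh (b * Im (S z - g n z))))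
          \<le> ennreal (2 * cosh b * (cosh (b * Re (S z)) + cosh (b * Im (S z))))" by (rule ennreal_leI)
        moreover have "ennreal ((cosh (b * Re (S z + g n z)) + cosh (b * Im (S z + g n z))) + (cosh (b * Re (S z - g n z)) + cosh (b * Im (S z - g n z))))
          = ennreal (cosh (b * Re (S z + g n z)) + cosh (b * Im (S z + g n z))) + ennreal (cosh (b * Re (S z - g n z)) + cosh (b * Im (S z - g n z)))"
          by (intro ennreal_plus add_nonneg_nonneg) auto
        moreover have "ennreal (2 * cosh b * (cosh (b * Re (S z)) + cosh (b * Im (S z)))) = ennreal (2 * cosh b) * ennreal (cosh (b * Re (S z)) + cosh (b * Im (S z)))"
          by (intro ennreal_mult add_nonneg_nonneg) auto
        ultimately show ?case by simp
      qed
    qed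
    also have "\<dots> = ennreal (2 * cosh b) * exp_moment \<mu> b S"
      unfolding exp_moment_def by (rule nn_integral_cmult) measurable
    also have "\<dots> \<le> ennreal (2 * cosh b) * ennreal (2 * T * cosh b ^ n)"
      using le unfolding S_def by (rule mult_left_mono) simp
    also have "\<dots> = ennreal (2 * T * cosh b ^ Suc n + 2 * T * cosh b ^ Suc n)"
      using T by (subst ennreal_mult[symmetric]) (auto simp: mult_ac)
    also have "\<dots> = c + c" unfolding c_def using T by (intro ennreal_plus) auto
    finally show ?thesis .
  qed
  \<comment> \<open>The two moments add up to at most \<open>c + c\<close>, so they cannot both
    exceed \<open>c\<close>.\<close>
  have "exp_moment \<mu> b (\<lambda>z. S z + g n z) \<le> c \<or> exp_moment \<mu> b (\<lambda>z. S z - g n z) \<le> c"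
  proof (cases "exp_moment \<mu> b (\<lambda>z. S z + g n z) \<le> c")
    case False
    then have "c + exp_moment \<mu> b (\<lambda>z. S z - g n z) \<le> exp_moment \<mu> b (\<lambda>z. S z + g n z) + exp_moment \<mu> b (\<lambda>z. S z - g n z)"
      by (intro add_right_mono) auto
    also note sum
    finally show ?thesis
      by (auto simp: ennreal_add_left_cancel_le c_def)
  qed simp
  then obtain e :: real where e: "\<bar>e\<bar> = 1" "exp_moment \<mu> b (\<lambda>z. S z + of_real e * g n z) \<le> c"
  proof (elim disjE)
    assume "exp_moment \<mu> b (\<lambda>z. S z + g n z) \<le> c"
    then show ?thesis by (intro that[of 1]) auto
  next
    assume "exp_moment \<mu> b (\<lambda>z. S z - g n z) \<le> c"
    then show ?thesis by (intro that[of "-1"]) auto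
  qed
  have "(\<Sum>k<Suc n. of_real ((\<epsilon>(n := e)) k) * g k z) = S z + of_real e * g n z" for z
    unfolding S_def by simp
  then show ?case using e \<epsilon> unfolding c_def by (intro exI[of _ "\<epsilon>(n := e)"]) auto
qed

text \<open>These are the tails on either side of a dominant index \<open>i\<close>: for
  \<open>x \<le> 1 / 2\<close> each geometric sum is at most twice its leading term.\<close>

lemma geometric_two_sided:
  fixes x :: real
  assumes x: "0 < x" "x \<le> 1 / 2"
  shows "(\<Sum>k<i. x ^ (i - k)) \<le> 2 * x" and "Suc i \<le> n \<Longrightarrow> (\<Sum>k=Suc i..<n. x ^ (k - i)) \<le> 2 * x"
proof -
  show "(\<Sum>k<i. x ^ (i - k)) \<le> 2 * x"
  proof (induction i)
    case (Suc i)
    have "(\<Sum>k<Suc i. x ^ (Suc i - k)) = x * ((\<Sum>k<i. x ^ (i - k)) + 1)"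
    proof -
      have "(\<Sum>k<i. x ^ (Suc i - k)) = (\<Sum>k<i. x * x ^ (i - k))"
        by (intro sum.cong refl) (simp add: Suc_diff_le)
      then show ?thesis by (simp add: sum_distrib_left distrib_left)
    qed
    also have "\<dots> \<le> x * 2" using Suc x by (intro mult_left_mono) auto
    finally show ?case by simp
  qed (use x in simp)
  show "(\<Sum>k=Suc i..<n. x ^ (k - i)) \<le> 2 * x" if "Suc i \<le> n"
  proof -
    \<comment> \<open>The remainder \<open>2 * x ^ (n - i)\<close> strengthens the bound so that the
      induction on \<open>n\<close> closes.\<close>
    have "(\<Sum>k=Suc i..<n. x ^ (k - i)) + 2 * x ^ (n - i) \<le> 2 * x"
      using that
    proof (induction n rule: dec_induct)
      case (step n)
      have "2 * x ^ (Suc n - i) = (2 * x) * x ^ (n - i)" using step by (simp add: Suc_diff_le)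
      also have "\<dots> \<le> 1 * x ^ (n - i)" using x by (intro mult_right_mono) auto
      finally show ?case using step by simp
    qed simp
    moreover have "0 \<le> 2 * x ^ (n - i)" using x by simp
    ultimately show ?thesis by linarith
  qed
qed

text \<open>Around radius \<open>1 - 1 / Q ^ (i + 1)\<close> the derivative of a lacunary polynomial is dominated by
  the single term of index \<open>i\<close>.\<close>

lemma lacunary_deriv_lower_bound:
  fixes Q :: nat and \<epsilon> :: "nat \<Rightarrow> real"
  assumes Q: "4 \<le> Q" "64 * exp 4 \<le> real Q" and \<epsilon>: "\<And>k. \<bar>\<epsilon> k\<bar> = 1" and i: "i < n"
    and r: "r \<in> annulus_interval (real (Q ^ Suc i))"
  shows "real (Q ^ Suc i) * (exp (- 4) / 2) \<le>
    cmod (deriv (\<lambda>z. \<Sum>k<n. of_real (\<epsilon> k) * z ^ (Q ^ Suc k)) (of_real r * circ t))"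
proof -
  define N where "N k = Q ^ Suc k" for k
  have N4: "4 \<le> N k" for k
  proof -
    have "Q ^ 1 \<le> Q ^ Suc k" using Q by (intro power_increasing) auto
    then have "Q \<le> N k" by (simp only: N_def power_one_right)
    then show ?thesis using Q(1) by linarith
  qed
  define x where "x = 1 / real Q"
  \<comment> \<open>The lower bound on \<open>Q\<close> makes both tails together,
    \<open>32 x\<close> times \<open>N i\<close>, at most half of the main term
    \<open>exp (- 4)\<close> times \<open>N i\<close>.\<close>
  have x: "0 < x" "x \<le> 1 / 2" "x \<le> exp (- 4) / 64"
    using Q by (auto simp: x_def exp_minus field_simps)
  note rr = radius_power_ge(2,3)[OF N4[of i] r[folded N_def] order_refl]
  define z where "z = of_real r * circ t"
  have nz: "cmod z = r" using rr by (simp add: z_def norm_mult)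
  define h where "h k = of_real (\<epsilon> k) * (of_nat (N k) * z ^ (N k - 1))" for k
  have d: "deriv (\<lambda>z. \<Sum>k<n. of_real (\<epsilon> k) * z ^ (Q ^ Suc k)) z = (\<Sum>k<n. h k)"
    unfolding N_def[symmetric] h_def
    by (rule DERIV_imp_deriv) (auto intro!: derivative_eq_intros sum.cong)
  have nh: "cmod (h k) = real (N k) * r ^ (N k - 1)" for k
    by (simp add: h_def norm_mult norm_power nz \<epsilon>)
  have hi: "real (N i) * exp (- 4) \<le> cmod (h i)"
    unfolding nh by (intro mult_left_mono radius_power_ge[OF N4 r[folded N_def]]) auto
  have low: "cmod (h k) \<le> 8 * real (N i) * x ^ (i - k)" if "k < i" for k
  proof -
    have "cmod (h k) \<le> real (N k) * 1" unfolding nh using rr by (intro mult_left_mono power_le_one) auto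
    also have "real (N k) = real (N i) * x ^ (i - k)"
    proof -
      have "N i = N k * Q ^ (i - k)" using that unfolding N_def power_add[symmetric] by simp
      then show ?thesis using Q by (simp add: x_def power_divide)
    qed
    also have "real (N i) * x ^ (i - k) * 1 \<le> 8 * real (N i) * x ^ (i - k)" using x by simp
    finally show ?thesis .
  qed
  \<comment> \<open>For larger \<open>k\<close> the growth of \<open>N k\<close> by the factor
    \<open>y\<close> must be beaten by the power of \<open>r\<close>. That power is at most
    \<open>exp (- y / 2)\<close>, for which the quadratic decay \<open>8 / y^2\<close> is enough:
    \<open>8 / y\<close> remains.\<close>
  have high: "cmod (h k) \<le> 8 * real (N i) * x ^ (k - i)" if "i < k" for k
  proof -
    define y where "y = real Q ^ (k - i)"
    have Nk: "real (N k) = real (N i) * y"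
    proof -
      have "N k = N i * Q ^ (k - i)" using that unfolding N_def power_add[symmetric] by simp
      then show ?thesis by (simp add: y_def)
    qed
    have "real Q ^ 1 \<le> y" unfolding y_def using Q that by (intro power_increasing) auto
    then have y: "4 \<le> y" using Q by simp
    have Ni: "1 \<le> real (N i)" using N4[of i] by simp
    have rle: "r \<le> exp (- (1 / real (N i)))"
    proof -
      have "r \<le> 1 - 1 / real (N i)" using r by (simp add: annulus_interval_def N_def)
      also have "\<dots> \<le> exp (- (1 / real (N i)))" using exp_ge_add_one_self[of "- (1 / real (N i))"] by simp
      finally show ?thesis .
    qed
    define w where "w = real (N k - 1) / real (N i)"
    have w: "y / 2 \<le> w"
    proof -
      have "real (N k - 1) = real (N i) * y - 1" using N4[of k] Nk by (simp add: of_nat_diff)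
      then have "w = y - 1 / real (N i)" using Ni by (simp add: w_def field_simps)
      moreover have "1 / real (N i) \<le> 1" using Ni by simp
      ultimately show ?thesis using y by linarith
    qed
    have "r ^ (N k - 1) \<le> exp (- (1 / real (N i))) ^ (N k - 1)" using rr rle by (intro power_mono) auto
    also have "\<dots> = exp (- w)" by (simp add: exp_of_nat_mult[symmetric] w_def)
    also have "\<dots> \<le> 8 / y\<^sup>2"
    proof -
      have "(y / 2)\<^sup>2 \<le> w\<^sup>2" using w y by (intro power_mono) auto
      moreover have "1 + w + w\<^sup>2 / 2 \<le> exp w" using w y by (intro exp_lower_Taylor_quadratic) auto
      ultimately have "y\<^sup>2 / 8 \<le> exp w" using w y by (simp add: power_divide)
      then have "inverse (exp w) \<le> inverse (y\<^sup>2 / 8)" using y by (intro le_imp_inverse_le) auto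
      then show ?thesis by (simp add: exp_minus field_simps)
    qed
    finally have "cmod (h k) \<le> real (N k) * (8 / y\<^sup>2)" unfolding nh by (rule mult_left_mono) simp
    also have "\<dots> = 8 * real (N i) * (1 / y)" unfolding Nk using y by (simp add: power2_eq_square field_simps)
    also have "1 / y = x ^ (k - i)" by (simp add: y_def x_def power_divide)
    finally show ?thesis .
  qed
  have split: "{..<n} = insert i ({..<i} \<union> {Suc i..<n})" using i by auto
  have sumsplit: "(\<Sum>k<n. h k) = h i + ((\<Sum>k<i. h k) + (\<Sum>k=Suc i..<n. h k))"
  proof -
    have "sum h ({..<i} \<union> {Suc i..<n}) = (\<Sum>k<i. h k) + (\<Sum>k=Suc i..<n. h k)"
      by (rule sum.union_disjoint) auto
    then show ?thesis unfolding split by (subst sum.insert) auto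
  qed
  have s1: "cmod (\<Sum>k<i. h k) \<le> 8 * real (N i) * (2 * x)"
  proof -
    have "cmod (\<Sum>k<i. h k) \<le> (\<Sum>k<i. 8 * real (N i) * x ^ (i - k))" using low by (intro sum_norm_le) auto
    also have "\<dots> = 8 * real (N i) * (\<Sum>k<i. x ^ (i - k))" by (simp add: sum_distrib_left)
    also have "\<dots> \<le> 8 * real (N i) * (2 * x)" using x by (intro mult_left_mono geometric_two_sided) auto
    finally show ?thesis .
  qed
  have s2: "cmod (\<Sum>k=Suc i..<n. h k) \<le> 8 * real (N i) * (2 * x)"
  proof -
    have "cmod (\<Sum>k=Suc i..<n. h k) \<le> (\<Sum>k=Suc i..<n. 8 * real (N i) * x ^ (k - i))" using high by (intro sum_norm_le) auto
    also have "\<dots> = 8 * real (N i) * (\<Sum>k=Suc i..<n. x ^ (k - i))" by (simp add: sum_distrib_left)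
    also have "\<dots> \<le> 8 * real (N i) * (2 * x)" using x i by (intro mult_left_mono geometric_two_sided) auto
    finally show ?thesis .
  qed
  have "cmod (h i) - cmod ((\<Sum>k<i. h k) + (\<Sum>k=Suc i..<n. h k)) \<le> cmod (\<Sum>k<n. h k)"
    unfolding sumsplit by (rule norm_diff_ineq)
  moreover have "cmod ((\<Sum>k<i. h k) + (\<Sum>k=Suc i..<n. h k)) \<le> 8 * real (N i) * (2 * x) + 8 * real (N i) * (2 * x)"
    using norm_triangle_ineq[of "\<Sum>k<i. h k" "\<Sum>k=Suc i..<n. h k"] s1 s2 by linarith
  moreover have "8 * real (N i) * (2 * x) + 8 * real (N i) * (2 * x) = real (N i) * (32 * x)" by simp
  moreover have "real (N i) * (32 * x) \<le> real (N i) * (exp (- 4) / 2)" using x(3) by (intro mult_left_mono) auto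
  ultimately have "real (N i) * exp (- 4) - real (N i) * (exp (- 4) / 2) \<le> cmod (\<Sum>k<n. h k)"
    using hi by linarith
  then show ?thesis unfolding d[symmetric] z_def N_def by simp
qed

theorem no_reverse_carleson_small_q:
  assumes p: "0 < p" and q: "0 < q" "q < 2" and \<mu>: "disc_measure \<mu>"
  shows "\<not> reverse_carleson \<mu> 0 p q"
proof
  assume "reverse_carleson \<mu> 0 p q"
  then obtain C where C: "0 < C" "\<And>f. f holomorphic_on ball 0 1 \<Longrightarrow> continuous_on (cball 0 1) f \<Longrightarrow>
      HF_norm f 0 p q < top \<Longrightarrow> HF_norm f 0 p q \<le> ennreal C * Lp_norm \<mu> p f"
    unfolding reverse_carleson_def by blast
  obtain T where sets: "sets \<mu> = sets borel" and T: "space \<mu> = UNIV" "0 \<le> T" "emeasure \<mu> UNIV = ennreal T"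
    and AE: "AE z in \<mu>. cmod z \<le> 1" using disc_measureD[OF \<mu>] .
  note [measurable_cong] = sets
  have qtop: "q \<noteq> top" using q by auto
  define a where "a = enn2real q"
  have qa: "q = ennreal a" using qtop unfolding a_def by (simp add: top.not_eq_extremum)
  have a: "0 < a" "a < 2"
  proof -
    show "0 < a" using q qa by simp
    have "ennreal a < ennreal 2" using q qa by simp
    then show "a < 2" by (subst (asm) ennreal_less_iff) (auto simp: a_def)
  qed
  obtain Q :: nat where "max 4 (64 * exp 4) < real Q" using reals_Archimedean2 by blast
  then have Q: "4 \<le> Q" "64 * exp 4 \<le> real Q" by auto
  define \<kappa> where "\<kappa> = min 1 (2 powr (a - 1))"
  have \<kappa>: "0 < \<kappa>" by (simp add: \<kappa>_def)
  define c where "c = \<kappa> powr (1 / a) * (exp (- 4) / 2)"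
  have c: "0 < c" using \<kappa> by (simp add: c_def)
  define D where "D = 2 powr p * (2 * p powr p)"
  have D: "0 < D" using p by (simp add: D_def)
  define M where "M = (D * (2 * T * exp 1)) powr (1 / p)"
  have main: "c * real n powr (1 / a) \<le> C * (real n powr (1 / 2) * M)" if n: "0 < n" for n
  proof -
    \<comment> \<open>With this scale \<open>cosh b ^ n \<le> exp 1\<close> does not depend on
      \<open>n\<close>, and undoing the scaling yields the size \<open>sqrt n\<close>.\<close>
    define b where "b = 1 / sqrt (real n)"
    have b: "0 \<le> b" "b \<le> 1" "b\<^sup>2 = 1 / real n" using n by (auto simp: b_def power_divide)
    have "AE z in \<mu>. cmod (z ^ (Q ^ Suc k)) \<le> 1" for k
      using AE by eventually_elim (auto simp: norm_power intro: power_le_one)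
    then obtain \<epsilon> :: "nat \<Rightarrow> real" where \<epsilon>: "\<And>k. \<bar>\<epsilon> k\<bar> = 1"
      and mom: "exp_moment \<mu> b (\<lambda>z. \<Sum>k<n. of_real (\<epsilon> k) * z ^ (Q ^ Suc k)) \<le> ennreal (2 * T * cosh b ^ n)"
      using exists_signs[OF sets _ _ T(3,2) b(1), of "\<lambda>k z. z ^ (Q ^ Suc k)" n] by auto
    define f where "f z = (\<Sum>k<n. of_real (\<epsilon> k) * z ^ (Q ^ Suc k))" for z :: complex
    have fh: "f holomorphic_on UNIV" unfolding f_def by (intro holomorphic_intros)
    note [measurable] = entire_measurable[OF fh]
    have "cosh b ^ n \<le> exp (b\<^sup>2) ^ n" using b by (intro power_mono cosh_le_exp_square) auto
    also have "\<dots> = exp 1" using n b(3) by (simp add: exp_of_nat_mult[symmetric])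
    finally have cosh: "2 * T * cosh b ^ n \<le> 2 * T * exp 1" using T by (intro mult_left_mono) auto
    have "(\<integral>\<^sup>+ z. ennreal (cmod (f z) powr p) \<partial>\<mu>) \<le>
        (\<integral>\<^sup>+ z. ennreal (real n powr (p / 2) * D) * ennreal (cosh (b * Re (f z)) + cosh (b * Im (f z))) \<partial>\<mu>)"
    proof (rule nn_integral_mono)
      fix z
      let ?x = "\<bar>b * Re (f z)\<bar>" and ?y = "\<bar>b * Im (f z)\<bar>"
      have "b * cmod (f z) \<le> ?x + ?y"
        using mult_left_mono[OF cmod_le[of "f z"] b(1)] b(1) by (simp add: abs_mult distrib_left)
      then have "(b * cmod (f z)) powr p \<le> (?x + ?y) powr p" using b p by (intro powr_mono2) auto
      also have "\<dots> \<le> 2 powr p * (?x powr p + ?y powr p)" using p by (intro powr_add_le) auto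
      also have "\<dots> \<le> 2 powr p * (2 * p powr p * cosh ?x + 2 * p powr p * cosh ?y)"
        using p by (intro mult_left_mono add_mono powr_le_cosh) auto
      also have "\<dots> = D * (cosh (b * Re (f z)) + cosh (b * Im (f z)))"
        by (simp add: D_def cosh_real_abs distrib_left mult.assoc)
      finally have 1: "(b * cmod (f z)) powr p \<le> D * (cosh (b * Re (f z)) + cosh (b * Im (f z)))" .
      have "cmod (f z) = sqrt (real n) * (b * cmod (f z))" using n by (simp add: b_def)
      then have "cmod (f z) powr p = sqrt (real n) powr p * (b * cmod (f z)) powr p"
        using b n by (metis powr_mult real_sqrt_ge_zero of_nat_0_le_iff norm_ge_zero mult_nonneg_nonneg)
      also have "sqrt (real n) powr p = real n powr (p / 2)" using n by (simp add: powr_half_sqrt[symmetric] powr_powr)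
      also have "real n powr (p / 2) * (b * cmod (f z)) powr p \<le> real n powr (p / 2) * (D * (cosh (b * Re (f z)) + cosh (b * Im (f z))))"
        using 1 by (rule mult_left_mono) simp
      finally have "ennreal (cmod (f z) powr p) \<le> ennreal ((real n powr (p / 2) * D) * (cosh (b * Re (f z)) + cosh (b * Im (f z))))"
        by (intro ennreal_leI) (simp add: mult.assoc)
      also have "\<dots> = ennreal (real n powr (p / 2) * D) * ennreal (cosh (b * Re (f z)) + cosh (b * Im (f z)))"
        using D by (intro ennreal_mult add_nonneg_nonneg) auto
      finally show "ennreal (cmod (f z) powr p) \<le> \<dots>" .
    qed
    also have "\<dots> = ennreal (real n powr (p / 2) * D) * exp_moment \<mu> b f"
      unfolding exp_moment_def by (rule nn_integral_cmult) measurable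
    also have "\<dots> \<le> ennreal (real n powr (p / 2) * D) * ennreal (2 * T * exp 1)"
      using order_trans[OF mom[folded f_def] ennreal_leI[OF cosh]] by (rule mult_left_mono) simp
    also have "\<dots> = ennreal (real n powr (p / 2) * (D * (2 * T * exp 1)))"
      using D T by (subst ennreal_mult[symmetric]) (auto simp: mult.assoc)
    finally have "Lp_norm \<mu> p f \<le> enn_powr (ennreal (real n powr (p / 2) * (D * (2 * T * exp 1)))) (1 / p)"
      unfolding Lp_norm_def using p by (intro enn_powr_mono) auto
    also have "\<dots> = ennreal ((real n powr (p / 2) * (D * (2 * T * exp 1))) powr (1 / p))"
      using D T by (intro enn_powr_ennreal) auto
    also have "(real n powr (p / 2) * (D * (2 * T * exp 1))) powr (1 / p) = real n powr (1 / 2) * M"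
      using D T p unfolding M_def by (subst powr_mult) (auto simp: powr_powr)
    finally have Lp: "Lp_norm \<mu> p f \<le> ennreal (real n powr (1 / 2) * M)" .
    have slice: "ennreal (c * real n powr (1 / a)) \<le> F_slice f 0 q (ord_m 0) t" for t
    proof -
      \<comment> \<open>At smoothness 0 the powers of the frequency cancel: each of the
        \<open>n\<close> disjoint annuli contributes the same constant, so the inner integral is at
        least a multiple of \<open>n\<close>.\<close>
      have "ennreal (min 1 (2 powr ((real 1 - 0) * a - 1)) * (\<Sum>k<n. (real (Q ^ Suc k) * (exp (- 4) / 2)) powr a * real (Q ^ Suc k) powr (- ((real 1 - 0) * a))))
        \<le> F_inner f 0 1 a t"
      proof (rule F_inner_lower_bound)
        have Qk: "real Q ^ 1 \<le> real Q ^ Suc k" for k using Q by (intro power_increasing) auto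
        then show "2 \<le> real (Q ^ Suc k)" for k using Q order_trans[of 2 "real Q" "real Q ^ Suc k"] by (auto simp del: power_Suc)
        \<comment> \<open>A ratio of at least 4 puts \<open>2 / Q ^ Suc j\<close> strictly below
          \<open>1 / Q ^ Suc i\<close>, which separates the annuli.\<close>
        have lt: "annulus_interval (real (Q ^ Suc i)) \<inter> annulus_interval (real (Q ^ Suc j)) = {}" if "i < j" for i j
        proof -
          have "Q ^ Suc i * 4 \<le> Q ^ Suc i * Q" using Q by (intro mult_left_mono) auto
          also have "\<dots> = Q ^ Suc (Suc i)" by simp
          also have "\<dots> \<le> Q ^ Suc j" using that Q by (intro power_increasing) auto
          finally have "real (Q ^ Suc i * 4) \<le> real (Q ^ Suc j)" by (rule of_nat_mono)
          then have N: "real (Q ^ Suc i) * 4 \<le> real (Q ^ Suc j)" by simp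
          have pos: "0 < real (Q ^ Suc i)" using Q by simp
          have "2 / real (Q ^ Suc j) \<le> 2 / (real (Q ^ Suc i) * 4)"
            using N pos by (intro divide_left_mono) (auto simp del: of_nat_power power_Suc intro: mult_pos_pos less_le_trans[OF _ N])
          also have "\<dots> < 1 / real (Q ^ Suc i)" using pos by (simp add: field_simps)
          finally show ?thesis by (auto simp: annulus_interval_def simp del: of_nat_power power_Suc)
        qed
        show "annulus_interval (real (Q ^ Suc i)) \<inter> annulus_interval (real (Q ^ Suc j)) = {}" if "i \<noteq> j" for i j
          using lt[of i j] lt[of j i] that by (cases "i < j") auto
        show "real (Q ^ Suc k) * (exp (- 4) / 2) \<le> cmod ((deriv ^^ 1) f (of_real r * circ t))"
          if "k \<in> {..<n}" "r \<in> annulus_interval (real (Q ^ Suc k))" for k r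
          using lacunary_deriv_lower_bound[where n = n and t = t and \<epsilon> = \<epsilon> and i = k and r = r, OF Q \<epsilon> _ that(2)] that(1) by (simp add: f_def[abs_def] del: power_Suc)
      qed (use a in auto)
      moreover have "(real (Q ^ Suc k) * (exp (- 4) / 2)) powr a * real (Q ^ Suc k) powr (- ((real 1 - 0) * a)) = (exp (- 4) / 2) powr a" for k
      proof -
        have gen: "(N * d) powr a * N powr (- ((real 1 - 0) * a)) = d powr a" if "0 < N" "0 < d" for N d :: real
          using that by (simp add: powr_mult powr_minus)
        show ?thesis by (rule gen) (use Q in simp_all)
      qed
      ultimately have "ennreal (\<kappa> * (real n * (exp (- 4) / 2) powr a)) \<le> F_inner f 0 1 a t"
        by (simp add: \<kappa>_def)
      then have "enn_powr (ennreal (\<kappa> * (real n * (exp (- 4) / 2) powr a))) (1 / a) \<le> enn_powr (F_inner f 0 1 a t) (1 / a)"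
        using a by (intro enn_powr_mono) auto
      also have "enn_powr (ennreal (\<kappa> * (real n * (exp (- 4) / 2) powr a))) (1 / a) = ennreal ((\<kappa> * (real n * (exp (- 4) / 2) powr a)) powr (1 / a))"
        using \<kappa> by (intro enn_powr_ennreal) auto
      also have "(\<kappa> * (real n * (exp (- 4) / 2) powr a)) powr (1 / a) = c * real n powr (1 / a)"
        using \<kappa> a by (simp add: powr_mult powr_powr c_def)
      also have "enn_powr (F_inner f 0 1 a t) (1 / a) = F_slice f 0 q (ord_m 0) t"
        using qtop by (simp add: F_slice_def a_def ord_m_def)
      finally show ?thesis .
    qed
    have "ennreal (c * real n powr (1 / a)) \<le> HF_norm f 0 p q"
      by (rule HF_norm_ge_const[OF slice _ p]) (use c in auto)
    also have "\<dots> \<le> ennreal C * Lp_norm \<mu> p f"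
      using fh p q by (intro C HF_norm_entire_finite) (auto intro: holomorphic_on_subset holomorphic_on_imp_continuous_on)
    also have "\<dots> \<le> ennreal C * ennreal (real n powr (1 / 2) * M)" by (intro mult_left_mono Lp) auto
    also have "\<dots> = ennreal (C * (real n powr (1 / 2) * M))" using C(1) by (simp add: ennreal_mult' M_def)
    finally show ?thesis using C(1) by (subst (asm) ennreal_le_iff) (auto simp: M_def)
  qed
  \<comment> \<open>The gap between the growth rates \<open>1 / a\<close> and \<open>1 / 2\<close>;
    it is positive exactly because \<open>a < 2\<close>.\<close>
  define e where "e = 1 / a - 1 / 2"
  have e: "0 < e" using a by (simp add: e_def field_simps)
  define X where "X = C * M / c"
  have X: "0 \<le> X" using C(1) c by (simp add: X_def M_def)
  obtain n0 :: nat where n0: "X powr (1 / e) < real n0" using reals_Archimedean2 by blast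
  define n where "n = max n0 1"
  have n: "0 < n" "X powr (1 / e) < real n" using n0 by (auto simp: n_def)
  then have "(X powr (1 / e)) powr e < real n powr e" using e by (intro powr_less_mono2) auto
  then have "X < real n powr e" using X e by (simp add: powr_powr)
  then have "C * M * real n powr (1 / 2) < c * real n powr e * real n powr (1 / 2)"
    using c n by (intro mult_strict_right_mono) (auto simp: X_def field_simps)
  also have "c * real n powr e * real n powr (1 / 2) = c * real n powr (1 / a)"
    by (simp add: e_def powr_add[symmetric])
  also have "\<dots> \<le> C * (real n powr (1 / 2) * M)" by (rule main[OF n(1)])
  finally show False by (simp add: mult_ac)
qed

theorem theorem5p1:
  fixes s p :: real and q :: ennreal
  assumes "s \<ge> 0" and "p > 0" and "q > 0"
  shows "(s > 0 \<longrightarrow> \<not> (\<exists>\<mu>. disc_measure \<mu> \<and> reverse_carleson \<mu> s p q))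
    \<and> (2 \<le> q \<longrightarrow> (\<forall>\<mu>. disc_measure \<mu> \<longrightarrow>
          (reverse_carleson \<mu> 0 p q \<longleftrightarrow>
           (\<exists>c>0. \<forall>a l. 0 \<le> l \<and> l \<le> 1 \<longrightarrow> emeasure \<mu> (arc a l) \<ge> ennreal (c * l)))))
    \<and> (q < 2 \<longrightarrow> \<not> (\<exists>\<mu>. disc_measure \<mu> \<and> reverse_carleson \<mu> 0 p q))"
proof (intro conjI impI allI)
  show "\<not> (\<exists>\<mu>. disc_measure \<mu> \<and> reverse_carleson \<mu> s p q)" if "s > 0"
    using no_reverse_carleson_positive_smoothness[OF that assms(2,3)] by blast
  show "\<not> (\<exists>\<mu>. disc_measure \<mu> \<and> reverse_carleson \<mu> 0 p q)" if "q < 2"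
    using no_reverse_carleson_small_q[OF assms(2,3) that] by blast
  fix \<mu> :: "complex measure" assume q: "2 \<le> q" and \<mu>: "disc_measure \<mu>"
  show "reverse_carleson \<mu> 0 p q \<longleftrightarrow> (\<exists>c>0. \<forall>a l. 0 \<le> l \<and> l \<le> 1 \<longrightarrow> emeasure \<mu> (arc a l) \<ge> ennreal (c * l))"
    using reverse_carleson_necessary[OF \<mu> assms(2,3)] reverse_carleson_sufficient[OF assms(2) q \<mu>] by blast
qed

end
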